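(* Let $m,n$ be positive integers and let $\lambda\vdash mn$ be a partition with $l(\lambda)\le n$ and $\lambda_1=m+2$. (a) Suppose $m$ is even. If $\lambda$ has all parts even, then $a^\lambda_{(n),(m)}=1$. Otherwise, $a^\lambda_{(n),(m)}=0$. (b) Suppose $m$ is odd. If $\lambda$ has all parts odd, then $a^\lambda_{(1^n),(m)}=1$. Otherwise, $a^\lambda_{(1^n),(m)}=0$.
   Context: For a partition $\lambda=(\lambda_1,\lambda_2,\dotsc)$, $\lambda_1$ is its largest part and $l(\lambda)$ denotes its length (number of parts). For partitions $\lambda,\mu,\nu$, the plethysm coefficient $a^\mu_{\lambda,\nu}:=\langle s_\lambda\circ s_\nu,s_\mu\rangle$ is the multiplicity of the Schur function $s_\mu$ in the plethysm $s_\lambda\circ s_\nu$. Here $(n)$ and $(m)$ are one-part partitions, and $(1^n)$ is the partition of $n$ with all parts equal to $1$.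
   Formalization: In (b), "all parts odd" is read for λ padded with zeros to n entries, so it requires l(λ)=n; if l(λ)<n the coefficient is 0. Counting only nonzero parts, (b) fails: m=1, n=3, λ=(3) has a=⟨e_3,s_3⟩=0. *)

theory Defs
  imports "HOL-Library.Multiset" "HOL-Library.Countable"
begin

text \<open>
  A monomial in the variables \<open>x\<^sub>0, x\<^sub>1, x\<^sub>2, \<dots>\<close> is the multiset of the indices of its factors,
  so that multiplication of monomials is multiset union.  A symmetric function is a formal
  series over the integers, given by its coefficient at every monomial.
\<close>

type_synonym monom = "nat multiset"
type_synonym series = "monom \<Rightarrow> int"

definition is_partition :: "nat list \<Rightarrow> bool" where
  "is_partition lam \<longleftrightarrow> sorted_wrt (\<ge>) lam \<and> 0 \<notin> set lam"

text \<open>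
  \<open>part lam i\<close> is the part \<open>\<lambda>\<^sub>i\<^sub>+\<^sub>1\<close> (indices start at 0) of the partition continued by zeros.
  A partition with at most \<open>n\<close> parts is the \<open>n\<close>-tuple \<open>(\<lambda>\<^sub>1, \<dots>, \<lambda>\<^sub>n)\<close>, and ``all parts odd''
  refers to this tuple, so that it excludes zero entries.  With only the positive parts counted,
  \<open>\<lambda> = (3)\<close>, \<open>m = 1\<close>, \<open>n = 3\<close> would be a counterexample, as \<open>\<langle>s\<^sub>1\<^sub>1\<^sub>1 \<circ> s\<^sub>1, s\<^sub>3\<rangle> = 0\<close>.
\<close>

definition part :: "nat list \<Rightarrow> nat \<Rightarrow> nat" where
  "part lam i = (if i < length lam then lam ! i else 0)"

text \<open>Semistandard tableaux of shape \<open>lam\<close>, as the list of their rows.\<close>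

definition ssyt :: "nat list \<Rightarrow> nat list list set" where
  "ssyt lam = {T. map length T = lam \<and> (\<forall>r\<in>set T. sorted r) \<and>
     (\<forall>i j. Suc i < length T \<and> j < length (T ! Suc i) \<longrightarrow> T ! i ! j < T ! Suc i ! j)}"

definition schur :: "nat list \<Rightarrow> series" where
  "schur lam = (\<lambda>\<alpha>. int (card {T \<in> ssyt lam. mset (concat T) = \<alpha>}))"

text \<open>
  The plethysm \<open>f \<circ> g = f(y\<^sub>1, y\<^sub>2, \<dots>)\<close>, where \<open>y\<^sub>1, y\<^sub>2, \<dots>\<close> are the monomials of \<open>g\<close>, each listed
  as often as its coefficient says; this is meant for symmetric \<open>f\<close> of bounded degree and for
  \<open>g\<close> with nonnegative coefficients, such as Schur functions.  The \<open>k\<close>-th copy of the monomial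
  \<open>\<alpha>\<close> is substituted for the variable of \<open>f\<close> with number \<open>copy_index (\<alpha>, k)\<close>, and all other
  variables of \<open>f\<close> are set to zero; as \<open>f\<close> is symmetric, the choice of the injective numbering
  does not matter.  The multiset \<open>B\<close> stands for a monomial in the \<open>y\<close>'s.  The condition that
  its coefficient be nonzero keeps the sum finite even if \<open>g\<close> has a constant term.
\<close>

definition copy_index :: "monom \<times> nat \<Rightarrow> nat" where
  "copy_index = (\<lambda>(\<alpha>, k). to_nat (sorted_list_of_multiset \<alpha>, k))"

definition plethysm :: "series \<Rightarrow> series \<Rightarrow> series" where
  "plethysm f g = (\<lambda>\<gamma>.
     \<Sum>B | f (image_mset copy_index B) \<noteq> 0 \<and> (\<forall>(\<alpha>, k) \<in># B. int k < g \<alpha>) \<and>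
           (\<Sum>y\<in>#B. fst y) = \<gamma>.
       f (image_mset copy_index B))"

text \<open>
  The coefficients of a symmetric function in the basis of Schur functions, and the Hall inner
  product, for which this basis is orthonormal.
\<close>

definition schur_coeff :: "series \<Rightarrow> nat list \<Rightarrow> int" where
  "schur_coeff f = (THE c. finite {\<mu>. c \<mu> \<noteq> 0} \<and> (\<forall>\<mu>. c \<mu> \<noteq> 0 \<longrightarrow> is_partition \<mu>) \<and>
     f = (\<lambda>\<alpha>. \<Sum>\<mu> | c \<mu> \<noteq> 0. c \<mu> * schur \<mu> \<alpha>))"

definition hall_inner :: "series \<Rightarrow> series \<Rightarrow> int" where
  "hall_inner f g = (\<Sum>\<mu> | schur_coeff f \<mu> \<noteq> 0. schur_coeff f \<mu> * schur_coeff g \<mu>)"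

definition plethysm_coeff :: "nat list \<Rightarrow> nat list \<Rightarrow> nat list \<Rightarrow> int" where
  "plethysm_coeff lam \<nu> \<mu> = hall_inner (plethysm (schur lam) (schur \<nu>)) (schur \<mu>)"

end

theory Submission
  imports Defs "HOL-Combinatorics.Transposition"
begin

text \<open>
  Write \<open>F\<close> for the outer function, \<open>h\<^sub>n\<close> if \<open>m\<close> is even and \<open>e\<^sub>n\<close> if \<open>m\<close> is odd.  The involution
  \<open>\<omega>\<close> maps \<open>F \<circ> h\<^sub>m\<close> to \<open>h\<^sub>n \<circ> e\<^sub>m\<close> in both cases, so the coefficient of \<open>s\<^sub>\<lambda>\<close> becomes that of
  \<open>s\<close> of the conjugate of \<open>\<lambda>\<close> in \<open>h\<^sub>n \<circ> e\<^sub>m\<close>, and as \<open>\<lambda>\<^sub>1 = m + 2\<close> it can be read off in \<open>N = m + 2\<close>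
  variables.  There, taking complements of the \<open>m\<close>-subsets of the \<open>N\<close> variables turns \<open>h\<^sub>n \<circ> e\<^sub>m\<close>
  into \<open>h\<^sub>n \<circ> e\<^sub>2\<close>, the generating function of loopless multigraphs with \<open>n\<close> edges, and Schur
  functions into Schur functions of the complement in an \<open>N \<times> n\<close> box.  Littlewood's identity says
  that \<open>h\<^sub>n \<circ> e\<^sub>2\<close> is the sum of the \<open>s\<^sub>\<mu>\<close> with all columns of \<open>\<mu>\<close> of even length.

  The involution \<open>\<omega>\<close> is avoided by letters of two parities, where odd letters may not be repeated in a
  factor.  Both the tableaux and the products counted by the plethysm obey
  \<open>\<Sum>\<^sub>k (-1)\<^sup>k [a - k copies of an even letter, k copies of an odd letter] = 0\<close> for \<open>a > 0\<close>,
  which determines the counts in odd letters from those in even letters.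
\<close>

section \<open>Partitions as functions and Kostka numbers\<close>

text \<open>The parity condition comes from the complement in the box. Its columns, one for each of
  the \<open>n\<close> entries of the tuple, have lengths \<open>N - \<lambda>\<^sub>i\<close>, so
  all are even exactly if every entry, zeros included, has the parity of \<open>m\<close>. The
  number \<open>N = m + 2\<close> has two origins: the complement of an \<open>m\<close>-subset is
  then a pair, that is an edge, and the conjugate of \<lambda> has \<open>m + 2\<close> rows. In
  \<open>N\<close> variables exactly the Schur functions with at most \<open>N\<close> rows survive,
  and these stay independent. The width \<open>n\<close> of the box bounds the exponents, because an
  odd letter occurs at most once in each of the \<open>n\<close> factors. Identities between Schur
  functions are proved for Kostka numbers by removing the largest letter. Each then becomes a local
  statement about one or two strips: a bijection, or an involution that reverses the sign. The
  definitions, however, speak of infinitely many variables, so expansions are stated for all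
  \<open>N\<close> that bound the letters of a monomial, with coefficients independent of
  \<open>N\<close>.\<close>

definition shapes :: "(nat \<Rightarrow> nat) set" where
  "shapes = {x. antimono x \<and> finite {i. x i \<noteq> 0}}"

definition wt :: "(nat \<Rightarrow> nat) \<Rightarrow> nat" where
  "wt x = (\<Sum>i | x i \<noteq> 0. x i)"

definition hstrip :: "(nat \<Rightarrow> nat) \<Rightarrow> (nat \<Rightarrow> nat) \<Rightarrow> bool" where
  "hstrip x y \<longleftrightarrow> (\<forall>i. x (Suc i) \<le> y i \<and> y i \<le> x i)"

definition hremove :: "(nat \<Rightarrow> nat) \<Rightarrow> nat \<Rightarrow> (nat \<Rightarrow> nat) set" where
  "hremove x k = {y. hstrip x y \<and> wt x = wt y + k}"

text \<open>Chains of horizontal strips starting at \<open>x\<close>, that is tableaux of shape \<open>x\<close> with \<open>g i\<close> entries \<open>i\<close>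
  for each \<open>i < N\<close>.\<close>

primrec kostka :: "nat \<Rightarrow> (nat \<Rightarrow> nat) \<Rightarrow> (nat \<Rightarrow> nat) \<Rightarrow> int" where
  "kostka 0 x g = (if x = (\<lambda>_. 0) then 1 else 0)"
| "kostka (Suc N) x g = (\<Sum>y\<in>hremove x (g N). kostka N y g)"

lemma wt_eq_sum:
  assumes "finite A" "{i. x i \<noteq> 0} \<subseteq> A"
  shows "wt x = sum x A"
  unfolding wt_def using assms by (intro sum.mono_neutral_left) auto

lemma shapes_bound:
  assumes "x \<in> shapes"
  obtains L where "\<And>i. L \<le> i \<Longrightarrow> x i = 0"
proof -
  have "finite {i. x i \<noteq> 0}" using assms by (simp add: shapes_def)
  then obtain L where "\<And>i. x i \<noteq> 0 \<Longrightarrow> i < L"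
    unfolding finite_nat_set_iff_bounded by auto
  show ?thesis
  proof (rule that)
    show "x i = 0" if "L \<le> i" for i
      using \<open>\<And>i. x i \<noteq> 0 \<Longrightarrow> i < L\<close>[of i] that by linarith
  qed
qed

lemma wt_eq_sum_lessThan: "(\<And>i. L \<le> i \<Longrightarrow> x i = 0) \<Longrightarrow> wt x = sum x {..<L}"
proof (rule wt_eq_sum)
  assume b: "\<And>i. L \<le> i \<Longrightarrow> x i = 0"
  show "{i. x i \<noteq> 0} \<subseteq> {..<L}"
  proof
    fix i assume "i \<in> {i. x i \<noteq> 0}"
    then show "i \<in> {..<L}" using b[of i] by (cases "L \<le> i") auto
  qed
qed simp

lemma le_wt: "x \<in> shapes \<Longrightarrow> x i \<le> wt x"
  unfolding wt_def shapes_def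
  by (cases "x i = 0") (auto intro!: member_le_sum)

lemma shapes_antimono: "x \<in> shapes \<Longrightarrow> i \<le> j \<Longrightarrow> x j \<le> x i"
  by (auto simp: shapes_def antimono_def)

lemma shapesI: "(\<And>i. x (Suc i) \<le> x i) \<Longrightarrow> (\<And>i. L \<le> i \<Longrightarrow> x i = 0) \<Longrightarrow> x \<in> shapes"
proof -
  assume a: "\<And>i. x (Suc i) \<le> x i" and b: "\<And>i. L \<le> i \<Longrightarrow> x i = 0"
  have "antimono x" unfolding antimono_def using lift_Suc_antimono_le[of x] a by blast
  moreover have "{i. x i \<noteq> 0} \<subseteq> {..<L}"
  proof
    fix i assume "i \<in> {i. x i \<noteq> 0}"
    then show "i \<in> {..<L}" using b[of i] by (cases "L \<le> i") auto
  qed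
  ultimately show ?thesis unfolding shapes_def using finite_subset by blast
qed

lemma lt_wt:
  assumes "x \<in> shapes" "x i \<noteq> 0" shows "i < wt x"
proof -
  have "{..i} \<subseteq> {j. x j \<noteq> 0}"
    using shapes_antimono[OF assms(1), of _ i] assms(2) by fastforce
  then have "sum x {..i} \<le> wt x" unfolding wt_def
    using assms(1) by (intro sum_mono2) (auto simp: shapes_def)
  moreover have "sum (\<lambda>_. 1) {..i} \<le> sum x {..i}"
    using \<open>{..i} \<subseteq> {j. x j \<noteq> 0}\<close> by (intro sum_mono) (auto simp: Suc_le_eq)
  ultimately show ?thesis by simp
qed

lemma finite_shapes_wt: "finite {x \<in> shapes. wt x = d}"
proof (rule finite_subset)
  show "finite {x. \<forall>i. (i \<in> {..<d} \<longrightarrow> x i \<in> {..d}) \<and> (i \<notin> {..<d} \<longrightarrow> x i = (0::nat))}"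
    by (rule finite_set_of_finite_funs) auto
  show "{x \<in> shapes. wt x = d} \<subseteq>
    {x. \<forall>i. (i \<in> {..<d} \<longrightarrow> x i \<in> {..d}) \<and> (i \<notin> {..<d} \<longrightarrow> x i = 0)}"
  proof clarify
    fix x i assume "x \<in> shapes" and "d = wt x"
    then show "(i \<in> {..<wt x} \<longrightarrow> x i \<in> {..wt x}) \<and> (i \<notin> {..<wt x} \<longrightarrow> x i = 0)"
      using le_wt[of x i] lt_wt[of x i] by auto
  qed
qed

lemma wt_mono: "x \<in> shapes \<Longrightarrow> (\<And>i. y i \<le> x i) \<Longrightarrow> wt y \<le> wt x"
proof -
  assume a: "x \<in> shapes" and b: "\<And>i. y i \<le> x i"
  obtain L where L: "\<And>i. L \<le> i \<Longrightarrow> x i = 0" using shapes_bound[OF a] by blast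
  have L': "y i = 0" if "L \<le> i" for i using L[OF that] b[of i] by simp
  show ?thesis using b by (simp add: wt_eq_sum_lessThan[OF L] wt_eq_sum_lessThan[OF L'] sum_mono)
qed

lemma hstripD: "hstrip x y \<Longrightarrow> x (Suc i) \<le> y i" "hstrip x y \<Longrightarrow> y i \<le> x i"
  by (auto simp: hstrip_def)

lemma hstrip_shapes: "x \<in> shapes \<Longrightarrow> hstrip x y \<Longrightarrow> y \<in> shapes"
proof -
  assume a: "x \<in> shapes" and b: "hstrip x y"
  obtain L where L: "\<And>i. L \<le> i \<Longrightarrow> x i = 0" using shapes_bound[OF a] by blast
  show ?thesis
  proof (rule shapesI)
    show "y (Suc i) \<le> y i" for i using hstripD[OF b] order_trans by blast
    show "L \<le> i \<Longrightarrow> y i = 0" for i using hstripD(2)[OF b, of i] L[of i] by simp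
  qed
qed

lemma hstrip_shapes': "y \<in> shapes \<Longrightarrow> hstrip x y \<Longrightarrow> x \<in> shapes"
proof -
  assume a: "y \<in> shapes" and b: "hstrip x y"
  obtain L where L: "\<And>i. L \<le> i \<Longrightarrow> y i = 0" using shapes_bound[OF a] by blast
  show ?thesis
  proof (rule shapesI)
    show "x (Suc i) \<le> x i" for i using hstripD[OF b] order_trans by blast
    show "x i = 0" if "Suc L \<le> i" for i
    proof -
      obtain j where j: "i = Suc j" "L \<le> j" using \<open>Suc L \<le> i\<close> by (metis Suc_le_D Suc_le_mono)
      then have "x (Suc j) \<le> y j" using b by (simp add: hstrip_def)
      then show ?thesis using L[OF j(2)] j(1) by simp
    qed
  qed
qed

lemma finite_hremove: "x \<in> shapes \<Longrightarrow> finite (hremove x k)"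
  by (rule finite_subset[OF _ finite_shapes_wt[of "wt x - k"]])
     (auto simp: hremove_def hstrip_shapes)

lemma hremove_shapes: "x \<in> shapes \<Longrightarrow> y \<in> hremove x k \<Longrightarrow> y \<in> shapes"
  by (auto simp: hremove_def hstrip_shapes)

lemma zero_shapes [simp]: "(\<lambda>_. 0) \<in> shapes"
  by (auto simp: shapes_def antimono_def)

lemma wt_zero [simp]: "wt (\<lambda>_. 0) = 0"
  by (simp add: wt_def)

lemma wt_eq_0: "x \<in> shapes \<Longrightarrow> wt x = 0 \<Longrightarrow> x = (\<lambda>_. 0)"
  using le_wt[of x] by auto

text \<open>A horizontal strip has at most one cell in each column, so its removal shortens the
  shape by at most one row, and \<open>N\<close> letters fill at most \<open>N\<close> rows.\<close>

lemma kostka_support: "x \<in> shapes \<Longrightarrow> kostka N x g \<noteq> 0 \<Longrightarrow> N \<le> i \<Longrightarrow> x i = 0"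
proof (induction N arbitrary: x i)
  case (Suc N)
  from Suc.prems obtain y where y: "y \<in> hremove x (g N)" "kostka N y g \<noteq> 0"
    by (auto elim: sum.not_neutral_contains_not_neutral)
  then have "y (i - 1) = 0" using Suc.IH[of y] Suc.prems hremove_shapes by auto
  moreover obtain j where "i = Suc j" using Suc.prems(3) by (metis Suc_le_D)
  moreover have "x (Suc j) \<le> y j" using y by (simp add: hremove_def hstrip_def)
  ultimately show ?case by simp
qed (auto split: if_splits)

lemma kostka_wt: "x \<in> shapes \<Longrightarrow> kostka N x g \<noteq> 0 \<Longrightarrow> wt x = sum g {..<N}"
proof (induction N arbitrary: x)
  case (Suc N)
  from Suc.prems obtain y where y: "y \<in> hremove x (g N)" "kostka N y g \<noteq> 0"
    by (auto elim: sum.not_neutral_contains_not_neutral)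
  then show ?case using Suc.IH[of y] hremove_shapes[OF Suc.prems(1) y(1)]
    by (auto simp: hremove_def)
qed (auto split: if_splits)

lemma kostka_cong: "(\<And>i. i < N \<Longrightarrow> g i = h i) \<Longrightarrow> kostka N x g = kostka N x h"
proof (induction N arbitrary: x)
  case (Suc N)
  have "kostka N y g = kostka N y h" for y using Suc by simp
  then show ?case using Suc.prems by simp
qed simp

lemma hremove_0: assumes "x \<in> shapes" shows "hremove x 0 = {x}"
proof -
  have "y = x" if "hstrip x y" "wt x = wt y" for y
  proof -
    obtain L where L: "\<And>i. L \<le> i \<Longrightarrow> x i = 0" using shapes_bound[OF assms] by blast
    have le: "\<And>i. y i \<le> x i" using that by (auto simp: hstrip_def)
    have L': "y i = 0" if "L \<le> i" for i using L[OF that] le[of i] by simp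
    have "sum x {..<L} = sum y {..<L}"
      using that(2) by (simp add: wt_eq_sum_lessThan[OF L] wt_eq_sum_lessThan[OF L'])
    then have "\<forall>i<L. y i = x i" using le
      by (metis finite_lessThan lessThan_iff sum_mono_inv)
    then show ?thesis using L L' by (intro ext) (metis not_less)
  qed
  moreover have "hstrip x x" using assms by (auto simp: hstrip_def shapes_antimono)
  ultimately show ?thesis by (auto simp: hremove_def)
qed

lemma sum_involution_eq_0:
  fixes f :: "'a \<Rightarrow> int"
  assumes "\<And>x. x \<in> A \<Longrightarrow> t x \<in> A" "\<And>x. x \<in> A \<Longrightarrow> t (t x) = x" "\<And>x. x \<in> A \<Longrightarrow> f (t x) = - f x"
  shows "sum f A = 0"
proof -
  have "sum f A = sum (\<lambda>x. - f x) A"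
    by (rule sum.reindex_bij_witness[of _ t t]) (use assms in auto)
  then show ?thesis by (simp add: sum_negf)
qed

lemma ex_kostka_chain: "x \<in> shapes \<Longrightarrow> kostka (Suc N) x g \<noteq> 0 \<Longrightarrow> \<exists>y. y \<in> hremove x (g N) \<and> y \<in> shapes \<and> kostka N y g \<noteq> 0"
  using hremove_shapes by (auto elim!: sum.not_neutral_contains_not_neutral)

text \<open>This is the Bender-Knuth involution. For fixed \<open>x\<close> and \<open>z\<close> the
  rows of the middle shape \<open>y\<close> vary independently in intervals, and \<open>r\<close>
  reflects each row in its interval. The upper end for row 0 is \<open>x 0\<close>, since no row of
  \<open>z\<close> precedes it. The ends of all intervals add up to \<open>wt x + wt z\<close>, so
  the two strips exchange their sizes.\<close>

lemma wt_reflect: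
  assumes x: "x \<in> shapes" and z: "z \<in> shapes" and y: "hstrip x y" "hstrip y z"
  defines "r \<equiv> \<lambda>i. max (x (Suc i)) (z i) + (case i of 0 \<Rightarrow> x 0 | Suc j \<Rightarrow> min (x i) (z j)) - y i"
  shows "hstrip x r" "hstrip r z" "wt r + wt y = wt x + wt z"
    "y = (\<lambda>i. max (x (Suc i)) (z i) + (case i of 0 \<Rightarrow> x 0 | Suc j \<Rightarrow> min (x i) (z j)) - r i)"
proof -
  let ?hi = "\<lambda>i. case i of 0 \<Rightarrow> x 0 | Suc j \<Rightarrow> min (x i) (z j)"
  let ?lo = "\<lambda>i. max (x (Suc i)) (z i)"
  have b: "?lo i \<le> y i" "y i \<le> ?hi i" for i
    using y by (auto simp: hstrip_def split: nat.splits)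
  have r: "r i + y i = ?lo i + ?hi i" for i
    using b[of i] unfolding r_def by simp
  have rb: "?lo i \<le> r i" "r i \<le> ?hi i" for i
    using b[of i] r[of i] by linarith+
  show "y = (\<lambda>i. ?lo i + ?hi i - r i)"
  proof
    fix i show "y i = ?lo i + ?hi i - r i" using r[of i] by linarith
  qed
  show h: "hstrip x r" unfolding hstrip_def
  proof
    fix i show "x (Suc i) \<le> r i \<and> r i \<le> x i"
      using rb[of i] by (auto split: nat.splits)
  qed
  show "hstrip r z" unfolding hstrip_def
  proof
    fix i show "r (Suc i) \<le> z i \<and> z i \<le> r i"
      using rb[of i] rb[of "Suc i"] by auto
  qed
  obtain L where L: "\<And>i. L \<le> i \<Longrightarrow> x i = 0" using shapes_bound[OF x] by blast
  have Lx: "\<And>i. Suc L \<le> i \<Longrightarrow> x i = 0" using L by simp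
  have Ly: "y i = 0" if "Suc L \<le> i" for i using Lx[OF that] hstripD(2)[OF y(1), of i] by simp
  have Lr: "r i = 0" if "Suc L \<le> i" for i using Lx[OF that] hstripD(2)[OF h, of i] by simp
  have Lz: "z i = 0" if "L \<le> i" for i
    using L[OF that] hstripD(2)[OF y(1), of i] hstripD(2)[OF y(2), of i] by simp
  have "wt r + wt y = (\<Sum>i<Suc L. r i + y i)"
    by (simp add: wt_eq_sum_lessThan[OF Lr] wt_eq_sum_lessThan[OF Ly] sum.distrib)
  also have "\<dots> = (\<Sum>i<Suc L. ?lo i) + (\<Sum>i<Suc L. ?hi i)" by (simp only: r sum.distrib)
  \<comment> \<open>Splitting off the first row shifts the upper ends by one, which puts each
    minimum next to the maximum of the same two numbers.\<close>
  also have "(\<Sum>i<Suc L. ?hi i) = x 0 + (\<Sum>i<L. min (x (Suc i)) (z i))"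
    by (subst sum.lessThan_Suc_shift) simp
  also have "(\<Sum>i<Suc L. ?lo i) = (\<Sum>i<L. ?lo i)" using L Lz by simp
  also have "(\<Sum>i<L. ?lo i) + (x 0 + (\<Sum>i<L. min (x (Suc i)) (z i)))
      = x 0 + (\<Sum>i<L. x (Suc i) + z i)"
  proof -
    have "(\<Sum>i<L. ?lo i) + (\<Sum>i<L. min (x (Suc i)) (z i)) = (\<Sum>i<L. x (Suc i) + z i)"
      unfolding sum.distrib[symmetric] by (rule sum.cong) auto
    then show ?thesis by simp
  qed
  also have "\<dots> = wt x + wt z"
    using wt_eq_sum_lessThan[of "Suc L" x, OF Lx] wt_eq_sum_lessThan[of L z, OF Lz]
    by (simp only: sum.lessThan_Suc_shift sum.distrib)
  finally show "wt r + wt y = wt x + wt z" .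
qed

text \<open>The shape \<open>z\<close> filled by the smaller letters stays fixed; reflecting the
  shape between the strips of the letters \<open>N\<close> and \<open>Suc N\<close> exchanges the
  sizes of these strips.\<close>

lemma kostka_swap_top:
  assumes x: "x \<in> shapes"
  shows "kostka (Suc (Suc N)) x (g \<circ> transpose N (Suc N)) = kostka (Suc (Suc N)) x g"
proof -
  define r where "r = (\<lambda>(y, z) i. max (x (Suc i)) (z i) + (case i of 0 \<Rightarrow> x 0 | Suc j \<Rightarrow> min (x i) (z j)) - y i)"
  let ?g = "g \<circ> transpose N (Suc N)"
  have K: "kostka N z ?g = kostka N z g" for z by (rule kostka_cong) (auto simp: transpose_def)
  have e: "kostka (Suc (Suc N)) x h = (\<Sum>(y, z)\<in>Sigma (hremove x (h (Suc N))) (\<lambda>y. hremove y (h N)). kostka N z h)" for h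
    by (simp add: sum.Sigma finite_hremove x hremove_shapes[OF x])
  have m: "r (y, z) \<in> hremove x a" "z \<in> hremove (r (y, z)) b" "r (r (y,z), z) = y"
    if "y \<in> hremove x b" "z \<in> hremove y a" for y z a b
  proof -
    have h: "hstrip x y" "hstrip y z" and w: "wt x = wt y + b" "wt y = wt z + a"
      using that by (auto simp: hremove_def)
    have z: "z \<in> shapes" using h x hstrip_shapes by blast
    note rf = wt_reflect[OF x z h]
    show "r (y, z) \<in> hremove x a" "z \<in> hremove (r (y, z)) b"
      using rf w unfolding r_def hremove_def by auto
    show "r (r (y,z), z) = y" unfolding r_def using rf(4) by simp
  qed
  define R where "R = (\<lambda>p. (r p, snd p))"
  have R: "R p \<in> Sigma (hremove x a) (\<lambda>y. hremove y b)" "R (R p) = p"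
    if "p \<in> Sigma (hremove x b) (\<lambda>y. hremove y a)" for p a b
    using m that unfolding R_def by fastforce+
  show ?thesis unfolding e
    by (rule sum.reindex_bij_witness[of _ R R])
       (use R K in \<open>auto simp: R_def split_beta simp del: mem_Sigma_iff\<close>)
qed

lemma kostka_swap:
  assumes "x \<in> shapes" "Suc i < N"
  shows "kostka N x (g \<circ> transpose i (Suc i)) = kostka N x g"
  using assms
proof (induction N arbitrary: x)
  case (Suc N)
  show ?case
  proof (cases "Suc i = N")
    case True
    then obtain M where "N = Suc M" "i = M" by auto
    then show ?thesis using kostka_swap_top[OF Suc.prems(1)] by blast
  next
    case False
    then have "Suc i < N" using Suc.prems by simp
    then have "kostka N y (g \<circ> transpose i (Suc i)) = kostka N y g" if "y \<in> hremove x (g N)" for y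
      using Suc.IH hremove_shapes[OF Suc.prems(1) that] by blast
    moreover have "(g \<circ> transpose i (Suc i)) N = g N"
      using \<open>Suc i < N\<close> by (simp add: transpose_def)
    ultimately show ?thesis unfolding kostka.simps by (simp only: cong: sum.cong)
  qed
qed simp

section \<open>Triangularity of the Kostka numbers\<close>

text \<open>The sum of \<open>i * g i\<close> is the sum of all entries of a tableau with content
  \<open>g\<close>. Columns increase strictly, so the entries of row \<open>i\<close> are at least
  \<open>i\<close>, and equality of the sums forces every entry to be its row number. This linear
  statistic takes the place of the dominance order.\<close>

lemma kostka_triangular:
  assumes "x \<in> shapes" "kostka N x g \<noteq> 0"
  shows "(\<Sum>i<N. i * x i) \<le> (\<Sum>i<N. i * g i) \<and>
    ((\<Sum>i<N. i * x i) = (\<Sum>i<N. i * g i) \<longrightarrow> (\<forall>i<N. g i = x i))"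
  using assms
proof (induction N arbitrary: x)
  case (Suc N)
  then obtain y where y: "y \<in> hremove x (g N)" "y \<in> shapes" "kostka N y g \<noteq> 0"
    using ex_kostka_chain by blast
  note IH = Suc.IH[OF y(2,3)]
  have le: "y i \<le> x i" for i using y(1) by (simp add: hremove_def hstrip_def)
  have "wt x = sum x {..<Suc N}"
    using kostka_support[OF Suc.prems] by (intro wt_eq_sum_lessThan) blast
  moreover have "wt y = sum y {..<N}"
    using kostka_support[OF y(2,3)] by (intro wt_eq_sum_lessThan) blast
  moreover have "(\<Sum>i<N. x i) = (\<Sum>i<N. y i) + (\<Sum>i<N. x i - y i)"
    unfolding sum.distrib[symmetric] using le by simp
  ultimately have g: "g N = x N + (\<Sum>i<N. x i - y i)"
    using y(1) by (simp add: hremove_def)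
  have xs: "(\<Sum>i<Suc N. i * x i) = N * x N + (\<Sum>i<N. i * y i) + (\<Sum>i<N. i * (x i - y i))"
    unfolding add.assoc sum.distrib[symmetric] using le
    by (simp add: distrib_left[symmetric])
  have gs: "(\<Sum>i<Suc N. i * g i) = N * x N + (\<Sum>i<N. i * g i) + (\<Sum>i<N. N * (x i - y i))"
    by (simp add: g algebra_simps sum_distrib_left)
  have l: "(\<Sum>i<N. i * (x i - y i)) \<le> (\<Sum>i<N. N * (x i - y i))"
    by (rule sum_mono) simp
  show ?case
  proof (intro conjI impI)
    show "(\<Sum>i<Suc N. i * x i) \<le> (\<Sum>i<Suc N. i * g i)"
      unfolding xs gs using IH l by linarith
    assume "(\<Sum>i<Suc N. i * x i) = (\<Sum>i<Suc N. i * g i)"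
    then have e: "(\<Sum>i<N. i * y i) = (\<Sum>i<N. i * g i)"
      "(\<Sum>i<N. i * (x i - y i)) = (\<Sum>i<N. N * (x i - y i))"
      unfolding xs gs using IH l by linarith+
    have "x i = y i" if "i < N" for i
    proof -
      have "i * (x i - y i) = N * (x i - y i)"
        using sum_mono_inv[OF e(2), of i] that by simp
      then show ?thesis using le[of i] that by simp
    qed
    moreover have "\<forall>i<N. g i = y i" using IH e by blast
    ultimately show "\<forall>i<Suc N. g i = x i" using g by (simp add: less_Suc_eq)
  qed
qed simp

lemma supported_eqI:
  fixes x y :: "nat \<Rightarrow> nat"
  assumes "\<And>i. N \<le> i \<Longrightarrow> x i = 0" "\<And>i. N \<le> i \<Longrightarrow> y i = (0::nat)" "\<And>i. i < N \<Longrightarrow> x i = y i"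
  shows "x = y"
proof
  show "x i = y i" for i by (cases "N \<le> i") (use assms[of i] in \<open>auto simp: not_le\<close>)
qed

text \<open>The only such tableau has all entries of row \<open>i\<close> equal to
  \<open>i\<close>.\<close>

lemma kostka_diag:
  assumes "x \<in> shapes" "\<And>i. N \<le> i \<Longrightarrow> x i = 0"
  shows "kostka N x x = 1"
  using assms
proof (induction N arbitrary: x)
  case (Suc N)
  define y where "y = x(N := 0)"
  have a: "x (Suc i) \<le> x i" for i using shapes_antimono[OF Suc.prems(1)] by simp
  have x0: "x i = 0" if "Suc N \<le> i" for i using Suc.prems(2) that by blast
  have ys: "y \<in> shapes"
  proof (rule shapesI)
    show "y (Suc i) \<le> y i" for i using a[of i] x0[of "Suc i"] by (auto simp: y_def)
    show "N \<le> i \<Longrightarrow> y i = 0" for i using x0[of i] by (cases "i = N") (auto simp: y_def)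
  qed
  have y0: "y i = 0" if "N \<le> i" for i using x0[of i] that by (cases "i = N") (auto simp: y_def)
  have hy: "hstrip x y" unfolding hstrip_def using a x0 by (auto simp: y_def)
  have wy: "wt y = sum x {..<N}" using wt_eq_sum_lessThan[of N y, OF y0] by (simp add: y_def)
  have wx: "wt x = sum x {..<Suc N}" using wt_eq_sum_lessThan[of "Suc N" x, OF x0] by simp
  have yin: "y \<in> hremove x (x N)" using hy wy wx by (simp add: hremove_def)
  \<comment> \<open>\<open>z\<close> has at most \<open>N\<close> rows, lies inside \<open>x\<close>
    and has the weight of the first \<open>N\<close> rows of \<open>x\<close>, so it consists of
    these rows.\<close>
  have other: "kostka N z x = 0" if "z \<in> hremove x (x N) - {y}" for z
  proof (rule ccontr)
    assume nz: "kostka N z x \<noteq> 0"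
    have zs: "z \<in> shapes" using that hremove_shapes Suc.prems(1) by blast
    have z0: "z i = 0" if "N \<le> i" for i using kostka_support[OF zs nz] that by blast
    have zx: "z i \<le> x i" for i using that by (simp add: hremove_def hstrip_def)
    have "wt z = sum z {..<N}" using wt_eq_sum_lessThan[of N z, OF z0] by simp
    moreover have "wt z = sum x {..<N}" using that wx by (simp add: hremove_def)
    ultimately have "z i = x i" if "i < N" for i
      using sum_mono_inv[of z "{..<N}" x i] zx that by simp
    then have "z = y" using z0 y0 by (intro supported_eqI[of N]) (auto simp: y_def)
    then show False using that by simp
  qed
  have "kostka N y x = kostka N y y" by (rule kostka_cong) (simp add: y_def)
  also have "\<dots> = 1" using Suc.IH[OF ys] y0 by blast
  finally show ?case
    using sum.remove[OF finite_hremove[OF Suc.prems(1)] yin, of "\<lambda>y. kostka N y x"] other by simp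
qed auto

lemma kostka_triangular_eq:
  assumes "x \<in> shapes" "\<And>i. N \<le> i \<Longrightarrow> x i = 0" "\<And>i. N \<le> i \<Longrightarrow> y i = 0"
    "kostka N x y \<noteq> 0" "(\<Sum>i<N. i * y i) \<le> (\<Sum>i<N. i * x i)"
  shows "x = y"
proof -
  have "\<forall>i<N. y i = x i"
    using kostka_triangular[OF assms(1,4)] assms(5) le_antisym by blast
  then show ?thesis by (intro supported_eqI[of N]) (use assms in auto)
qed

text \<open>Take \<open>y\<close> of least rank among the shapes with nonzero coefficient: at the
  content \<open>y\<close>, triangularity leaves only the diagonal term.\<close>

lemma kostka_independent:
  assumes "finite X" "X \<subseteq> shapes" "\<And>x i. x \<in> X \<Longrightarrow> N \<le> i \<Longrightarrow> x i = 0"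
    "\<And>y. y \<in> X \<Longrightarrow> (\<Sum>x\<in>X. d x * kostka N x y) = 0" "x \<in> X"
  shows "d x = 0"
proof (rule ccontr)
  let ?r = "\<lambda>x. \<Sum>i<N. i * x i" and ?Y = "{x \<in> X. d x \<noteq> 0}"
  assume "d x \<noteq> 0"
  then have "\<exists>y. y \<in> ?Y \<and> (\<forall>z. z \<in> ?Y \<longrightarrow> ?r y \<le> ?r z)"
    using assms(5) by (intro ex_has_least_nat[of _ x]) simp
  then obtain y where y: "y \<in> X" "d y \<noteq> 0" "\<And>z. z \<in> X \<Longrightarrow> d z \<noteq> 0 \<Longrightarrow> ?r y \<le> ?r z" by blast
  have "d z * kostka N z y = 0" if "z \<in> X - {y}" for z
  proof (rule ccontr)
    assume "d z * kostka N z y \<noteq> 0"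
    then have "z = y" using y that assms by (intro kostka_triangular_eq[of z N y]) auto
    then show False using that by simp
  qed
  then have "(\<Sum>x\<in>X - {y}. d x * kostka N x y) = 0" by (rule sum.neutral[OF ballI])
  then have "(\<Sum>x\<in>X. d x * kostka N x y) = d y * kostka N y y"
    using sum.remove[OF assms(1) y(1), of "\<lambda>x. d x * kostka N x y"] by simp
  also have "kostka N y y = 1" using y(1) assms(2,3) by (intro kostka_diag) blast+
  finally show False using y assms(4) by simp
qed

text \<open>Forward substitution by increasing rank. The diagonal entries are 1, so no division
  occurs and the solution is integral.\<close>

lemma kostka_solve:
  assumes "finite X" "X \<subseteq> shapes" "\<And>x i. x \<in> X \<Longrightarrow> N \<le> i \<Longrightarrow> x i = 0"
  shows "\<exists>c. \<forall>y\<in>X. (\<Sum>x\<in>X. c x * kostka N x y) = b y"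
  using assms
proof (induction X rule: finite_ranking_induct[where f = "\<lambda>x. \<Sum>i<N. i * x i"])
  case (insert a S)
  then obtain c where c: "\<And>y. y \<in> S \<Longrightarrow> (\<Sum>x\<in>S. c x * kostka N x y) = b y" by blast
  show ?case
  proof (cases "a \<in> S")
    case True
    then show ?thesis using c by (auto simp: insert_absorb)
  next
    case False
    \<comment> \<open>The new coefficient settles the equation at \<open>a\<close>. It does not
      disturb the earlier ones, since \<open>kostka N a y\<close> vanishes for every other
      \<open>y\<close> of no larger rank.\<close>
    define c' where "c' = c(a := b a - (\<Sum>x\<in>S. c x * kostka N x a))"
    have s: "(\<Sum>x\<in>insert a S. c' x * kostka N x y) = c' a * kostka N a y + (\<Sum>x\<in>S. c x * kostka N x y)" for y
      using insert.hyps(1) False by (auto simp: c'_def intro!: sum.cong)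
    have "kostka N a a = 1" using insert.prems by (intro kostka_diag) auto
    then have "(\<Sum>x\<in>insert a S. c' x * kostka N x a) = b a" unfolding s by (simp add: c'_def)
    moreover have "(\<Sum>x\<in>insert a S. c' x * kostka N x y) = b y" if "y \<in> S" for y
    proof -
      have "kostka N a y = 0"
      proof (rule ccontr)
        assume "kostka N a y \<noteq> 0"
        then have "a = y" using insert.prems insert.hyps(2) that
          by (intro kostka_triangular_eq[of a N y]) auto
        then show False using False that by simp
      qed
      then show ?thesis unfolding s using c that by simp
    qed
    ultimately show ?thesis by blast
  qed
qed simp

section \<open>Schur functions span the symmetric functions\<close>

lemma kostka_stable:
  assumes "x \<in> shapes" "\<And>i. N \<le> i \<Longrightarrow> g i = 0" "N \<le> M"
  shows "kostka M x g = kostka N x g"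
  using assms(3)
proof (induction M rule: dec_induct)
  case (step M)
  then show ?case using assms(2)[of M] hremove_0[OF assms(1)] by simp
qed simp

lemma count_transpose: "count (image_mset (transpose i j) \<gamma>) k = count \<gamma> (transpose i j k)"
proof -
  have "transpose i j -` {k} = {transpose i j k}"
    by (auto simp: transpose_def split: if_splits)
  then have "count (image_mset (transpose i j) \<gamma>) k
      = (\<Sum>y\<in>{transpose i j k} \<inter> set_mset \<gamma>. count \<gamma> y)" by (simp add: count_image_mset)
  also have "\<dots> = count \<gamma> (transpose i j k)"
    by (cases "transpose i j k \<in># \<gamma>") (simp_all add: not_in_iff)
  finally show ?thesis .
qed

text \<open>The weakly decreasing exponent vectors of degree \<open>d\<close> fix the coefficients,
  and symmetry reaches all other monomials: while some exponent is smaller than the next one,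
  exchanging the two lowers the sum of \<open>i * count \<gamma> i\<close>. As \<open>c\<close> does
  not depend on \<open>N\<close>, the result is an expansion in infinitely many variables.\<close>

lemma kostka_span:
  assumes sym: "\<And>\<gamma> i. f (image_mset (transpose i (Suc i)) \<gamma>) = (f \<gamma> :: int)"
    and hom: "\<And>\<gamma>. f \<gamma> \<noteq> 0 \<Longrightarrow> size \<gamma> = d"
  obtains c where "\<And>N \<gamma>. set_mset \<gamma> \<subseteq> {..<N} \<Longrightarrow>
    f \<gamma> = (\<Sum>x | x \<in> shapes \<and> wt x = d. c x * kostka N x (count \<gamma>))"
proof -
  let ?X = "{x \<in> shapes. wt x = d}"
  have X: "x i = 0" if "x \<in> ?X" "d \<le> i" for x i
    using lt_wt[of x i] that by auto
  \<comment> \<open>A partition of \<open>d\<close> has at most \<open>d\<close> parts, so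
    \<open>d\<close> variables are enough to determine \<open>c\<close>.\<close>
  have "\<exists>c. \<forall>y\<in>?X. (\<Sum>x\<in>?X. c x * kostka d x y) = f (\<Sum>i<d. replicate_mset (y i) i)"
    by (rule kostka_solve) (use finite_shapes_wt X in auto)
  then obtain c where c: "\<forall>y\<in>?X. (\<Sum>x\<in>?X. c x * kostka d x y) = f (\<Sum>i<d. replicate_mset (y i) i)"
    by blast
  define D where "D = (\<lambda>N \<gamma>. f \<gamma> - (\<Sum>x\<in>?X. c x * kostka N x (count \<gamma>)))"
  have "D N \<gamma> = 0" if "set_mset \<gamma> \<subseteq> {..<N}" for N \<gamma>
    using that
  proof (induction "\<Sum>i<N. i * count \<gamma> i" arbitrary: \<gamma> rule: less_induct)
    case less
    have g0: "count \<gamma> i = 0" if "N \<le> i" for i using less.prems that by (auto simp: not_in_iff[symmetric])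
    have sz: "size \<gamma> = sum (count \<gamma>) {..<N}"
      unfolding size_multiset_overloaded_eq using g0 less.prems
      by (intro sum.mono_neutral_left) (auto simp: not_in_iff)
    show ?case
    proof (cases "\<forall>i. Suc i < N \<longrightarrow> count \<gamma> (Suc i) \<le> count \<gamma> i")
      case True
      have gs: "count \<gamma> \<in> shapes"
      proof (rule shapesI)
        show "count \<gamma> (Suc i) \<le> count \<gamma> i" for i
          using True g0[of "Suc i"] by (cases "Suc i < N") auto
      qed (rule g0)
      have wg: "wt (count \<gamma>) = size \<gamma>"
        using wt_eq_sum_lessThan[of N "count \<gamma>", OF g0] sz by simp
      show ?thesis
      proof (cases "size \<gamma> = d")
        case False
        then have "f \<gamma> = 0" using hom by blast
        moreover have "kostka N x (count \<gamma>) = 0" if "x \<in> ?X" for x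
          using kostka_wt[of x N "count \<gamma>"] that sz False by auto
        ultimately show ?thesis by (simp add: D_def)
      next
        case sd: True
        then have gX: "count \<gamma> \<in> ?X" using gs wg by simp
        have g0': "count \<gamma> i = 0" if "d \<le> i" for i using X[OF gX that] .
        have "kostka N x (count \<gamma>) = kostka d x (count \<gamma>)" if "x \<in> ?X" for x
        proof -
          have "x \<in> shapes" using that by simp
          then show ?thesis
            using kostka_stable[of x N "count \<gamma>" d] kostka_stable[of x d "count \<gamma>" N] g0 g0'
            by (cases "N \<le> d") auto
        qed
        moreover have "(\<Sum>i<d. replicate_mset (count \<gamma> i) i) = \<gamma>"
        proof (rule multiset_eqI)
          fix a
          have "count (\<Sum>i<d. replicate_mset (count \<gamma> i) i) a = (\<Sum>i<d. if i = a then count \<gamma> a else 0)"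
            unfolding count_sum by (intro sum.cong) auto
          then show "count (\<Sum>i<d. replicate_mset (count \<gamma> i) i) a = count \<gamma> a"
            using g0'[of a] by auto
        qed
        moreover note c[rule_format, OF gX]
        ultimately show ?thesis unfolding D_def by simp
      qed
    next
      case False
      then obtain i where i: "Suc i < N" "count \<gamma> i < count \<gamma> (Suc i)" by (auto simp: not_le)
      let ?\<gamma> = "image_mset (transpose i (Suc i)) \<gamma>"
      have "count ?\<gamma> = count \<gamma> \<circ> transpose i (Suc i)" by (rule ext) (simp add: count_transpose)
      then have "D N ?\<gamma> = D N \<gamma>"
        unfolding D_def sym using kostka_swap[OF _ i(1)] by (auto intro!: sum.cong)
      moreover have "set_mset ?\<gamma> \<subseteq> {..<N}"
        using less.prems i(1) by (auto simp: transpose_def)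
      moreover have "(\<Sum>j<N. j * count ?\<gamma> j) < (\<Sum>j<N. j * count \<gamma> j)"
      proof -
        have split: "(\<Sum>j<N. h j) = (\<Sum>j\<in>{..<N} - {i, Suc i}. h j) + (h i + h (Suc i))" for h :: "nat \<Rightarrow> nat"
          using sum.subset_diff[of "{i, Suc i}" "{..<N}" h] i(1) by simp
        have "(\<Sum>j\<in>{..<N} - {i, Suc i}. j * count ?\<gamma> j) = (\<Sum>j\<in>{..<N} - {i, Suc i}. j * count \<gamma> j)"
          by (intro sum.cong) (auto simp: count_transpose transpose_def)
        then show ?thesis unfolding split[of "\<lambda>j. j * count ?\<gamma> j"] split[of "\<lambda>j. j * count \<gamma> j"]
          using i(2) by (simp add: count_transpose)
      qed
      ultimately show ?thesis using less.hyps by simp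
    qed
  qed
  then show ?thesis by (intro that[of c]) (simp add: D_def)
qed

section \<open>Semistandard tableaux\<close>

lemma ssyt_map_iff: "T \<in> ssyt (map x [0..<L]) \<longleftrightarrow> length T = L \<and>
    (\<forall>i<L. length (T ! i) = x i \<and> sorted (T ! i)) \<and>
    (\<forall>i j. Suc i < L \<longrightarrow> j < x (Suc i) \<longrightarrow> T ! i ! j < T ! Suc i ! j)"
proof -
  have "map length T = map x [0..<L] \<longleftrightarrow> length T = L \<and> (\<forall>i<L. length (T ! i) = x i)"
    unfolding list_eq_iff_nth_eq by auto
  then show ?thesis unfolding ssyt_def mem_Collect_eq all_set_conv_all_nth by auto
qed

lemma sorted_filter_less:
  assumes "sorted r" "\<forall>a\<in>set r. a \<le> N"
  shows "filter (\<lambda>a. a < N) r @ replicate (length r - length (filter (\<lambda>a. a < N) r)) N = (r :: nat list)"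
  using assms
proof (induction r)
  case (Cons a r)
  show ?case
  proof (cases "a < N")
    case False
    then have "\<forall>b\<in>set (a # r). b = N" using Cons.prems by (auto intro: le_antisym)
    then have "a # r = replicate (length (a # r)) N" "filter (\<lambda>a. a < N) (a # r) = []"
      by (auto simp: filter_empty_conv intro!: replicate_eqI)
    then show ?thesis by simp
  qed (use Cons in auto)
qed simp

text \<open>The number \<open>L\<close> of rows is fixed and rows may be empty, so that it does not
  change when whole rows disappear with the removal of the largest letter.\<close>

definition tableaux :: "nat \<Rightarrow> (nat \<Rightarrow> nat) \<Rightarrow> monom \<Rightarrow> nat list list set" where
  "tableaux L x \<gamma> = {T \<in> ssyt (map x [0..<L]). mset (concat T) = \<gamma>}"

definition trunc :: "nat \<Rightarrow> nat list list \<Rightarrow> nat list list" where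
  "trunc N T = map (filter (\<lambda>a. a < N)) T"

definition shape_of :: "nat list list \<Rightarrow> nat \<Rightarrow> nat" where
  "shape_of T i = (if i < length T then length (T ! i) else 0)"

definition extend :: "nat \<Rightarrow> (nat \<Rightarrow> nat) \<Rightarrow> nat list list \<Rightarrow> nat list list" where
  "extend N x T = map (\<lambda>i. T ! i @ replicate (x i - length (T ! i)) N) [0..<length T]"

lemma tableaux_iff: "T \<in> tableaux L x \<gamma> \<longleftrightarrow> length T = L \<and>
    (\<forall>i<L. length (T ! i) = x i \<and> sorted (T ! i)) \<and>
    (\<forall>i j. Suc i < L \<longrightarrow> j < x (Suc i) \<longrightarrow> T ! i ! j < T ! Suc i ! j) \<and> mset (concat T) = \<gamma>"
  by (simp add: tableaux_def ssyt_map_iff)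

lemma tableaux_shape:
  assumes "T \<in> tableaux L x \<gamma>" "\<And>i. L \<le> i \<Longrightarrow> x i = 0"
  shows "shape_of T = x"
  by (rule supported_eqI[of L]) (use assms in \<open>auto simp: shape_of_def tableaux_iff\<close>)

lemma tableaux_entries:
  assumes "T \<in> tableaux L x \<gamma>" "i < L" "a \<in> set (T ! i)"
  shows "a \<in># \<gamma>"
proof -
  have "a \<in> set (concat T)" using assms by (auto simp: tableaux_iff)
  then show ?thesis using assms(1) by (auto simp: tableaux_iff simp flip: set_mset_mset)
qed

lemma tableaux_wt:
  assumes "T \<in> tableaux L x \<gamma>" "\<And>i. L \<le> i \<Longrightarrow> x i = 0"
  shows "wt x = size \<gamma>"
proof -
  have "map length T = map x [0..<L]" using assms(1) by (auto simp: tableaux_def ssyt_def)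
  then have "size (mset (concat T)) = sum x {..<L}"
    by (simp add: length_concat interv_sum_list_conv_sum_set_nat atLeast0LessThan)
  then show ?thesis using assms(1) wt_eq_sum_lessThan[of L x, OF assms(2)]
    by (auto simp add: tableaux_iff)
qed

lemma extend_trunc:
  assumes "T \<in> tableaux L x \<gamma>" "set_mset \<gamma> \<subseteq> {..<Suc N}"
  shows "extend N x (trunc N T) = T"
proof (rule nth_equalityI)
  show "length (extend N x (trunc N T)) = length T" by (simp add: extend_def trunc_def)
  fix i assume "i < length (extend N x (trunc N T))"
  then have i: "i < L" "i < length T" using assms(1) by (auto simp: extend_def trunc_def tableaux_iff)
  have "sorted (T ! i)" "length (T ! i) = x i" using assms(1) i by (auto simp: tableaux_iff)
  moreover have "\<forall>a\<in>set (T ! i). a \<le> N"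
    using tableaux_entries[OF assms(1) i(1)] assms(2) by fastforce
  ultimately show "extend N x (trunc N T) ! i = T ! i"
    using i sorted_filter_less[of "T ! i" N] by (simp add: extend_def trunc_def)
qed

lemma trunc_extend:
  assumes "T \<in> tableaux L y \<gamma>" "set_mset \<gamma> \<subseteq> {..<N}"
  shows "trunc N (extend N x T) = T"
proof (rule nth_equalityI)
  show "length (trunc N (extend N x T)) = length T" by (simp add: extend_def trunc_def)
  fix i assume "i < length (trunc N (extend N x T))"
  then have i: "i < L" "i < length T" using assms(1) by (auto simp: extend_def trunc_def tableaux_iff)
  have "\<forall>a\<in>set (T ! i). a < N"
    using tableaux_entries[OF assms(1) i(1)] assms(2) by fastforce
  then have "filter (\<lambda>a. a < N) (T ! i) = T ! i" by simp
  then show "trunc N (extend N x T) ! i = T ! i"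
    using i by (simp add: extend_def trunc_def)
qed

lemma filter_less_add_top:
  assumes "set_mset \<gamma> \<subseteq> {..<Suc N}"
  shows "filter_mset (\<lambda>a. a < N) \<gamma> + replicate_mset (count \<gamma> N) N = \<gamma>"
proof (rule multiset_eqI)
  fix a
  have "count \<gamma> a = 0" if "N < a"
  proof -
    have "a \<notin># \<gamma>" using assms that by auto
    then show ?thesis by (simp add: not_in_iff)
  qed
  then show "count (filter_mset (\<lambda>a. a < N) \<gamma> + replicate_mset (count \<gamma> N) N) a = count \<gamma> a"
    by (cases a N rule: linorder_cases) auto
qed

text \<open>Two copies of the largest letter cannot lie in one column, so they form a horizontal
  strip.\<close>

lemma trunc_tableaux:
  assumes T: "T \<in> tableaux L x \<gamma>" and \<gamma>: "set_mset \<gamma> \<subseteq> {..<Suc N}"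
    and x: "x \<in> shapes" and L: "\<And>i. L \<le> i \<Longrightarrow> x i = 0"
  shows "shape_of (trunc N T) \<in> hremove x (count \<gamma> N)"
    "trunc N T \<in> tableaux L (shape_of (trunc N T)) (filter_mset (\<lambda>a. a < N) \<gamma>)"
proof -
  define y where "y = shape_of (trunc N T)"
  define r where "r = (\<lambda>i. filter (\<lambda>a. a < N) (T ! i))"
  have len: "length T = L" using T by (simp add: tableaux_iff)
  have yi: "y i = length (r i)" if "i < L" for i
    using that len by (simp add: y_def r_def shape_of_def trunc_def)
  have y0: "y i = 0" if "L \<le> i" for i using that len by (simp add: y_def shape_of_def trunc_def)
  have row: "r i @ replicate (x i - y i) N = T ! i" if i: "i < L" for i
  proof -
    have "sorted (T ! i)" "length (T ! i) = x i" using T i by (auto simp: tableaux_iff)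
    moreover have "\<forall>a\<in>set (T ! i). a \<le> N"
      using tableaux_entries[OF T i(1)] \<gamma> by fastforce
    ultimately show ?thesis using sorted_filter_less[of "T ! i" N] yi[OF i] by (simp add: r_def)
  qed
  have rlt: "r i ! j < N" if "j < length (r i)" for i j
    using nth_mem[OF that] by (simp add: r_def)
  have nth: "T ! i ! j = (if j < y i then r i ! j else N)" if "i < L" "j < x i" for i j
  proof -
    have "T ! i ! j = (r i @ replicate (x i - y i) N) ! j" using row that by simp
    then show ?thesis using that yi by (auto simp: nth_append)
  qed
  have yx: "y i \<le> x i" for i
  proof (cases "i < L")
    case True
    then have "length (T ! i) = x i" using T by (auto simp: tableaux_iff)
    then show ?thesis using yi[OF True] length_filter_le[of "\<lambda>a. a < N" "T ! i"] by (simp add: r_def)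
  qed (use y0 in auto)
  have col: "T ! i ! j < T ! Suc i ! j" if "Suc i < L" "j < x (Suc i)" for i j
    using T that by (auto simp: tableaux_iff)
  have xd: "x (Suc i) \<le> x i" for i using shapes_antimono[OF x] by simp
  have hs: "x (Suc i) \<le> y i" for i
  proof (cases "Suc i < L \<and> 0 < x (Suc i)")
    case True
    then have i: "Suc i < L" "0 < x (Suc i)" by auto
    show ?thesis
    proof (rule ccontr)
      \<comment> \<open>Otherwise column \<open>y i\<close> has the largest letter \<open>N\<close>
        in row \<open>i\<close> and a still larger entry beneath it.\<close>
      assume "\<not> x (Suc i) \<le> y i"
      then have "y i < x (Suc i)" by simp
      then have "T ! i ! y i < T ! Suc i ! y i" "T ! i ! y i = N"
        using col[OF i(1)] nth[of i "y i"] i xd[of i] by auto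
      moreover have "T ! Suc i ! y i \<le> N"
        using nth[of "Suc i" "y i"] \<open>y i < x (Suc i)\<close> i(1) yi[of "Suc i"] rlt[of "y i" "Suc i"]
        by (simp add: less_imp_le)
      ultimately show False by simp
    qed
  qed (use L[of "Suc i"] in auto)
  have "mset (concat (trunc N T)) = filter_mset (\<lambda>a. a < N) \<gamma>"
    using T by (auto simp: trunc_def tableaux_iff filter_concat[symmetric] mset_filter)
  then have t: "trunc N T \<in> tableaux L y (filter_mset (\<lambda>a. a < N) \<gamma>)"
    unfolding tableaux_iff
  proof (intro conjI allI impI)
    show "length (trunc N T) = L" using len by (simp add: trunc_def)
    fix i assume i: "i < L"
    show "length (trunc N T ! i) = y i" using i len yi by (simp add: trunc_def r_def)
    show "sorted (trunc N T ! i)" using T i len by (simp add: trunc_def tableaux_iff sorted_filter[of id, simplified])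
  next
    fix i j assume i: "Suc i < L" "j < y (Suc i)"
    then have "j < x (Suc i)" using yx less_le_trans by blast
    moreover have "j < y i" using calculation hs less_le_trans by blast
    ultimately show "trunc N T ! i ! j < trunc N T ! Suc i ! j"
      using col[of i j] nth[of i j] nth[of "Suc i" j] i len xd[of i] by (simp add: trunc_def r_def)
  qed
  then show "trunc N T \<in> tableaux L (shape_of (trunc N T)) (filter_mset (\<lambda>a. a < N) \<gamma>)"
    by (simp add: y_def)
  have "size \<gamma> = size (filter_mset (\<lambda>a. a < N) \<gamma>) + count \<gamma> N"
    using arg_cong[OF filter_less_add_top[OF \<gamma>], of size] by simp
  then show "shape_of (trunc N T) \<in> hremove x (count \<gamma> N)"
    using tableaux_wt[OF T L] tableaux_wt[OF t y0] hs yx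
    by (simp add: hremove_def hstrip_def flip: y_def)
qed

lemma mset_concat_append:
  "mset (concat (map (\<lambda>i. f i @ g i) xs)) = mset (concat (map f xs)) + mset (concat (map g xs))"
  by (induction xs) auto

lemma concat_map_replicate: "concat (map (\<lambda>i. replicate (h i) a) xs) = replicate (sum_list (map h xs)) a"
  by (induction xs) (auto simp: replicate_add)

text \<open>Because \<open>x (Suc i) \<le> y i\<close>, the cell above any cell of row
  \<open>Suc i\<close> holds an old letter, which is smaller than \<open>N\<close>; so columns stay
  strictly increasing.\<close>

lemma extend_tableaux:
  assumes y: "y \<in> hremove x k" and T: "T \<in> tableaux L y \<gamma>" and \<gamma>: "set_mset \<gamma> \<subseteq> {..<N}"
    and x: "x \<in> shapes" and L: "\<And>i. L \<le> i \<Longrightarrow> x i = 0"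
  shows "extend N x T \<in> tableaux L x (\<gamma> + replicate_mset k N)"
  unfolding tableaux_iff
proof (intro conjI allI impI)
  have len: "length T = L" using T by (simp add: tableaux_iff)
  then show "length (extend N x T) = L" by (simp add: extend_def)
  have yx: "y i \<le> x i" "x (Suc i) \<le> y i" for i using y by (auto simp: hremove_def hstrip_def)
  have y0: "y i = 0" if "L \<le> i" for i using yx[of i] L[OF that] by simp
  have leny: "length (T ! i) = y i" if "i < L" for i using T that by (auto simp: tableaux_iff)
  have lt: "a < N" if "a \<in> set (T ! i)" "i < L" for i a
    using tableaux_entries[OF T] \<gamma> that by fastforce
  {
    fix i assume i: "i < L"
    show "length (extend N x T ! i) = x i" using i len leny yx by (simp add: extend_def)
    have "sorted (T ! i)" using T i by (auto simp: tableaux_iff)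
    then show "sorted (extend N x T ! i)" using i len lt[of _ i]
      by (auto simp: extend_def sorted_append order.strict_implies_order)
  next
    fix i j assume i: "Suc i < L" "j < x (Suc i)"
    then have j: "j < y i" using yx less_le_trans by blast
    then have "T ! i ! j < N" using lt[of "T ! i ! j" i] nth_mem[of j "T ! i"] i leny[of i] by simp
    moreover have "T ! i ! j < T ! Suc i ! j" if "j < y (Suc i)" using T i that by (auto simp: tableaux_iff)
    ultimately show "extend N x T ! i ! j < extend N x T ! Suc i ! j"
      using i j len leny by (auto simp: extend_def nth_append)
  }
  have "(\<Sum>i<L. x i) = (\<Sum>i<L. y i) + (\<Sum>i<L. x i - length (T ! i))"
    unfolding sum.distrib[symmetric] using yx leny by (intro sum.cong) auto
  moreover have "wt x = wt y + k" using y by (simp add: hremove_def)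
  ultimately have k: "(\<Sum>i<L. x i - length (T ! i)) = k"
    using wt_eq_sum_lessThan[of L x, OF L] wt_eq_sum_lessThan[of L y, OF y0] by simp
  have "map ((!) T) [0..<length T] = T" by (rule map_nth)
  then show "mset (concat (extend N x T)) = \<gamma> + replicate_mset k N"
    using T k len unfolding extend_def mset_concat_append concat_map_replicate
    by (simp add: tableaux_iff interv_sum_list_conv_sum_set_nat atLeast0LessThan)
qed

text \<open>Removing the largest letter is a bijection onto pairs of a shape \<open>y\<close> in
  \<open>hremove\<close> and a tableau of that shape, which is the recursion of
  \<open>kostka\<close>.\<close>

lemma card_tableaux:
  assumes "x \<in> shapes" "\<And>i. L \<le> i \<Longrightarrow> x i = 0" "set_mset \<gamma> \<subseteq> {..<N}"
  shows "finite (tableaux L x \<gamma>) \<and> int (card (tableaux L x \<gamma>)) = kostka N x (count \<gamma>)"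
  using assms
proof (induction N arbitrary: x \<gamma>)
  case 0
  then have g: "\<gamma> = {#}" by simp
  show ?case
  proof (cases "x = (\<lambda>_. 0)")
    case True
    have "T = replicate L []" if "T \<in> tableaux L (\<lambda>_. 0) {#}" for T
      using that by (intro nth_equalityI) (auto simp: tableaux_iff)
    moreover have "replicate L [] \<in> tableaux L (\<lambda>_. 0) {#}"
      by (simp add: tableaux_iff concat_replicate_trivial)
    ultimately have "tableaux L x \<gamma> = {replicate L []}" unfolding True g by blast
    then show ?thesis using True by simp
  next
    case False
    have "T \<notin> tableaux L x \<gamma>" for T
      using tableaux_wt[of T L x \<gamma>, OF _ 0(2)] wt_eq_0[OF 0(1)] False g by fastforce
    then have "tableaux L x \<gamma> = {}" by blast
    then show ?thesis using False by simp
  qed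
next
  case (Suc N)
  let ?\<gamma> = "filter_mset (\<lambda>a. a < N) \<gamma>"
  let ?S = "SIGMA y:hremove x (count \<gamma> N). tableaux L y ?\<gamma>"
  have \<gamma>': "set_mset ?\<gamma> \<subseteq> {..<N}" by auto
  have \<gamma>: "?\<gamma> + replicate_mset (count \<gamma> N) N = \<gamma>"
    by (rule filter_less_add_top) (rule Suc.prems(3))
  have y0: "y i = 0" if "y \<in> hremove x k" "L \<le> i" for y i k
    using Suc.prems(2)[OF that(2)] that(1) hstripD(2)[of x y i] by (simp add: hremove_def)
  have bij: "bij_betw (\<lambda>T. (shape_of (trunc N T), trunc N T)) (tableaux L x \<gamma>) ?S"
  proof (rule bij_betw_byWitness[where f' = "\<lambda>(y, T). extend N x T"])
    show "\<forall>T\<in>tableaux L x \<gamma>. (\<lambda>(y, T). extend N x T) (shape_of (trunc N T), trunc N T) = T"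
      using extend_trunc Suc.prems(3) by auto
    show "\<forall>p\<in>?S. (shape_of (trunc N ((\<lambda>(y, T). extend N x T) p)), trunc N ((\<lambda>(y, T). extend N x T) p)) = p"
      using trunc_extend[OF _ \<gamma>'] tableaux_shape[OF _ y0] by auto
    show "(\<lambda>T. (shape_of (trunc N T), trunc N T)) ` tableaux L x \<gamma> \<subseteq> ?S"
      using trunc_tableaux[OF _ Suc.prems(3,1,2)] by auto
    show "(\<lambda>(y, T). extend N x T) ` ?S \<subseteq> tableaux L x \<gamma>"
      using extend_tableaux[OF _ _ \<gamma>' Suc.prems(1,2), of _ "count \<gamma> N"] unfolding \<gamma> by auto
  qed
  have IH: "finite (tableaux L y ?\<gamma>) \<and> int (card (tableaux L y ?\<gamma>)) = kostka N y (count \<gamma>)"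
    if "y \<in> hremove x (count \<gamma> N)" for y
  proof -
    have "kostka N y (count ?\<gamma>) = kostka N y (count \<gamma>)" by (rule kostka_cong) simp
    then show ?thesis
      using Suc.IH[OF hremove_shapes[OF Suc.prems(1) that] y0[OF that] \<gamma>'] by (simp only:)
  qed
  have "finite ?S" using IH finite_hremove[OF Suc.prems(1)] by (intro finite_SigmaI) auto
  moreover have "int (card ?S) = kostka (Suc N) x (count \<gamma>)"
    using IH finite_hremove[OF Suc.prems(1)] by (subst card_SigmaI) auto
  ultimately show ?case using bij_betw_finite[OF bij] bij_betw_same_card[OF bij] by simp
qed

section \<open>Expansion in Schur functions\<close>

lemma map_part: "map (part lam) [0..<length lam] = lam"
  by (rule nth_equalityI) (auto simp: part_def)

lemma part_beyond: "length lam \<le> i \<Longrightarrow> part lam i = 0"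
  by (simp add: part_def)

lemma part_shapes: assumes "is_partition lam" shows "part lam \<in> shapes"
proof (rule shapesI)
  show "part lam (Suc i) \<le> part lam i" for i
    using assms by (auto simp: part_def is_partition_def sorted_wrt_iff_nth_less)
qed (rule part_beyond)

lemma wt_part: "wt (part lam) = sum_list lam"
proof -
  have "wt (part lam) = sum (part lam) {..<length lam}"
    by (rule wt_eq_sum_lessThan) (rule part_beyond)
  also have "\<dots> = sum_list (map (part lam) [0..<length lam])"
    by (simp add: interv_sum_list_conv_sum_set_nat atLeast0LessThan)
  finally show ?thesis by (simp only: map_part)
qed

lemma schur_eq_kostka:
  assumes "is_partition lam" "set_mset \<gamma> \<subseteq> {..<N}"
  shows "schur lam \<gamma> = kostka N (part lam) (count \<gamma>)"
proof -
  have "schur lam \<gamma> = int (card (tableaux (length lam) (part lam) \<gamma>))"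
    unfolding schur_def tableaux_def map_part ..
  then show ?thesis
    using card_tableaux[OF part_shapes[OF assms(1)] part_beyond assms(2)] by simp
qed

lemma part_inj:
  assumes "is_partition lam" "is_partition mu" "part lam = part mu"
  shows "lam = mu"
proof -
  have pos: "{i. part nu i \<noteq> 0} = {..<length nu}" if nu: "is_partition nu" for nu
  proof -
    have "nu ! i \<noteq> 0" if "i < length nu" for i
      using nu nth_mem[OF that] unfolding is_partition_def by metis
    then show ?thesis by (auto simp: part_def)
  qed
  have "{..<length lam} = {..<length mu}"
    using pos[OF assms(1)] pos[OF assms(2)] unfolding assms(3) by (rule trans[OF sym])
  then have "length lam = length mu" by simp
  then show ?thesis using map_part[of lam] map_part[of mu] unfolding assms(3) by metis
qed

lemma part_surj:
  assumes x: "x \<in> shapes"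
  obtains lam where "is_partition lam" "part lam = x"
proof -
  define L where "L = (LEAST i. x i = 0)"
  obtain M where "x M = 0" using shapes_bound[OF x] by blast
  then have L: "x L = 0" unfolding L_def by (rule LeastI)
  have pos: "x i \<noteq> 0" if "i < L" for i using not_less_Least that unfolding L_def by blast
  have beyond: "x i = 0" if "L \<le> i" for i using shapes_antimono[OF x that] L by simp
  define lam where "lam = map x [0..<L]"
  have "part lam = x"
  proof
    show "part lam i = x i" for i using beyond[of i] by (simp add: part_def lam_def)
  qed
  moreover have "is_partition lam" unfolding is_partition_def
  proof
    show "sorted_wrt (\<ge>) lam" using shapes_antimono[OF x]
      by (auto simp: sorted_wrt_iff_nth_less lam_def)
    show "0 \<notin> set lam"
    proof
      assume "0 \<in> set lam"
      then obtain i where "i < L" "x i = 0" by (auto simp: lam_def)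
      then show False using pos by blast
    qed
  qed
  ultimately show ?thesis using that by blast
qed

text \<open>The condition under the definite description in \<open>schur_coeff\<close>, which
  acquires its meaning through \<open>schur_expansion_unique\<close>.\<close>

definition schur_expansion :: "series \<Rightarrow> (nat list \<Rightarrow> int) \<Rightarrow> bool" where
  "schur_expansion f c \<longleftrightarrow> finite {\<mu>. c \<mu> \<noteq> 0} \<and> (\<forall>\<mu>. c \<mu> \<noteq> 0 \<longrightarrow> is_partition \<mu>) \<and>
     f = (\<lambda>\<alpha>. \<Sum>\<mu> | c \<mu> \<noteq> 0. c \<mu> * schur \<mu> \<alpha>)"

lemma bounded_mset: "\<exists>N. set_mset (\<gamma> :: nat multiset) \<subseteq> {..<N}"
  using finite_nat_set_iff_bounded[of "set_mset \<gamma>"] by (auto simp: subset_iff)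

text \<open>Once \<open>N\<close> bounds the lengths of all partitions involved, independence can be
  tested in \<open>N\<close> variables, at the monomials \<alpha> whose exponents are the parts of
  one of these partitions.\<close>

lemma schur_independent:
  assumes fin: "finite M" and part: "\<And>\<mu>. \<mu> \<in> M \<Longrightarrow> is_partition \<mu>"
    and zero: "\<And>\<alpha>. (\<Sum>\<mu>\<in>M. d \<mu> * schur \<mu> \<alpha>) = 0" and mu: "\<mu> \<in> M"
  shows "d \<mu> = 0"
proof -
  define N where "N = Suc (\<Sum>\<mu>\<in>M. length \<mu>)"
  have inj: "inj_on part M" by (rule inj_onI) (rule part_inj; simp add: part)
  have len: "length \<mu> \<le> N" if "\<mu> \<in> M" for \<mu>
    using member_le_sum[of \<mu> M length] that fin by (simp add: N_def)
  have sup: "part \<mu> i = 0" if "\<mu> \<in> M" "N \<le> i" for \<mu> i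
    using part_beyond[of \<mu> i] len[OF that(1)] that(2) by simp
  have "(d \<circ> inv_into M part) (part \<mu>) = 0"
  proof (rule kostka_independent[of "part ` M" N "d \<circ> inv_into M part"])
    show "finite (part ` M)" using fin by simp
    show "part ` M \<subseteq> shapes" using part part_shapes by blast
    show "part \<mu> \<in> part ` M" using mu by simp
    show "x i = 0" if x: "x \<in> part ` M" and i: "N \<le> i" for x i
    proof -
      obtain \<nu> where "\<nu> \<in> M" "x = part \<nu>" using x by blast
      then show ?thesis using sup i by simp
    qed
    fix y assume y: "y \<in> part ` M"
    define \<alpha> where "\<alpha> = (\<Sum>i<N. replicate_mset (y i) i)"
    have c: "count \<alpha> i = (if i < N then y i else 0)" for i
    proof -
      have "count \<alpha> i = (\<Sum>j<N. if j = i then y i else 0)"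
        unfolding \<alpha>_def count_sum by (intro sum.cong) auto
      then show ?thesis by simp
    qed
    have s: "set_mset \<alpha> \<subseteq> {..<N}"
    proof
      fix i assume "i \<in># \<alpha>"
      then have "count \<alpha> i \<noteq> 0" by simp
      then show "i \<in> {..<N}" unfolding c by (simp split: if_splits)
    qed
    have "(\<Sum>x\<in>part ` M. (d \<circ> inv_into M part) x * kostka N x y)
        = (\<Sum>\<mu>\<in>M. d \<mu> * kostka N (part \<mu>) y)"
      by (subst sum.reindex[OF inj]) (auto intro!: sum.cong simp: inv_into_f_f[OF inj])
    also have "\<dots> = (\<Sum>\<mu>\<in>M. d \<mu> * schur \<mu> \<alpha>)"
    proof (rule sum.cong[OF refl])
      fix \<nu> assume "\<nu> \<in> M"
      then have "schur \<nu> \<alpha> = kostka N (part \<nu>) (count \<alpha>)" using schur_eq_kostka[OF part s] by blast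
      also have "\<dots> = kostka N (part \<nu>) y" by (rule kostka_cong) (simp add: c)
      finally show "d \<nu> * kostka N (part \<nu>) y = d \<nu> * schur \<nu> \<alpha>" by simp
    qed
    finally show "(\<Sum>x\<in>part ` M. (d \<circ> inv_into M part) x * kostka N x y) = 0" using zero by simp
  qed
  then show ?thesis using inv_into_f_f[OF inj mu] by simp
qed

lemma schur_expansion_partition: "schur_expansion f c \<Longrightarrow> c \<mu> \<noteq> 0 \<Longrightarrow> is_partition \<mu>"
  by (simp add: schur_expansion_def)

lemma schur_expansion_unique:
  assumes "schur_expansion f c" "schur_expansion f c'"
  shows "c = c'"
proof
  fix \<mu>
  let ?M = "{\<mu>. c \<mu> \<noteq> 0} \<union> {\<mu>. c' \<mu> \<noteq> 0}"
  have fin: "finite ?M" using assms by (simp add: schur_expansion_def)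
  have e: "f \<alpha> = (\<Sum>\<mu>\<in>?M. b \<mu> * schur \<mu> \<alpha>)"
    if "schur_expansion f b" "{\<mu>. b \<mu> \<noteq> 0} \<subseteq> ?M" for b \<alpha>
  proof -
    have "f \<alpha> = (\<Sum>\<mu> | b \<mu> \<noteq> 0. b \<mu> * schur \<mu> \<alpha>)" using that(1) by (simp add: schur_expansion_def)
    also have "\<dots> = (\<Sum>\<mu>\<in>?M. b \<mu> * schur \<mu> \<alpha>)"
      by (rule sum.mono_neutral_left) (use fin that(2) in auto)
    finally show ?thesis .
  qed
  show "c \<mu> = c' \<mu>"
  proof (cases "\<mu> \<in> ?M")
    case True
    have "(\<Sum>\<mu>\<in>?M. (c \<mu> - c' \<mu>) * schur \<mu> \<alpha>) = 0" for \<alpha>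
      using e[OF assms(1), of \<alpha>] e[OF assms(2), of \<alpha>] by (simp add: left_diff_distrib sum_subtractf)
    then have "c \<mu> - c' \<mu> = 0"
      using schur_expansion_partition assms
      by (intro schur_independent[OF fin _ _ True, of "\<lambda>\<mu>. c \<mu> - c' \<mu>"]) blast+
    then show ?thesis by simp
  qed auto
qed

lemma schur_coeff_eqI: "schur_expansion f c \<Longrightarrow> schur_coeff f = c"
  unfolding schur_coeff_def schur_expansion_def[symmetric]
  using schur_expansion_unique by (intro the_equality)

lemma schur_coeff_schur: "is_partition lam \<Longrightarrow> schur_coeff (schur lam) = (\<lambda>\<mu>. if \<mu> = lam then 1 else 0)"
  by (rule schur_coeff_eqI) (simp add: schur_expansion_def)

lemma hall_inner_schur:
  assumes "is_partition lam" "schur_expansion f c"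
  shows "hall_inner f (schur lam) = c lam"
proof -
  have "finite {\<mu>. c \<mu> \<noteq> 0}" using assms(2) by (simp add: schur_expansion_def)
  then have "(\<Sum>\<mu> | c \<mu> \<noteq> 0. c \<mu> * (if \<mu> = lam then 1 else 0)) = c lam"
    by (simp add: if_distrib cong: if_cong)
  then show ?thesis
    unfolding hall_inner_def schur_coeff_eqI[OF assms(2)] schur_coeff_schur[OF assms(1)] .
qed

lemma schur_expansionI:
  assumes X: "finite X" "X \<subseteq> shapes"
    and f: "\<And>N \<gamma>. set_mset \<gamma> \<subseteq> {..<N} \<Longrightarrow> f \<gamma> = (\<Sum>x\<in>X. c x * kostka N x (count \<gamma>))"
  shows "schur_expansion f (\<lambda>\<mu>. if is_partition \<mu> \<and> part \<mu> \<in> X then c (part \<mu>) else 0)"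
proof -
  let ?c = "\<lambda>\<mu>. if is_partition \<mu> \<and> part \<mu> \<in> X then c (part \<mu>) else 0"
  let ?M = "{\<mu>. is_partition \<mu> \<and> part \<mu> \<in> X}"
  have inj: "inj_on part ?M" by (rule inj_onI) (rule part_inj; simp)
  have img: "part ` ?M = X"
  proof
    show "X \<subseteq> part ` ?M"
    proof
      fix x assume "x \<in> X"
      moreover obtain lam where "is_partition lam" "part lam = x"
        using part_surj X(2) \<open>x \<in> X\<close> by blast
      ultimately show "x \<in> part ` ?M" by blast
    qed
  qed auto
  have finM: "finite ?M" using finite_imageD[OF _ inj] X(1) img by simp
  have sub: "{\<mu>. ?c \<mu> \<noteq> 0} \<subseteq> ?M" by auto
  have "f \<alpha> = (\<Sum>\<mu> | ?c \<mu> \<noteq> 0. ?c \<mu> * schur \<mu> \<alpha>)" for \<alpha>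
  proof -
    obtain N where N: "set_mset \<alpha> \<subseteq> {..<N}" using bounded_mset by blast
    have "f \<alpha> = (\<Sum>x\<in>part ` ?M. c x * kostka N x (count \<alpha>))" unfolding img by (rule f[OF N])
    also have "\<dots> = (\<Sum>\<mu>\<in>?M. ?c \<mu> * schur \<mu> \<alpha>)"
      unfolding sum.reindex[OF inj] using schur_eq_kostka[OF _ N] by (intro sum.cong) auto
    also have "\<dots> = (\<Sum>\<mu> | ?c \<mu> \<noteq> 0. ?c \<mu> * schur \<mu> \<alpha>)"
      by (rule sum.mono_neutral_right) (use finM sub in auto)
    finally show ?thesis .
  qed
  then show ?thesis using finite_subset[OF sub finM] unfolding schur_expansion_def by auto
qed

section \<open>Strips and conjugation\<close>

definition vstrip :: "(nat \<Rightarrow> nat) \<Rightarrow> (nat \<Rightarrow> nat) \<Rightarrow> bool" where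
  "vstrip x y \<longleftrightarrow> (\<forall>i. y i \<le> x i \<and> x i \<le> Suc (y i))"

text \<open>For horizontal strips the interlacing already makes \<open>y\<close> decreasing; the
  condition \<open>vstrip\<close> does not, so membership in \<open>shapes\<close> is
  imposed.\<close>

definition vremove :: "(nat \<Rightarrow> nat) \<Rightarrow> nat \<Rightarrow> (nat \<Rightarrow> nat) set" where
  "vremove x k = {y \<in> shapes. vstrip x y \<and> wt x = wt y + k}"

lemma vremove_shapes: "y \<in> vremove x k \<Longrightarrow> y \<in> shapes"
  by (simp add: vremove_def)

lemma finite_vremove: "finite (vremove x k)"
  by (rule finite_subset[OF _ finite_shapes_wt[of "wt x - k"]]) (auto simp: vremove_def)

lemma eq_of_le_wt:
  assumes "x \<in> shapes" "\<And>i. y i \<le> x i" "wt x = wt y"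
  shows "y = x"
proof -
  obtain L where L: "\<And>i. L \<le> i \<Longrightarrow> x i = 0" using shapes_bound[OF assms(1)] by blast
  have L': "y i = 0" if "L \<le> i" for i using L[OF that] assms(2)[of i] by simp
  have "sum y {..<L} = sum x {..<L}"
    using assms(3) wt_eq_sum_lessThan[of L x, OF L] wt_eq_sum_lessThan[of L y, OF L'] by simp
  then have "y i = x i" if "i < L" for i
    using sum_mono_inv[of y "{..<L}" x i] assms(2) that by simp
  then show ?thesis using L L' by (intro supported_eqI[of L])
qed

lemma vremove_0: "x \<in> shapes \<Longrightarrow> vremove x 0 = {x}"
proof -
  assume x: "x \<in> shapes"
  have "y = x" if "y \<in> vremove x 0" for y
    by (rule eq_of_le_wt[OF x]) (use that in \<open>auto simp: vremove_def vstrip_def\<close>)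
  moreover have "x \<in> vremove x 0" using x by (simp add: vremove_def vstrip_def)
  ultimately show ?thesis by blast
qed

lemma wt_fun_upd:
  assumes "x \<in> shapes"
  shows "wt (x(i := a)) + x i = wt x + a"
proof -
  let ?A = "insert i {j. x j \<noteq> 0}"
  have fin: "finite ?A" using assms by (simp add: shapes_def)
  have "wt (x(i := a)) = sum (x(i := a)) ?A" by (rule wt_eq_sum[OF fin]) auto
  moreover have "wt x = sum x ?A" by (rule wt_eq_sum[OF fin]) auto
  moreover have "sum (x(i := a)) (?A - {i}) = sum x (?A - {i})" by (rule sum.cong) auto
  ultimately show ?thesis using sum.remove[OF fin, of i x] sum.remove[OF fin, of i "x(i := a)"] by simp
qed

text \<open>The sign-reversing involution moves the last cell of the first nonempty row of the skew
  shape \<open>x / z\<close> between the two strips.\<close>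

lemma strips_cancel:
  assumes x: "x \<in> shapes" and z: "z \<in> shapes" and neq: "z \<noteq> x"
  shows "(\<Sum>y | vstrip x y \<and> hstrip y z. (-1) ^ (wt x - wt y)) = (0::int)"
proof -
  let ?A = "{y. vstrip x y \<and> hstrip y z}"
  define i0 where "i0 = (LEAST i. x i \<noteq> z i)"
  have "\<exists>i. x i \<noteq> z i" using neq by auto
  then have i0: "x i0 \<noteq> z i0" unfolding i0_def by (rule LeastI_ex)
  have before: "x i = z i" if "i < i0" for i using not_less_Least that unfolding i0_def by blast
  \<comment> \<open>Both values of row \<open>i0\<close> are allowed: \<open>z i0 < x i0\<close>
    leaves room for the smaller one, and the row above, where \<open>x\<close> and \<open>z\<close>
    agree, leaves room for the larger one.\<close>
  define t where "t = (\<lambda>y. y(i0 := if y i0 = x i0 then x i0 - 1 else x i0))"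
  have A: "y i0 = x i0 \<or> Suc (y i0) = x i0" "z i0 < x i0" "z i \<le> y i" "y (Suc i) \<le> z i" "y i \<le> x i"
    "x i \<le> Suc (y i)" "y \<in> shapes" "wt y \<le> wt x"
    if "y \<in> ?A" for y i
  proof -
    have v: "y i \<le> x i" "x i \<le> Suc (y i)" "z i \<le> y i" "y (Suc i) \<le> z i" for i
      using that by (auto simp: vstrip_def hstrip_def)
    show "y i0 = x i0 \<or> Suc (y i0) = x i0" using v[of i0] by linarith
    show "z i0 < x i0" using v[of i0] i0 by linarith
    show "z i \<le> y i" "y (Suc i) \<le> z i" "y i \<le> x i" "x i \<le> Suc (y i)" using v by auto
    show "y \<in> shapes" using hstrip_shapes'[OF z] that by blast
    show "wt y \<le> wt x" using wt_mono[OF x] v by blast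
  qed
  have tA: "t y \<in> ?A" if "y \<in> ?A" for y
  proof -
    have "vstrip x (t y)" unfolding vstrip_def t_def using A(5,6)[OF that] A(1,2)[OF that] by auto
    moreover have "t y (Suc i) \<le> z i" for i
    proof (cases "Suc i = i0")
      case True
      have "t y i0 \<le> x i0" by (simp add: t_def)
      also have "\<dots> \<le> x i" using shapes_antimono[OF x, of i i0] True by simp
      also have "\<dots> = z i" using before[of i] True by simp
      finally show ?thesis using True by simp
    qed (use A(4)[OF that] in \<open>simp add: t_def\<close>)
    moreover have "z i \<le> t y i" for i using A(2,3)[OF that] by (auto simp: t_def)
    ultimately show ?thesis by (simp add: hstrip_def)
  qed
  show ?thesis
  proof (rule sum_involution_eq_0[of _ t])
    fix y assume y: "y \<in> ?A"
    show "t y \<in> ?A" by (rule tA[OF y])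
    show "t (t y) = y" using A(1,2)[OF y] unfolding t_def by (intro ext) auto
    have w: "wt (t y) + y i0 = wt y + t y i0"
      using wt_fun_upd[OF A(7)[OF y], of i0 "t y i0"] by (simp add: t_def)
    have le: "wt y \<le> wt x" "wt (t y) \<le> wt x" using A(8) y tA[OF y] by blast+
    consider "y i0 = x i0" | "Suc (y i0) = x i0" using A(1)[OF y] by blast
    then show "(-1) ^ (wt x - wt (t y)) = - ((-1) ^ (wt x - wt y) :: int)"
    proof cases
      case 1
      then have "Suc (wt (t y)) = wt y" using w A(2)[OF y] by (simp add: t_def)
      then have "wt x - wt (t y) = Suc (wt x - wt y)" using le by simp
      then show ?thesis by simp
    next
      case 2
      then have "wt (t y) = Suc (wt y)" using w by (simp add: t_def)
      then have "wt x - wt y = Suc (wt x - wt (t y))" using le by simp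
      then show ?thesis by simp
    qed
  qed
qed

text \<open>This is the alternating relation between the \<open>e\<^sub>k\<close> and
  \<open>h\<^sub>a\<^sub>-\<^sub>k\<close>, acting by skewing: a vertical strip of size
  \<open>k\<close> is removed, then the horizontal strip of the new largest letter \<open>N\<close>.
  Grouped by the shape \<open>z\<close> that remains, the terms cancel by
  \<open>strips_cancel\<close>, and \<open>0 < a\<close> ensures that \<open>z\<close> differs from
  \<open>x\<close>.\<close>

lemma kostka_strips_cancel:
  assumes x: "x \<in> shapes" and a: "0 < a" and \<gamma>: "set_mset \<gamma> \<subseteq> {..<N}"
  shows "(\<Sum>k\<le>a. (-1) ^ k * (\<Sum>y\<in>vremove x k. kostka (Suc N) y (count (\<gamma> + replicate_mset (a - k) N)))) = 0"
proof -
  let ?Z = "{z \<in> shapes. wt x = wt z + a}"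
  have finZ: "finite ?Z" by (rule finite_subset[OF _ finite_shapes_wt[of "wt x - a"]]) auto
  have "N \<notin># \<gamma>" using \<gamma> by auto
  then have K: "kostka (Suc N) y (count (\<gamma> + replicate_mset l N)) = (\<Sum>z\<in>hremove y l. kostka N z (count \<gamma>))" for y l
    by (auto simp: not_in_iff intro!: sum.cong kostka_cong)
  have e: "(-1) ^ k * (\<Sum>y\<in>vremove x k. kostka (Suc N) y (count (\<gamma> + replicate_mset (a - k) N)))
      = (\<Sum>z\<in>?Z. kostka N z (count \<gamma>) * (\<Sum>y | y \<in> vremove x k \<and> hstrip y z. (-1) ^ k))"
    if "k \<le> a" for k
  proof -
    have h: "hremove y (a - k) = {z \<in> ?Z. hstrip y z}" if "y \<in> vremove x k" for y
    proof -
      have "y \<in> shapes" "wt x = wt y + k" using that by (auto simp: vremove_def)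
      then have "wt y = wt z + (a - k) \<longleftrightarrow> wt x = wt z + a" "hstrip y z \<longrightarrow> z \<in> shapes" for z
        using \<open>k \<le> a\<close> hstrip_shapes by auto
      then show ?thesis unfolding hremove_def by auto
    qed
    have "(\<Sum>y\<in>vremove x k. kostka (Suc N) y (count (\<gamma> + replicate_mset (a - k) N)))
      = (\<Sum>y\<in>vremove x k. \<Sum>z | z \<in> ?Z \<and> hstrip y z. kostka N z (count \<gamma>))"
      unfolding K by (intro sum.cong refl) (simp only: h)
    also have "\<dots> = (\<Sum>z\<in>?Z. \<Sum>y | y \<in> vremove x k \<and> hstrip y z. kostka N z (count \<gamma>))"
      by (rule sum.swap_restrict[OF finite_vremove finZ])
    finally show ?thesis by (simp add: sum_distrib_left mult_ac)
  qed
  have "(\<Sum>k\<le>a. \<Sum>y | y \<in> vremove x k \<and> hstrip y z. (-1) ^ k) = (0::int)" if z: "z \<in> ?Z" for z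
  proof -
    let ?A = "{y. vstrip x y \<and> hstrip y z}"
    have zs: "z \<in> shapes" "wt x = wt z + a" using z by auto
    have A: "y \<in> shapes" "wt y \<le> wt x" "wt z \<le> wt y" if "y \<in> ?A" for y
    proof -
      show y: "y \<in> shapes" using hstrip_shapes'[OF zs(1)] that by blast
      show "wt y \<le> wt x" using wt_mono[OF x, of y] that by (simp add: vstrip_def)
      show "wt z \<le> wt y" using wt_mono[OF y, of z] that by (simp add: hstrip_def)
    qed
    have "?A \<subseteq> (\<Union>d\<in>{..wt x}. {y \<in> shapes. wt y = d})" using A by auto
    then have finA: "finite ?A" by (rule finite_subset) (use finite_shapes_wt in auto)
    have "(\<Sum>k\<le>a. \<Sum>y | y \<in> vremove x k \<and> hstrip y z. (-1) ^ k)
        = (\<Sum>k\<le>a. \<Sum>y | y \<in> ?A \<and> wt x - wt y = k. (-1) ^ (wt x - wt y) :: int)"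
    proof (rule sum.cong[OF refl])
      fix k
      have "{y. y \<in> vremove x k \<and> hstrip y z} = {y. y \<in> ?A \<and> wt x - wt y = k}"
        using A by (auto simp: vremove_def)
      then show "(\<Sum>y | y \<in> vremove x k \<and> hstrip y z. (-1) ^ k)
          = (\<Sum>y | y \<in> ?A \<and> wt x - wt y = k. (-1) ^ (wt x - wt y) :: int)" by (intro sum.cong) auto
    qed
    also have "\<dots> = (\<Sum>y\<in>?A. (-1) ^ (wt x - wt y))"
    proof (rule sum.group[OF finA])
      show "(\<lambda>y. wt x - wt y) ` ?A \<subseteq> {..a}" using A(3) zs(2) by fastforce
    qed simp
    also have "\<dots> = 0" using zs a by (intro strips_cancel[OF x]) auto
    finally show ?thesis .
  qed
  then have "(\<Sum>z\<in>?Z. kostka N z (count \<gamma>) * (\<Sum>k\<le>a. \<Sum>y | y \<in> vremove x k \<and> hstrip y z. (-1) ^ k)) = 0"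
    by (intro sum.neutral ballI) (simp only: mult_zero_right)
  then have "(\<Sum>k\<le>a. \<Sum>z\<in>?Z. kostka N z (count \<gamma>) * (\<Sum>y | y \<in> vremove x k \<and> hstrip y z. (-1) ^ k)) = 0"
    unfolding sum_distrib_left[of "kostka _ _ _" _ "{..a}"] by (subst sum.swap)
  moreover have "(\<Sum>k\<le>a. (-1) ^ k * (\<Sum>y\<in>vremove x k. kostka (Suc N) y (count (\<gamma> + replicate_mset (a - k) N))))
    = (\<Sum>k\<le>a. \<Sum>z\<in>?Z. kostka N z (count \<gamma>) * (\<Sum>y | y \<in> vremove x k \<and> hstrip y z. (-1) ^ k))"
    using e by (intro sum.cong) auto
  ultimately show ?thesis by (simp only:)
qed

section \<open>Conjugate shapes\<close>

definition conjugate :: "(nat \<Rightarrow> nat) \<Rightarrow> nat \<Rightarrow> nat" where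
  "conjugate x j = card {i. j < x i}"

text \<open>The rows longer than \<open>j\<close> form an initial segment because \<open>x\<close>
  decreases. This exchange of the coordinates of a cell, rather than the cardinality in the
  definition, carries the later facts on conjugates.\<close>

lemma less_conjugate_iff:
  assumes "x \<in> shapes"
  shows "i < conjugate x j \<longleftrightarrow> j < x i"
proof -
  obtain L where L: "\<And>i. L \<le> i \<Longrightarrow> x i = 0" using shapes_bound[OF assms] by blast
  define k where "k = (LEAST i. \<not> j < x i)"
  have ex: "\<not> j < x L" using L[of L] by simp
  have k: "\<not> j < x k" unfolding k_def by (rule LeastI) (rule ex)
  have "j < x i \<longleftrightarrow> i < k" for i
  proof
    assume "j < x i"
    then show "i < k" using k shapes_antimono[OF assms, of k i] by (metis not_less order.strict_trans2)
  next
    assume "i < k"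
    then show "j < x i" using not_less_Least unfolding k_def by blast
  qed
  then have "{i. j < x i} = {..<k}" by auto
  then show ?thesis using \<open>j < x i \<longleftrightarrow> i < k\<close> by (simp add: conjugate_def)
qed

lemma conjugate_shapes:
  assumes "x \<in> shapes"
  shows "conjugate x \<in> shapes"
proof (rule shapesI)
  fix j
  show "conjugate x (Suc j) \<le> conjugate x j"
  proof (rule ccontr)
    assume "\<not> conjugate x (Suc j) \<le> conjugate x j"
    then have "conjugate x j < conjugate x (Suc j)" by simp
    then have "Suc j < x (conjugate x j)" using less_conjugate_iff[OF assms] by simp
    then have "conjugate x j < conjugate x j" using less_conjugate_iff[OF assms, of "conjugate x j" j] by simp
    then show False by simp
  qed
next
  fix j assume "x 0 \<le> j"
  then show "conjugate x j = 0" using less_conjugate_iff[OF assms, of 0 j] by simp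
qed

lemma nat_eqI_less: "(\<And>k. k < a \<longleftrightarrow> k < b) \<Longrightarrow> a = (b::nat)"
  by (metis linorder_neq_iff)

lemma conjugate_conjugate: "x \<in> shapes \<Longrightarrow> conjugate (conjugate x) = x"
  by (intro ext nat_eqI_less) (simp add: less_conjugate_iff conjugate_shapes)

lemma wt_conjugate:
  assumes "x \<in> shapes"
  shows "wt (conjugate x) = wt x"
proof -
  have c: "wt y = card {(i, j). j < y i}" if "y \<in> shapes" for y
  proof -
    have "{(i, j). j < y i} = (SIGMA i:{i. y i \<noteq> 0}. {..<y i})" by auto
    moreover have "finite {i. y i \<noteq> 0}" using that by (simp add: shapes_def)
    ultimately show ?thesis by (simp add: wt_def)
  qed
  have "{(i, j). j < conjugate x i} = prod.swap ` {(i, j). j < x i}"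
    using less_conjugate_iff[OF assms] by (auto simp: image_iff)
  then show ?thesis using c[OF assms] c[OF conjugate_shapes[OF assms]] by (simp add: card_image)
qed

text \<open>Read through cells, the condition \<open>conjugate x (Suc i) \<le> conjugate y i\<close>
  says that the cell \<open>(k, Suc i)\<close> of \<open>x\<close> forces the cell
  \<open>(k, i)\<close> into \<open>y\<close>, so that no row of \<open>x\<close> exceeds the row of
  \<open>y\<close> by more than one cell.\<close>

lemma hstrip_conjugate:
  assumes "x \<in> shapes" "y \<in> shapes"
  shows "hstrip (conjugate x) (conjugate y) \<longleftrightarrow> vstrip x y"
proof -
  have le: "a \<le> b \<longleftrightarrow> (\<forall>k<a. k < b)" for a b :: nat
    using linorder_not_le[of a b] by (auto intro: less_le_trans)
  have "(\<forall>i. conjugate y i \<le> conjugate x i) \<longleftrightarrow> (\<forall>i. y i \<le> x i)"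
    unfolding le[of "conjugate _ _"] le[of "y _"] less_conjugate_iff[OF assms(1)] less_conjugate_iff[OF assms(2)] by blast
  moreover have "(\<forall>i. conjugate x (Suc i) \<le> conjugate y i) \<longleftrightarrow> (\<forall>i. x i \<le> Suc (y i))"
  proof -
    have "x i \<le> Suc (y i) \<longleftrightarrow> (\<forall>k. Suc k < x i \<longrightarrow> k < y i)" for i
    proof (cases "x i")
      case (Suc c)
      then show ?thesis using le[of c "y i"] by simp
    qed simp
    then show ?thesis
      unfolding le[of "conjugate _ _"] less_conjugate_iff[OF assms(1)] less_conjugate_iff[OF assms(2)] by blast
  qed
  ultimately show ?thesis by (auto simp: hstrip_def vstrip_def)
qed

lemma sum_vremove_conjugate:
  assumes x: "x \<in> shapes"
  shows "(\<Sum>y\<in>vremove x k. f (conjugate y)) = (\<Sum>y\<in>hremove (conjugate x) k. f y)"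
proof (rule sum.reindex_bij_witness[of _ conjugate conjugate])
  fix y assume y: "y \<in> vremove x k"
  then have ys: "y \<in> shapes" by (rule vremove_shapes)
  show "conjugate (conjugate y) = y" by (rule conjugate_conjugate[OF ys])
  show "conjugate y \<in> hremove (conjugate x) k"
    using y hstrip_conjugate[OF x ys] wt_conjugate[OF x] wt_conjugate[OF ys] by (simp add: hremove_def vremove_def)
next
  fix y assume y: "y \<in> hremove (conjugate x) k"
  then have ys: "y \<in> shapes" using hremove_shapes[OF conjugate_shapes[OF x]] by blast
  show c: "conjugate (conjugate y) = y" by (rule conjugate_conjugate[OF ys])
  show "conjugate y \<in> vremove x k"
    using y hstrip_conjugate[OF x conjugate_shapes[OF ys]] wt_conjugate[OF x] wt_conjugate[OF ys] conjugate_shapes[OF ys]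
    by (simp add: hremove_def vremove_def c)
qed simp

text \<open>In the relation with \<open>a = b\<close> the term \<open>k = b\<close> is
  \<open>F \<gamma> b\<close> up to sign, while all other terms have fewer odd letters, at the cost
  of a new even letter \<open>N\<close>. So the values without odd letters determine the rest, and
  the right-hand side obeys the same recursion by \<open>kostka_strips_cancel\<close>.\<close>

lemma odd_letter_kostka:
  fixes F :: "monom \<Rightarrow> nat \<Rightarrow> int"
  assumes rel: "\<And>\<gamma> N a. set_mset \<gamma> \<subseteq> {..<N} \<Longrightarrow> 0 < a \<Longrightarrow>
      (\<Sum>k\<le>a. (-1) ^ k * F (\<gamma> + replicate_mset (a - k) N) k) = 0"
    and X: "X \<subseteq> shapes"
    and base: "\<And>\<gamma> N. set_mset \<gamma> \<subseteq> {..<N} \<Longrightarrow> F \<gamma> 0 = (\<Sum>x\<in>X. c x * kostka N x (count \<gamma>))"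
    and \<gamma>: "set_mset \<gamma> \<subseteq> {..<N}"
  shows "F \<gamma> b = (\<Sum>x\<in>X. c x * (\<Sum>y\<in>vremove x b. kostka N y (count \<gamma>)))"
  using \<gamma>
proof (induction b arbitrary: \<gamma> N rule: less_induct)
  case (less b)
  show ?case
  proof (cases "b = 0")
    case True
    have "(\<Sum>x\<in>X. c x * (\<Sum>y\<in>vremove x 0. kostka N y (count \<gamma>))) = (\<Sum>x\<in>X. c x * kostka N x (count \<gamma>))"
      using X vremove_0 by (intro sum.cong) auto
    then show ?thesis using base[OF less.prems] True by simp
  next
    case False
    define G where "G = (\<lambda>\<gamma> k N. \<Sum>x\<in>X. c x * (\<Sum>y\<in>vremove x k. kostka N y (count \<gamma>)))"
    let ?\<gamma> = "\<lambda>k. \<gamma> + replicate_mset (b - k) N"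
    have "set_mset (?\<gamma> k) \<subseteq> {..<Suc N}" for k using less.prems by auto
    then have IH: "F (?\<gamma> k) k = G (?\<gamma> k) k (Suc N)" if "k < b" for k
      using less.IH[OF that] unfolding G_def by blast
    have "(\<Sum>k\<le>b. (-1) ^ k * G (?\<gamma> k) k (Suc N)) =
      (\<Sum>x\<in>X. c x * (\<Sum>k\<le>b. (-1) ^ k * (\<Sum>y\<in>vremove x k. kostka (Suc N) y (count (?\<gamma> k)))))"
      unfolding G_def sum_distrib_left by (subst sum.swap) (simp only: mult.left_commute)
    also have "\<dots> = 0"
      using kostka_strips_cancel[OF _ _ less.prems] X False by (intro sum.neutral ballI) auto
    finally have "(\<Sum>k\<le>b. (-1) ^ k * G (?\<gamma> k) k (Suc N)) = (\<Sum>k\<le>b. (-1) ^ k * F (?\<gamma> k) k)"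
      using rel[OF less.prems, of b] False by simp
    then have "(\<Sum>k<b. (-1) ^ k * G (?\<gamma> k) k (Suc N)) + (-1) ^ b * G \<gamma> b (Suc N)
      = (\<Sum>k<b. (-1) ^ k * F (?\<gamma> k) k) + (-1) ^ b * F \<gamma> b"
      by (simp flip: lessThan_Suc_atMost)
    moreover have "(\<Sum>k<b. (-1) ^ k * F (?\<gamma> k) k) = (\<Sum>k<b. (-1) ^ k * G (?\<gamma> k) k (Suc N))"
      using IH by (intro sum.cong) auto
    ultimately have "F \<gamma> b = G \<gamma> b (Suc N)" by simp
    also have "\<dots> = G \<gamma> b N"
    proof -
      have "count \<gamma> i = 0" if "N \<le> i" for i
      proof -
        have "i \<notin># \<gamma>" using less.prems that by auto
        then show ?thesis by (simp add: not_in_iff)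
      qed
      then have "kostka (Suc N) y (count \<gamma>) = kostka N y (count \<gamma>)" if "y \<in> shapes" for y
        using kostka_stable[OF that, of N "count \<gamma>" "Suc N"] by simp
      then have "kostka (Suc N) y (count \<gamma>) = kostka N y (count \<gamma>)" if "y \<in> vremove x b" for x y
        using that vremove_shapes by blast
      then show ?thesis unfolding G_def by (intro sum.cong arg_cong2[of _ _ _ _ "(*)"] refl)
    qed
    finally show ?thesis by (simp add: G_def)
  qed
qed

text \<open>If exchanging an even letter for an odd one obeys the cancellation law of strips, then
  making all letters odd transposes the shapes.\<close>

lemma odd_letters_kostka:
  fixes F :: "monom \<Rightarrow> monom \<Rightarrow> int"
  assumes rel: "\<And>\<gamma> \<delta> N u a. set_mset \<gamma> \<subseteq> {..<N} \<Longrightarrow> set_mset \<delta> \<subseteq> {..<M} \<Longrightarrow> u < M \<Longrightarrow> u \<notin># \<delta> \<Longrightarrow> 0 < a \<Longrightarrow>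
      (\<Sum>k\<le>a. (-1) ^ k * F (\<gamma> + replicate_mset (a - k) N) (\<delta> + replicate_mset k u)) = 0"
    and X: "finite X" "X \<subseteq> shapes"
    and base: "\<And>\<gamma> N. set_mset \<gamma> \<subseteq> {..<N} \<Longrightarrow> F \<gamma> {#} = (\<Sum>x\<in>X. c x * kostka N x (count \<gamma>))"
    and \<delta>: "set_mset \<delta> \<subseteq> {..<M}"
  shows "F {#} \<delta> = (\<Sum>x\<in>X. c x * kostka M (conjugate x) (count \<delta>))"
  using assms
proof (induction M arbitrary: F X c \<delta>)
  case 0
  have z: "conjugate x = (\<lambda>_. 0) \<longleftrightarrow> x = (\<lambda>_. 0)" if "x \<in> X" for x
    using conjugate_conjugate[of x] 0(3) that by (auto simp: conjugate_def fun_eq_iff)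
  have "F {#} {#} = (\<Sum>x\<in>X. c x * kostka 0 x (count {#}))" by (rule 0(4)) simp
  also have "\<dots> = (\<Sum>x\<in>X. c x * kostka 0 (conjugate x) (count \<delta>))" using z by (intro sum.cong) auto
  finally show ?case using 0(5) by simp
next
  case (Suc M)
  let ?\<delta> = "filter_mset (\<lambda>a. a < M) \<delta>"
  define b where "b = count \<delta> M"
  have \<delta>: "?\<delta> + replicate_mset b M = \<delta>" unfolding b_def by (rule filter_less_add_top[OF Suc.prems(5)])
  \<comment> \<open>The \<open>b\<close> copies of the top odd letter \<open>M\<close> are frozen
    into the function. \<open>X'\<close> and \<open>c'\<close> give its expansion after the removal
    of vertical strips of size \<open>b\<close>, which conjugation turns into the horizontal strips
    in the recursion of \<open>kostka (Suc M)\<close>.\<close>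
  define F' where "F' = (\<lambda>\<gamma> \<delta>. F \<gamma> (\<delta> + replicate_mset b M))"
  define X' where "X' = (\<Union>x\<in>X. vremove x b)"
  define c' where "c' = (\<lambda>y. \<Sum>x | x \<in> X \<and> y \<in> vremove x b. c x)"
  have finX': "finite X'" using Suc.prems(2) finite_vremove by (auto simp: X'_def)
  have X's: "X' \<subseteq> shapes" using vremove_shapes by (auto simp: X'_def)
  have swap: "(\<Sum>x\<in>X. c x * (\<Sum>y\<in>vremove x b. K y)) = (\<Sum>y\<in>X'. c' y * K y)" for K
  proof -
    have "(\<Sum>x\<in>X. c x * (\<Sum>y\<in>vremove x b. K y)) = (\<Sum>x\<in>X. \<Sum>y | y \<in> X' \<and> y \<in> vremove x b. c x * K y)"
      unfolding sum_distrib_left by (intro sum.cong) (auto simp: X'_def)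
    also have "\<dots> = (\<Sum>y\<in>X'. \<Sum>x | x \<in> X \<and> y \<in> vremove x b. c x * K y)"
      by (rule sum.swap_restrict[OF Suc.prems(2) finX'])
    finally show ?thesis by (simp add: c'_def sum_distrib_right)
  qed
  have "F' {#} ?\<delta> = (\<Sum>y\<in>X'. c' y * kostka M (conjugate y) (count ?\<delta>))"
  proof (rule Suc.IH[OF _ finX' X's])
    fix \<gamma> \<delta> :: monom and N u a :: nat
    assume *: "set_mset \<gamma> \<subseteq> {..<N}" "set_mset \<delta> \<subseteq> {..<M}" "u < M" "u \<notin># \<delta>" "0 < a"
    have "set_mset (\<delta> + replicate_mset b M) \<subseteq> {..<Suc M}" using *(2) by (auto simp: less_Suc_eq)
    moreover have "u \<notin># \<delta> + replicate_mset b M" using *(3,4) by auto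
    ultimately show "(\<Sum>k\<le>a. (-1) ^ k * F' (\<gamma> + replicate_mset (a - k) N) (\<delta> + replicate_mset k u)) = 0"
      using Suc.prems(1)[of \<gamma> N "\<delta> + replicate_mset b M" u a] *
      by (simp add: F'_def add_ac)
  next
    fix \<gamma> :: monom and N :: nat
    assume "set_mset \<gamma> \<subseteq> {..<N}"
    then have "F \<gamma> (replicate_mset b M) = (\<Sum>x\<in>X. c x * (\<Sum>y\<in>vremove x b. kostka N y (count \<gamma>)))"
    proof (rule odd_letter_kostka[where F = "\<lambda>\<gamma> k. F \<gamma> (replicate_mset k M)", OF _ Suc.prems(3), rotated 2])
      fix \<gamma> :: monom and N a :: nat
      assume "set_mset \<gamma> \<subseteq> {..<N}" "0 < a"
      then show "(\<Sum>k\<le>a. (-1) ^ k * F (\<gamma> + replicate_mset (a - k) N) (replicate_mset k M)) = 0"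
        using Suc.prems(1)[of \<gamma> N "{#}" M a] by simp
    next
      fix \<gamma> :: monom and N :: nat
      assume "set_mset \<gamma> \<subseteq> {..<N}"
      then show "F \<gamma> (replicate_mset 0 M) = (\<Sum>x\<in>X. c x * kostka N x (count \<gamma>))"
        using Suc.prems(4) by simp
    qed
    then show "F' \<gamma> {#} = (\<Sum>y\<in>X'. c' y * kostka N y (count \<gamma>))" unfolding swap by (simp add: F'_def)
  qed auto
  also have "\<dots> = (\<Sum>x\<in>X. c x * (\<Sum>y\<in>vremove x b. kostka M (conjugate y) (count ?\<delta>)))" by (rule swap[symmetric])
  also have "\<dots> = (\<Sum>x\<in>X. c x * kostka (Suc M) (conjugate x) (count \<delta>))"
  proof (rule sum.cong[OF refl])
    fix x assume "x \<in> X"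
    then have "x \<in> shapes" using Suc.prems(3) by blast
    then have "(\<Sum>y\<in>vremove x b. kostka M (conjugate y) (count ?\<delta>)) = (\<Sum>y\<in>hremove (conjugate x) b. kostka M y (count ?\<delta>))"
      by (rule sum_vremove_conjugate)
    also have "\<dots> = (\<Sum>y\<in>hremove (conjugate x) b. kostka M y (count \<delta>))"
      by (intro sum.cong refl kostka_cong) simp
    finally show "c x * (\<Sum>y\<in>vremove x b. kostka M (conjugate y) (count ?\<delta>)) = c x * kostka (Suc M) (conjugate x) (count \<delta>)"
      by (simp add: b_def)
  qed
  finally show ?case unfolding F'_def \<delta> .
qed

section \<open>Plethysm with odd letters\<close>

type_synonym super_monom = "(nat + nat) multiset"

definition even_letters :: "super_monom \<Rightarrow> nat" where
  "even_letters A = size (filter_mset isl A)"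

text \<open>The monomials of the complete symmetric function in letters of two parities: even
  letters alone give those of \<open>h\<^sub>m\<close>, odd letters alone those of
  \<open>e\<^sub>m\<close>.\<close>

definition super_factor :: "nat \<Rightarrow> super_monom \<Rightarrow> bool" where
  "super_factor m A \<longleftrightarrow> size A = m \<and> (\<forall>j. count A (Inr j) \<le> 1)"

definition super_monom_of :: "monom \<Rightarrow> monom \<Rightarrow> super_monom" where
  "super_monom_of \<gamma> \<delta> = image_mset Inl \<gamma> + image_mset Inr \<delta>"

text \<open>Factors with an odd number of even letters may not be repeated.  Without odd letters
  this yields \<open>h\<^sub>n \<circ> h\<^sub>m\<close> for even \<open>m\<close> and \<open>e\<^sub>n \<circ> h\<^sub>m\<close> for odd \<open>m\<close>, without even letters it yields
  \<open>h\<^sub>n \<circ> e\<^sub>m\<close>.\<close>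

definition super_products :: "nat \<Rightarrow> nat \<Rightarrow> super_monom multiset set" where
  "super_products n m = {B. size B = n \<and> (\<forall>A\<in>#B. super_factor m A \<and> (odd (even_letters A) \<longrightarrow> count B A \<le> 1))}"

definition super_plethysm :: "nat \<Rightarrow> nat \<Rightarrow> monom \<Rightarrow> monom \<Rightarrow> super_monom multiset set" where
  "super_plethysm n m \<gamma> \<delta> = {B \<in> super_products n m. \<Sum>\<^sub># B = super_monom_of \<gamma> \<delta>}"

lemma count_image_Inl: "count (image_mset Inl \<gamma>) (Inl i) = count \<gamma> i" "count (image_mset Inl \<gamma>) (Inr j) = 0"
  by (induction \<gamma>) auto

lemma count_image_Inr: "count (image_mset Inr \<gamma>) (Inr i) = count \<gamma> i" "count (image_mset Inr \<gamma>) (Inl j) = 0"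
  by (induction \<gamma>) auto

lemma count_super_monom_of [simp]:
  "count (super_monom_of \<gamma> \<delta>) (Inl i) = count \<gamma> i"
  "count (super_monom_of \<gamma> \<delta>) (Inr i) = count \<delta> i"
  by (simp_all add: super_monom_of_def count_image_Inl count_image_Inr)

lemma super_eqI:
  assumes "\<And>i. count A (Inl i) = count B (Inl i)" "\<And>i. count A (Inr i) = count B (Inr i)"
  shows "A = B"
proof (rule multiset_eqI)
  show "count A a = count B a" for a using assms by (cases a) auto
qed

lemma finite_super_products_content: "finite {B \<in> super_products n m. set_mset (\<Sum>\<^sub># B) \<subseteq> S}" if "finite S"
proof (rule finite_subset)
  show "{B \<in> super_products n m. set_mset (\<Sum>\<^sub># B) \<subseteq> S} \<subseteq> multisets_of_size (multisets_of_size S m) n"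
    by (auto simp: super_products_def super_factor_def multisets_of_size_def)
  show "finite (multisets_of_size (multisets_of_size S m) n)" using that by auto
qed

lemma finite_super_plethysm: "finite (super_plethysm n m \<gamma> \<delta>)"
proof (rule finite_subset)
  let ?S = "set_mset (super_monom_of \<gamma> \<delta>)"
  show "super_plethysm n m \<gamma> \<delta> \<subseteq> {B \<in> super_products n m. set_mset (\<Sum>\<^sub># B) \<subseteq> ?S}"
  proof
    fix B assume "B \<in> super_plethysm n m \<gamma> \<delta>"
    then have "B \<in> super_products n m" "\<Sum>\<^sub># B = super_monom_of \<gamma> \<delta>"
      by (simp_all add: super_plethysm_def)
    then show "B \<in> {B \<in> super_products n m. set_mset (\<Sum>\<^sub># B) \<subseteq> ?S}"
      by (simp only: mem_Collect_eq subset_refl simp_thms)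
  qed
  show "finite {B \<in> super_products n m. set_mset (\<Sum>\<^sub># B) \<subseteq> ?S}"
    by (rule finite_super_products_content) simp
qed

section \<open>Trading an even letter for an odd one\<close>

definition identify :: "nat \<Rightarrow> nat \<Rightarrow> nat + nat \<Rightarrow> nat + nat" where
  "identify t u = (\<lambda>l. if l = Inr u then Inl t else l)"

lemma count_identify:
  "count (image_mset (identify t u) M) (Inl i) = count M (Inl i) + (if i = t then count M (Inr u) else 0)"
  "count (image_mset (identify t u) M) (Inr j) = (if j = u then 0 else count M (Inr j))"
  by (induction M) (auto simp: identify_def)

lemma identify_id: "Inr u \<notin># A \<Longrightarrow> image_mset (identify t u) A = A"
  by (induction A) (auto simp: identify_def)

text \<open>As \<open>t\<close> and \<open>u\<close> are new letters, the contents that the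
  identification sends to a content with \<open>a\<close> copies of \<open>t\<close> are told apart
  by the number \<open>k\<close> of letters \<open>u\<close>; they are the contents in the
  alternating sum of \<open>super_plethysm_cancel\<close>.\<close>

lemma identify_content:
  assumes "t \<notin># \<gamma>" "u \<notin># \<delta>"
  shows "image_mset (identify t u) M = super_monom_of (\<gamma> + replicate_mset a t) \<delta> \<and> count M (Inr u) = k
    \<longleftrightarrow> k \<le> a \<and> M = super_monom_of (\<gamma> + replicate_mset (a - k) t) (\<delta> + replicate_mset k u)"
    (is "?L \<longleftrightarrow> ?R")
proof
  have t: "count \<gamma> t = 0" and u: "count \<delta> u = 0" using assms by (simp_all add: not_in_iff)
  {
    assume ?L
    then have e: "image_mset (identify t u) M = super_monom_of (\<gamma> + replicate_mset a t) \<delta>"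
      and k: "count M (Inr u) = k" by auto
    have l: "count M (Inl i) + (if i = t then k else 0) = count \<gamma> i + (if i = t then a else 0)" for i
      using arg_cong[OF e, of "\<lambda>M. count M (Inl i)"] k by (simp add: count_identify split: if_splits)
    have r: "(if j = u then 0 else count M (Inr j)) = count \<delta> j" for j
      using arg_cong[OF e, of "\<lambda>M. count M (Inr j)"] by (simp only: count_identify count_super_monom_of)
    have "k \<le> a" using l[of t] t by simp
    moreover have "M = super_monom_of (\<gamma> + replicate_mset (a - k) t) (\<delta> + replicate_mset k u)"
    proof (rule super_eqI)
      show "count M (Inl i) = count (super_monom_of (\<gamma> + replicate_mset (a - k) t) (\<delta> + replicate_mset k u)) (Inl i)" for i
        using l[of i] \<open>k \<le> a\<close> by (auto split: if_splits)
      show "count M (Inr j) = count (super_monom_of (\<gamma> + replicate_mset (a - k) t) (\<delta> + replicate_mset k u)) (Inr j)" for j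
        using r[of j] k u by (auto split: if_splits)
    qed
    ultimately show ?R ..
  next
    assume ?R
    then have ka: "k \<le> a" and M: "M = super_monom_of (\<gamma> + replicate_mset (a - k) t) (\<delta> + replicate_mset k u)"
      by auto
    have "image_mset (identify t u) M = super_monom_of (\<gamma> + replicate_mset a t) \<delta>"
    proof (rule super_eqI)
      show "count (image_mset (identify t u) M) (Inl i) = count (super_monom_of (\<gamma> + replicate_mset a t) \<delta>) (Inl i)" for i
        using ka u by (auto simp: count_identify M)
      show "count (image_mset (identify t u) M) (Inr j) = count (super_monom_of (\<gamma> + replicate_mset a t) \<delta>) (Inr j)" for j
        using u by (auto simp: count_identify M)
    qed
    then show ?L using u by (simp add: M)
  }
qed

text \<open>For at most one \<open>f\<close> and any number of \<open>b\<close> the generating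
  function is \<open>(1 + f) / (1 - b)\<close>, which is 1 for \<open>f = - b\<close>. The
  corresponding pairing of the nonempty multisets trades \<open>f\<close> for a \<open>b\<close> if
  \<open>f\<close> is present, and one \<open>b\<close> for \<open>f\<close> otherwise.\<close>

definition toggle :: "'a \<Rightarrow> 'a \<Rightarrow> 'a multiset \<Rightarrow> 'a multiset" where
  "toggle f b B = (if f \<in># B then add_mset b (B - {#f#}) else add_mset f (B - {#b#}))"

lemma toggle_cases:
  assumes "f \<in># B \<or> b \<in># B" "count B f \<le> 1" "f \<noteq> b"
  obtains B0 where "f \<notin># B0" "B = add_mset f B0" "toggle f b B = add_mset b B0"
    | B0 where "f \<notin># B0" "B = add_mset b B0" "toggle f b B = add_mset f B0"
proof (cases "f \<in># B")
  case True
  then obtain B0 where B: "B = add_mset f B0" by (metis mset_add)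
  moreover have "f \<notin># B0" using assms(2) B by (simp add: not_in_iff)
  ultimately show ?thesis using that(1)[of B0] True by (simp add: toggle_def)
next
  case False
  then obtain B0 where B: "B = add_mset b B0" using assms(1) by (metis mset_add)
  moreover have "f \<notin># B0" using False B by simp
  ultimately show ?thesis using that(2)[of B0] False by (simp add: toggle_def)
qed

lemma sum_mset_image_image: "\<Sum>\<^sub># (image_mset (image_mset f) B) = image_mset f (\<Sum>\<^sub># B)"
  by (induction B) auto

text \<open>Trading an even letter \<open>t\<close> of a factor for the odd letter \<open>u\<close> flips the parity of its number of
  even letters.  So each class of factors which agree after identifying \<open>t\<close> with \<open>u\<close> and contain
  that letter has one member \<open>f\<close> which may not be repeated and one member \<open>b\<close> which may, and
  exchanging one of them for the other reverses the sign.\<close>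

lemma super_plethysm_cancel:
  assumes t: "t \<notin># \<gamma>" and u: "u \<notin># \<delta>" and a: "0 < a"
  shows "(\<Sum>k\<le>a. (-1) ^ k * int (card (super_plethysm n m
    (\<gamma> + replicate_mset (a - k) t) (\<delta> + replicate_mset k u)))) = 0"
proof -
  let ?\<phi> = "identify t u"
  \<comment> \<open>\<open>U\<close> collects the products of all terms of the alternating sum; the
    number of letters \<open>u\<close> tells the terms apart and gives the sign.\<close>
  define U where "U = {B \<in> super_products n m. image_mset ?\<phi> (\<Sum>\<^sub># B) = super_monom_of (\<gamma> + replicate_mset a t) \<delta>}"
  define cnt where "cnt = (\<lambda>B :: super_monom multiset. count (\<Sum>\<^sub># B) (Inr u))"
  have fibre: "super_plethysm n m (\<gamma> + replicate_mset (a - k) t) (\<delta> + replicate_mset k u) = {B \<in> U. cnt B = k}"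
    if "k \<le> a" for k
    using that identify_content[OF t u] unfolding super_plethysm_def U_def cnt_def by blast
  have cnt_le: "cnt B \<le> a" if "B \<in> U" for B
    using that identify_content[OF t u, of "\<Sum>\<^sub># B" a "cnt B"] unfolding U_def cnt_def by blast
  have finU: "finite U"
  proof (rule finite_subset)
    show "U \<subseteq> (\<Union>k\<in>{..a}. super_plethysm n m (\<gamma> + replicate_mset (a - k) t) (\<delta> + replicate_mset k u))"
    proof
      fix B assume "B \<in> U"
      then have "B \<in> super_plethysm n m (\<gamma> + replicate_mset (a - cnt B) t) (\<delta> + replicate_mset (cnt B) u)"
        using fibre[OF cnt_le] by blast
      then show "B \<in> (\<Union>k\<in>{..a}. super_plethysm n m (\<gamma> + replicate_mset (a - k) t) (\<delta> + replicate_mset k u))"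
        using cnt_le[OF \<open>B \<in> U\<close>] by blast
    qed
  qed (use finite_super_plethysm in auto)
  define \<psi> where "\<psi> = (\<lambda>B. image_mset (image_mset ?\<phi>) B)"
  \<comment> \<open>The choice depends on \<open>B\<close> only through \<open>\<psi> B\<close>,
    which the exchange preserves. So \<tau> finds the same class again and is an involution.\<close>
  define K where "K = (\<lambda>B. SOME K. K \<in># \<psi> B \<and> Inl t \<in># K)"
  define y where "y = (\<lambda>K. add_mset (Inr u) (K - {#Inl t#}))"
  define f where "f = (\<lambda>K. if odd (even_letters K) then K else y K)"
  define b where "b = (\<lambda>K. if odd (even_letters K) then y K else K)"
  define \<tau> where "\<tau> = (\<lambda>B. toggle (f (K B)) (b (K B)) B)"
  have cls: "f (K B) \<in># B \<or> b (K B) \<in># B" "count B (f (K B)) \<le> 1" "f (K B) \<noteq> b (K B)"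
    "odd (even_letters (f (K B)))" "even (even_letters (b (K B)))"
    "super_factor m (f (K B))" "super_factor m (b (K B))"
    "image_mset ?\<phi> (f (K B)) = K B" "image_mset ?\<phi> (b (K B)) = K B"
    "{count (f (K B)) (Inr u), count (b (K B)) (Inr u)} = {0, 1}"
    if B: "B \<in> U" for B
  proof -
    \<comment> \<open>As \<open>0 < a\<close>, some factor contains \<open>t\<close> after the
      identification, so there is a class to act on.\<close>
    have "Inl t \<in># \<Sum>\<^sub># (\<psi> B)"
      using B a unfolding \<psi>_def sum_mset_image_image U_def by (simp add: super_monom_of_def)
    then have "\<exists>K. K \<in># \<psi> B \<and> Inl t \<in># K" by auto
    then have "K B \<in># \<psi> B \<and> Inl t \<in># K B" unfolding K_def by (rule someI_ex)
    then obtain A where A: "A \<in># B" "image_mset ?\<phi> A = K B" and tK: "Inl t \<in># K B"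
      by (auto simp: \<psi>_def)
    then obtain K' where K': "K B = add_mset (Inl t) K'" by (metis mset_add)
    have y: "y (K B) = add_mset (Inr u) K'" by (simp add: y_def K')
    have uK: "Inr u \<notin># K B" using count_identify(2)[of t u A u] A(2) by (simp add: not_in_iff)
    then have uK': "Inr u \<notin># K'" by (simp add: K')
    have idK: "image_mset ?\<phi> (K B) = K B" by (rule identify_id[OF uK])
    have idy: "image_mset ?\<phi> (y (K B)) = K B"
      unfolding y using identify_id[OF uK', of t] K' by (simp add: identify_def)
    have sA: "super_factor m A" using B A(1) by (simp add: U_def super_products_def)
    \<comment> \<open>The odd letter \<open>u\<close> occurs at most once in a factor, so the class
      has only two candidates: \<open>K B\<close> itself and \<open>K B\<close> with one
      \<open>t\<close> replaced by \<open>u\<close>.\<close>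
    have Ain: "A = K B \<or> A = y (K B)"
    proof (cases "Inr u \<in># A")
      case True
      then obtain A' where A': "A = add_mset (Inr u) A'" by (metis mset_add)
      have "count A (Inr u) \<le> 1" using sA by (simp add: super_factor_def)
      then have "Inr u \<notin># A'" using A' by (simp add: not_in_iff)
      then have "image_mset ?\<phi> A = add_mset (Inl t) A'"
        using identify_id[of u A' t] by (simp add: A' identify_def)
      then have "A' = K'" using A(2) K' by simp
      then show ?thesis using A' y by simp
    next
      case False
      then show ?thesis using identify_id[OF False, of t] A(2) by simp
    qed
    have "size K' + 1 = m" using sA Ain K' y by (auto simp: super_factor_def)
    moreover have "count K' (Inr j) \<le> 1" for j
    proof -
      have "count (K B) (Inr j) \<le> count A (Inr j)"
        unfolding A(2)[symmetric] count_identify by simp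
      also have "\<dots> \<le> 1" using sA by (simp add: super_factor_def)
      finally show ?thesis by (simp add: K')
    qed
    moreover have cu: "count K' (Inr u) = 0" using uK' by (simp add: not_in_iff)
    ultimately have s: "super_factor m (K B)" "super_factor m (y (K B))"
      unfolding y unfolding K' super_factor_def by auto
    have ev: "even_letters (K B) = Suc (even_letters (y (K B)))"
      unfolding y unfolding K' by (simp add: even_letters_def)
    have neq: "K B \<noteq> y (K B)" using ev by auto
    show "f (K B) \<in># B \<or> b (K B) \<in># B" using Ain A(1) unfolding f_def b_def by auto
    show "f (K B) \<noteq> b (K B)" using neq by (auto simp: f_def b_def)
    show o: "odd (even_letters (f (K B)))" "even (even_letters (b (K B)))"
      using ev by (auto simp: f_def b_def)
    show "count B (f (K B)) \<le> 1"
      using B o(1) by (cases "f (K B) \<in># B") (auto simp: U_def super_products_def not_in_iff)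
    show "super_factor m (f (K B))" "super_factor m (b (K B))" using s by (auto simp: f_def b_def)
    show "image_mset ?\<phi> (f (K B)) = K B" "image_mset ?\<phi> (b (K B)) = K B"
      using idK idy by (auto simp: f_def b_def)
    show "{count (f (K B)) (Inr u), count (b (K B)) (Inr u)} = {0, 1}"
      using uK cu unfolding f_def b_def y by (auto simp: not_in_iff)
  qed
  have main: "\<tau> B \<in> U \<and> \<tau> (\<tau> B) = B \<and> (-1) ^ cnt (\<tau> B) = - ((-1) ^ cnt B :: int)" if B: "B \<in> U" for B
  proof -
    define KK where "KK = K B"
    define ff where "ff = f KK"
    define bb where "bb = b KK"
    note c = cls[OF B, folded KK_def, folded ff_def bb_def]
    have \<tau>B: "\<tau> B = toggle ff bb B" by (simp add: \<tau>_def KK_def ff_def bb_def)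
    have Bp: "size B = n" "\<And>A. A \<in># B \<Longrightarrow> super_factor m A"
      "\<And>A. A \<in># B \<Longrightarrow> odd (even_letters A) \<Longrightarrow> count B A \<le> 1"
      using B by (auto simp: U_def super_products_def)
    obtain p q B0 where pq: "p = ff \<and> q = bb \<or> p = bb \<and> q = ff" and f0: "ff \<notin># B0"
      and BB: "B = add_mset p B0" "\<tau> B = add_mset q B0"
      using toggle_cases[OF c(1-3)] unfolding \<tau>B by metis
    have "\<psi> (add_mset q B0) = \<psi> (add_mset p B0)" using pq c(8,9) unfolding \<psi>_def by auto
    then have \<psi>\<tau>: "\<psi> (\<tau> B) = \<psi> B" unfolding BB(2) by (simp only: BB(1)[symmetric])
    then have "K (\<tau> B) = KK" by (simp add: K_def KK_def)
    then have "\<tau> (\<tau> B) = toggle ff bb (\<tau> B)" by (subst \<tau>_def) (simp only: ff_def bb_def)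
    also have "\<dots> = toggle ff bb (add_mset q B0)" by (simp only: BB(2))
    also have "\<dots> = add_mset p B0" using pq f0 c(3) unfolding toggle_def by auto
    also have "\<dots> = B" by (rule BB(1)[symmetric])
    finally have inv: "\<tau> (\<tau> B) = B" .
    have "image_mset ?\<phi> (\<Sum>\<^sub># (\<tau> B)) = image_mset ?\<phi> (\<Sum>\<^sub># B)"
      using \<psi>\<tau> unfolding \<psi>_def sum_mset_image_image[symmetric] by simp
    moreover have "\<tau> B \<in> super_products n m"
    proof -
      have "super_factor m A" if "A \<in># \<tau> B" for A
        using that Bp(2)[of A] pq c(6,7) BB(1) unfolding BB(2) by auto
      moreover have "count (\<tau> B) A \<le> 1" if A: "A \<in># \<tau> B" "odd (even_letters A)" for A
      proof (cases "A = ff")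
        case True
        then show ?thesis using f0 by (simp add: BB(2) not_in_iff)
      next
        case False
        then have Aq: "A \<noteq> q" using pq A(2) c(5) by auto
        then have "A \<in># B0" using A(1) BB(2) by simp
        then have "count B A \<le> 1" using Bp(3)[of A] A(2) BB(1) by simp
        then show ?thesis unfolding BB(2) using Aq BB(1) by (auto split: if_splits)
      qed
      moreover have "size (\<tau> B) = n" unfolding BB(2) using Bp(1) BB(1) by simp
      ultimately show ?thesis by (simp add: super_products_def)
    qed
    ultimately have "\<tau> B \<in> U" using B by (simp add: U_def)
    moreover have "(-1) ^ cnt (\<tau> B) = - ((-1) ^ cnt B :: int)"
    proof -
      have "count p (Inr u) = 0 \<and> count q (Inr u) = 1 \<or> count p (Inr u) = 1 \<and> count q (Inr u) = 0"
        using c(10) pq unfolding doubleton_eq_iff by metis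
      moreover have "cnt (\<tau> B) = count q (Inr u) + cnt B0" unfolding BB(2) cnt_def by simp
      moreover have "cnt B = count p (Inr u) + cnt B0" using BB(1) by (simp add: cnt_def)
      ultimately show ?thesis by (elim disjE conjE) simp_all
    qed
    ultimately show ?thesis using inv by blast
  qed
  have "(\<Sum>k\<le>a. (-1) ^ k * int (card (super_plethysm n m (\<gamma> + replicate_mset (a - k) t) (\<delta> + replicate_mset k u))))
      = (\<Sum>k\<le>a. \<Sum>B | B \<in> U \<and> cnt B = k. (-1) ^ cnt B)"
    using fibre by (intro sum.cong) auto
  also have "\<dots> = (\<Sum>B\<in>U. (-1) ^ cnt B)"
    by (rule sum.group[OF finU]) (use cnt_le in auto)
  also have "\<dots> = 0"
    by (rule sum_involution_eq_0[of _ \<tau>]) (use main in auto)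
  finally show ?thesis .
qed

section \<open>The Pieri rule\<close>

definition hadd :: "(nat \<Rightarrow> nat) \<Rightarrow> nat \<Rightarrow> (nat \<Rightarrow> nat) set" where
  "hadd z k = {x. hstrip x z \<and> wt x = wt z + k}"

text \<open>The exponent vectors of the monomials of \<open>h\<^sub>k\<close> in \<open>N\<close>
  variables that divide the monomial with exponents \<open>g\<close>.\<close>

definition below :: "nat \<Rightarrow> nat \<Rightarrow> (nat \<Rightarrow> nat) \<Rightarrow> (nat \<Rightarrow> nat) set" where
  "below N k g = {\<beta>. (\<forall>i. \<beta> i \<le> g i) \<and> (\<forall>i\<ge>N. \<beta> i = 0) \<and> sum \<beta> {..<N} = k}"

lemma hadd_shapes: "z \<in> shapes \<Longrightarrow> x \<in> hadd z k \<Longrightarrow> x \<in> shapes"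
  using hstrip_shapes' by (auto simp: hadd_def)

lemma finite_hadd: "z \<in> shapes \<Longrightarrow> finite (hadd z k)"
  by (rule finite_subset[OF _ finite_shapes_wt[of "wt z + k"]]) (auto simp: hadd_def hstrip_shapes')

lemma finite_below: "finite (below N k g)"
proof (rule finite_subset)
  show "finite {x. \<forall>i. (i \<in> {..<N} \<longrightarrow> x i \<in> {..k}) \<and> (i \<notin> {..<N} \<longrightarrow> x i = (0::nat))}"
    by (rule finite_set_of_finite_funs) auto
  show "below N k g \<subseteq> {x. \<forall>i. (i \<in> {..<N} \<longrightarrow> x i \<in> {..k}) \<and> (i \<notin> {..<N} \<longrightarrow> x i = 0)}"
  proof (clarsimp simp: below_def)
    fix \<beta> :: "nat \<Rightarrow> nat" and i assume "i < N"
    then show "\<beta> i \<le> sum \<beta> {..<N}" by (intro member_le_sum) auto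
  qed
qed

text \<open>For given \<open>y\<close> and \<open>z\<close> the rows \<open>x (Suc i)\<close> of a common extension \<open>x\<close> and the rows \<open>w i\<close> of a
  common reduction \<open>w\<close> range over the same interval; the first row of \<open>x\<close> is free.\<close>

definition fold_up :: "(nat \<Rightarrow> nat) \<Rightarrow> (nat \<Rightarrow> nat) \<Rightarrow> nat \<Rightarrow> (nat \<Rightarrow> nat) \<Rightarrow> nat \<Rightarrow> nat" where
  "fold_up y z b w = (\<lambda>i. case i of 0 \<Rightarrow> max (y 0) (z 0) + b
     | Suc i \<Rightarrow> max (y (Suc i)) (z (Suc i)) + min (y i) (z i) - w i)"

definition fold_down :: "(nat \<Rightarrow> nat) \<Rightarrow> (nat \<Rightarrow> nat) \<Rightarrow> (nat \<Rightarrow> nat) \<Rightarrow> nat \<Rightarrow> nat" where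
  "fold_down y z x = (\<lambda>i. max (y (Suc i)) (z (Suc i)) + min (y i) (z i) - x (Suc i))"

lemma wt_fold:
  assumes y: "y \<in> shapes" and z: "z \<in> shapes" and w: "w \<in> shapes"
    and s: "\<And>i. x (Suc i) + w i = max (y (Suc i)) (z (Suc i)) + min (y i) (z i)"
    and x0: "x 0 = max (y 0) (z 0) + b"
  shows "wt x + wt w = wt y + wt z + b"
proof -
  obtain L1 where L1: "\<And>i. L1 \<le> i \<Longrightarrow> y i = 0" using shapes_bound[OF y] by blast
  obtain L2 where L2: "\<And>i. L2 \<le> i \<Longrightarrow> z i = 0" using shapes_bound[OF z] by blast
  define L where "L = max L1 L2"
  have yL: "y i = 0" and zL: "z i = 0" if "L \<le> i" for i using that L1[of i] L2[of i] by (auto simp: L_def)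
  have wL: "w i = 0" and xL: "x (Suc i) = 0" if "L \<le> i" for i
    using s[of i] yL[OF that] zL[OF that] yL[of "Suc i"] zL[of "Suc i"] that by auto
  have xL': "x i = 0" if "Suc L \<le> i" for i using xL[of "i - 1"] that by (cases i) auto
  have yL': "y i = 0" and zL': "z i = 0" if "Suc L \<le> i" for i using yL[of i] zL[of i] that by auto
  have "wt x = x 0 + (\<Sum>i<L. x (Suc i))"
    using wt_eq_sum_lessThan[of "Suc L" x, OF xL'] by (simp only: sum.lessThan_Suc_shift)
  then have "wt x + wt w = x 0 + (\<Sum>i<L. x (Suc i) + w i)"
    using wt_eq_sum_lessThan[of L w, OF wL] by (simp add: sum.distrib)
  also have "\<dots> = b + (max (y 0) (z 0) + (\<Sum>i<L. max (y (Suc i)) (z (Suc i)))) + (\<Sum>i<L. min (y i) (z i))"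
    unfolding s x0 by (simp add: sum.distrib)
  also have "max (y 0) (z 0) + (\<Sum>i<L. max (y (Suc i)) (z (Suc i))) = (\<Sum>i<Suc L. max (y i) (z i))"
    by (simp only: sum.lessThan_Suc_shift)
  also have "\<dots> = (\<Sum>i<L. max (y i) (z i))" using yL[of L] zL[of L] by simp
  also have "b + (\<Sum>i<L. max (y i) (z i)) + (\<Sum>i<L. min (y i) (z i)) = b + (\<Sum>i<L. y i + z i)"
  proof -
    have "(\<Sum>i<L. max (y i) (z i)) + (\<Sum>i<L. min (y i) (z i)) = (\<Sum>i<L. y i + z i)"
      unfolding sum.distrib[symmetric] by (rule sum.cong) auto
    then show ?thesis by simp
  qed
  also have "\<dots> = wt y + wt z + b"
    using wt_eq_sum_lessThan[of L y, OF yL] wt_eq_sum_lessThan[of L z, OF zL] by (simp add: sum.distrib)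
  finally show ?thesis .
qed

lemma fold_up_props:
  assumes y: "y \<in> shapes" and z: "z \<in> shapes" and w: "hstrip y w" "hstrip z w"
  shows "hstrip (fold_up y z b w) y" "hstrip (fold_up y z b w) z"
    "wt (fold_up y z b w) + wt w = wt y + wt z + b"
    "fold_down y z (fold_up y z b w) = w" "fold_up y z b w 0 = max (y 0) (z 0) + b"
proof -
  let ?x = "fold_up y z b w"
  have bd: "max (y (Suc i)) (z (Suc i)) \<le> w i" "w i \<le> min (y i) (z i)" for i
    using w by (auto simp: hstrip_def)
  show x0: "?x 0 = max (y 0) (z 0) + b" by (simp add: fold_up_def)
  have s: "?x (Suc i) + w i = max (y (Suc i)) (z (Suc i)) + min (y i) (z i)" for i
    using bd[of i] unfolding fold_up_def nat.case by linarith
  have xb: "max (y (Suc i)) (z (Suc i)) \<le> ?x (Suc i)" "?x (Suc i) \<le> min (y i) (z i)" for i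
    using s[of i] bd[of i] by linarith+
  have xge: "y i \<le> ?x i" "z i \<le> ?x i" for i
    using x0 xb(1)[of "i - 1"] by (cases i; simp)+
  show "hstrip ?x y" "hstrip ?x z" using xge xb(2) by (auto simp: hstrip_def)
  show "wt ?x + wt w = wt y + wt z + b"
    by (rule wt_fold[OF y z hstrip_shapes[OF y w(1)] s x0])
  show "fold_down y z ?x = w"
  proof
    show "fold_down y z ?x i = w i" for i using s[of i] unfolding fold_down_def by linarith
  qed
qed

lemma fold_down_props:
  assumes y: "y \<in> shapes" and z: "z \<in> shapes" and x: "hstrip x y" "hstrip x z"
  defines "b \<equiv> x 0 - max (y 0) (z 0)"
  shows "hstrip y (fold_down y z x)" "hstrip z (fold_down y z x)"
    "wt x + wt (fold_down y z x) = wt y + wt z + b"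
    "fold_up y z b (fold_down y z x) = x"
proof -
  let ?w = "fold_down y z x"
  have bd: "max (y (Suc i)) (z (Suc i)) \<le> x (Suc i)" "x (Suc i) \<le> min (y i) (z i)" for i
    using x by (auto simp: hstrip_def)
  have x0: "x 0 = max (y 0) (z 0) + b" using hstripD(2)[OF x(1), of 0] hstripD(2)[OF x(2), of 0]
    by (simp add: b_def)
  have s: "x (Suc i) + ?w i = max (y (Suc i)) (z (Suc i)) + min (y i) (z i)" for i
    using bd[of i] unfolding fold_down_def by linarith
  have wb: "max (y (Suc i)) (z (Suc i)) \<le> ?w i" "?w i \<le> min (y i) (z i)" for i
    using s[of i] bd[of i] by linarith+
  show h: "hstrip y ?w" "hstrip z ?w" unfolding hstrip_def using wb by auto
  show "wt x + wt ?w = wt y + wt z + b"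
    by (rule wt_fold[OF y z hstrip_shapes[OF y h(1)] s x0])
  show "fold_up y z b ?w = x"
  proof
    fix i
    show "fold_up y z b ?w i = x i"
    proof (cases i)
      case 0
      then show ?thesis using x0 by (simp add: fold_up_def)
    next
      case (Suc j)
      then show ?thesis using s[of j] by (simp add: fold_up_def)
    qed
  qed
qed

text \<open>The commutation rule between multiplication by \<open>h\<^sub>k\<close> and skewing by
  \<open>h\<^sub>l\<close>. The number \<open>b\<close> is the excess of the first row of
  \<open>x\<close> over those of \<open>y\<close> and \<open>z\<close>, the one part of
  \<open>x\<close> that has no counterpart in \<open>w\<close>.\<close>

lemma hremove_hadd_commute:
  assumes z: "z \<in> shapes"
  shows "(\<Sum>b\<le>min k l. \<Sum>w\<in>hremove z (l - b). \<Sum>y\<in>hadd w (k - b). f y)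
    = (\<Sum>x\<in>hadd z k. \<Sum>y\<in>hremove x l. (f y :: int))"
proof -
  let ?L = "SIGMA b:{..min k l}. SIGMA w:hremove z (l - b). hadd w (k - b)"
  let ?R = "SIGMA x:hadd z k. hremove x l"
  have "(\<Sum>b\<le>min k l. \<Sum>w\<in>hremove z (l - b). \<Sum>y\<in>hadd w (k - b). f y) = (\<Sum>(b, w, y)\<in>?L. f y)"
    using finite_hremove[OF z] finite_hadd hremove_shapes[OF z]
    by (simp add: sum.Sigma)
  also have "\<dots> = (\<Sum>(x, y)\<in>?R. f y)"
  proof (rule sum.reindex_bij_witness[of _
      "\<lambda>(x, y). (x 0 - max (y 0) (z 0), fold_down y z x, y)" "\<lambda>(b, w, y). (fold_up y z b w, y)"])
    fix p assume "p \<in> ?L"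
    then obtain b w y where p: "p = (b, w, y)" and b: "b \<le> k" "b \<le> l"
      and w: "hstrip z w" "wt z = wt w + (l - b)" and y: "hstrip y w" "wt y = wt w + (k - b)"
      by (auto simp: hremove_def hadd_def)
    have ys: "y \<in> shapes" using hstrip_shapes'[OF hstrip_shapes[OF z w(1)] y(1)] .
    note P = fold_up_props[OF ys z y(1) w(1), of b]
    show "(\<lambda>(x, y). (x 0 - max (y 0) (z 0), fold_down y z x, y)) ((\<lambda>(b, w, y). (fold_up y z b w, y)) p) = p"
      using P(4,5) by (simp add: p)
    have "wt (fold_up y z b w) = wt z + k" "wt (fold_up y z b w) = wt y + l"
      using P(3) w(2) y(2) b by linarith+
    then show "(\<lambda>(b, w, y). (fold_up y z b w, y)) p \<in> ?R"
      using P(1,2) unfolding p hadd_def hremove_def by simp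
    show "(case (\<lambda>(b, w, y). (fold_up y z b w, y)) p of (x, y) \<Rightarrow> f y) = (case p of (b, w, y) \<Rightarrow> f y)"
      by (simp add: p)
  next
    fix p assume "p \<in> ?R"
    then obtain x y where p: "p = (x, y)" and xz: "hstrip x z" "wt x = wt z + k"
      and xy: "hstrip x y" "wt x = wt y + l" by (auto simp: hremove_def hadd_def)
    have ys: "y \<in> shapes" using hstrip_shapes[OF hstrip_shapes'[OF z xz(1)] xy(1)] .
    let ?b = "x 0 - max (y 0) (z 0)" and ?w = "fold_down y z x"
    note P = fold_down_props[OF ys z xy(1) xz(1)]
    have "wt ?w \<le> wt y" "wt ?w \<le> wt z"
      using wt_mono[OF ys, of ?w] wt_mono[OF z, of ?w] P(1,2) by (auto simp: hstrip_def)
    then have "?b \<le> k" "?b \<le> l" "wt z = wt ?w + (l - ?b)" "wt y = wt ?w + (k - ?b)"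
      using P(3) xz(2) xy(2) by linarith+
    then show "(\<lambda>(x, y). (x 0 - max (y 0) (z 0), fold_down y z x, y)) p \<in> ?L"
      using P(1,2) by (simp add: p hadd_def hremove_def)
    show "(\<lambda>(b, w, y). (fold_up y z b w, y)) ((\<lambda>(x, y). (x 0 - max (y 0) (z 0), fold_down y z x, y)) p) = p"
      using P(4) by (simp add: p)
  qed
  also have "\<dots> = (\<Sum>x\<in>hadd z k. \<Sum>y\<in>hremove x l. f y)"
    using finite_hadd[OF z] finite_hremove hadd_shapes[OF z] by (simp add: sum.Sigma)
  finally show ?thesis .
qed

lemma sum_below_Suc:
  "(\<Sum>\<beta>\<in>below (Suc N) k g. F \<beta>) = (\<Sum>b\<le>min k (g N). \<Sum>\<beta>\<in>below N (k - b) g. F (\<beta>(N := b)))"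
proof -
  have "(\<Sum>b\<le>min k (g N). \<Sum>\<beta>\<in>below N (k - b) g. F (\<beta>(N := b)))
      = (\<Sum>(b, \<beta>)\<in>(SIGMA b:{..min k (g N)}. below N (k - b) g). F (\<beta>(N := b)))"
    by (simp add: sum.Sigma finite_below)
  also have "\<dots> = (\<Sum>\<beta>\<in>below (Suc N) k g. F \<beta>)"
  proof (rule sum.reindex_bij_witness[of _ "\<lambda>\<beta>. (\<beta> N, \<beta>(N := 0))" "\<lambda>(b, \<beta>). \<beta>(N := b)"])
    fix p assume "p \<in> (SIGMA b:{..min k (g N)}. below N (k - b) g)"
    then obtain b \<beta> where p: "p = (b, \<beta>)" and b: "b \<le> k" "b \<le> g N"
      and \<beta>: "\<And>i. \<beta> i \<le> g i" "\<And>i. N \<le> i \<Longrightarrow> \<beta> i = 0" "sum \<beta> {..<N} = k - b"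
      by (auto simp: below_def)
    have "(\<beta>(N := b))(N := 0) = \<beta>" using \<beta>(2)[of N] by auto
    then show "(\<lambda>\<beta>. (\<beta> N, \<beta>(N := 0))) ((\<lambda>(b, \<beta>). \<beta>(N := b)) p) = p" by (simp add: p)
    have "sum (\<beta>(N := b)) {..<N} = k - b" using \<beta>(3) by simp
    moreover have "(\<beta>(N := b)) i \<le> g i" for i using \<beta>(1)[of i] b by simp
    moreover have "(\<beta>(N := b)) i = 0" if "Suc N \<le> i" for i using \<beta>(2)[of i] that by simp
    ultimately show "(\<lambda>(b, \<beta>). \<beta>(N := b)) p \<in> below (Suc N) k g" using b(1) by (simp add: p below_def)
    show "F ((\<lambda>(b, \<beta>). \<beta>(N := b)) p) = (case p of (b, \<beta>) \<Rightarrow> F (\<beta>(N := b)))" by (simp add: p)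
  next
    fix \<beta> assume "\<beta> \<in> below (Suc N) k g"
    then have \<beta>: "\<And>i. \<beta> i \<le> g i" "\<And>i. Suc N \<le> i \<Longrightarrow> \<beta> i = 0" "sum \<beta> {..<N} + \<beta> N = k"
      by (auto simp: below_def)
    show "(\<lambda>(b, \<beta>). \<beta>(N := b)) ((\<lambda>\<beta>. (\<beta> N, \<beta>(N := 0))) \<beta>) = \<beta>" by simp
    have "(\<beta>(N := 0)) i \<le> g i" for i using \<beta>(1)[of i] by simp
    moreover have "(\<beta>(N := 0)) i = 0" if "N \<le> i" for i using \<beta>(2)[of i] that by (cases "i = N") auto
    moreover have "sum (\<beta>(N := 0)) {..<N} = k - \<beta> N" using \<beta>(3) by simp
    ultimately show "(\<lambda>\<beta>. (\<beta> N, \<beta>(N := 0))) \<beta> \<in> (SIGMA b:{..min k (g N)}. below N (k - b) g)"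
      using \<beta>(1)[of N] \<beta>(3) by (simp add: below_def)
  qed
  finally show ?thesis by simp
qed

text \<open>The left-hand side is the coefficient of \<open>h\<^sub>k\<close> times the Schur
  function of \<open>z\<close> at the monomial \<open>g\<close>. Peeling off the last variable from
  both factors leaves exactly the commutation of adding and removing horizontal strips.\<close>

lemma kostka_Pieri:
  assumes "z \<in> shapes"
  shows "(\<Sum>\<beta>\<in>below N k g. kostka N z (\<lambda>i. g i - \<beta> i)) = (\<Sum>x\<in>hadd z k. kostka N x g)"
  using assms
proof (induction N arbitrary: z k)
  case 0
  have b: "below 0 k g = (if k = 0 then {\<lambda>_. 0} else {})" by (auto simp: below_def)
  have "x = z" if "x \<in> hadd z 0" for x
    using that hremove_0[OF hadd_shapes[OF 0 that]] by (auto simp: hadd_def hremove_def)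
  moreover have "z \<in> hadd z 0" using hremove_0[OF 0] by (auto simp: hadd_def hremove_def)
  ultimately have h0: "hadd z 0 = {z}" by blast
  show ?case
  proof (cases "k = 0")
    case False
    have "x \<noteq> (\<lambda>_. 0)" if "x \<in> hadd z k" for x using that False by (auto simp: hadd_def)
    then have "(\<Sum>x\<in>hadd z k. kostka 0 x g) = 0" by (intro sum.neutral) auto
    then show ?thesis using False b by simp
  qed (use b h0 in simp)
next
  case (Suc N)
  have "(\<Sum>\<beta>\<in>below (Suc N) k g. kostka (Suc N) z (\<lambda>i. g i - \<beta> i))
    = (\<Sum>b\<le>min k (g N). \<Sum>\<beta>\<in>below N (k - b) g. \<Sum>w\<in>hremove z (g N - b). kostka N w (\<lambda>i. g i - \<beta> i))"
    unfolding sum_below_Suc by (auto intro!: sum.cong kostka_cong)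
  also have "\<dots> = (\<Sum>b\<le>min k (g N). \<Sum>w\<in>hremove z (g N - b). \<Sum>\<beta>\<in>below N (k - b) g. kostka N w (\<lambda>i. g i - \<beta> i))"
    by (rule sum.cong[OF refl]) (rule sum.swap)
  also have "\<dots> = (\<Sum>b\<le>min k (g N). \<Sum>w\<in>hremove z (g N - b). \<Sum>y\<in>hadd w (k - b). kostka N y g)"
    by (rule sum.cong[OF refl], rule sum.cong[OF refl], rule Suc.IH, rule hremove_shapes[OF Suc.prems])
  also have "\<dots> = (\<Sum>x\<in>hadd z k. \<Sum>y\<in>hremove x (g N). kostka N y g)"
    by (rule hremove_hadd_commute[OF Suc.prems])
  finally show ?case by simp
qed

text \<open>The shapes all of whose columns have even length.\<close>

definition paired :: "(nat \<Rightarrow> nat) set" where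
  "paired = {z \<in> shapes. \<forall>i. z (2 * i) = z (2 * i + 1)}"

lemma finite_paired_wt: "finite {z \<in> paired. wt z + k = d}"
  by (rule finite_subset[OF _ finite_shapes_wt[of "d - k"]]) (auto simp: paired_def)

section \<open>Multigraphs and complements\<close>

definition pairs :: "nat \<Rightarrow> (nat \<times> nat) set" where
  "pairs N = {(i, j). i < j \<and> j < N}"

text \<open>A loopless multigraph on the vertices \<open>0, \<dots>, N - 1\<close> is given by the multiplicities of its edges.\<close>

definition degree_at :: "nat \<Rightarrow> (nat \<times> nat \<Rightarrow> nat) \<Rightarrow> nat \<Rightarrow> nat" where
  "degree_at N e l = (\<Sum>p\<in>pairs N. if l = fst p \<or> l = snd p then e p else 0)"

definition graphs :: "nat \<Rightarrow> (nat \<Rightarrow> nat) \<Rightarrow> (nat \<times> nat \<Rightarrow> nat) set" where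
  "graphs N g = {e. (\<forall>p. p \<notin> pairs N \<longrightarrow> e p = 0) \<and> (\<forall>l<N. degree_at N e l = g l)}"

lemma finite_pairs: "finite (pairs N)"
  by (rule finite_subset[of _ "{..<N} \<times> {..<N}"]) (auto simp: pairs_def)

lemma pairs_Suc: "pairs (Suc N) = pairs N \<union> (\<lambda>i. (i, N)) ` {..<N}"
  "pairs N \<inter> (\<lambda>i. (i, N)) ` {..<N} = {}"
  by (auto simp: pairs_def less_Suc_eq)

lemma sum_pairs_Suc: "(\<Sum>p\<in>pairs (Suc N). h p) = (\<Sum>p\<in>pairs N. h p) + (\<Sum>i<N. h (i, N))"
proof -
  have "(\<Sum>p\<in>(\<lambda>i. (i, N)) ` {..<N}. h p) = (\<Sum>i<N. h (i, N))"
    by (subst sum.reindex) (auto simp: inj_on_def)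
  then show ?thesis
    unfolding pairs_Suc(1) using finite_pairs pairs_Suc(2) by (subst sum.union_disjoint) auto
qed

lemma degree_at_Suc:
  "l < N \<Longrightarrow> degree_at (Suc N) e l = degree_at N e l + e (l, N)"
  "degree_at (Suc N) e N = (\<Sum>i<N. e (i, N))"
proof -
  assume "l < N"
  then have "(\<Sum>i<N. if l = fst (i, N) \<or> l = snd (i, N) then e (i, N) else 0) = (\<Sum>i<N. if i = l then e (l, N) else 0)"
    by (intro sum.cong) auto
  then show "degree_at (Suc N) e l = degree_at N e l + e (l, N)"
    using \<open>l < N\<close> unfolding degree_at_def sum_pairs_Suc by simp
next
  have "(\<Sum>p\<in>pairs N. if N = fst p \<or> N = snd p then e p else 0) = 0"
    by (rule sum.neutral) (auto simp: pairs_def)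
  then show "degree_at (Suc N) e N = (\<Sum>i<N. e (i, N))"
    unfolding degree_at_def sum_pairs_Suc by simp
qed

lemma degree_at_cong: "(\<And>p. p \<in> pairs N \<Longrightarrow> e p = e' p) \<Longrightarrow> degree_at N e l = degree_at N e' l"
  unfolding degree_at_def by (intro sum.cong) auto

text \<open>The multiplicities of the edges at the last vertex form a vector \<beta> with sum
  \<open>g N\<close>, and the other vertices keep a graph with degrees lowered by \<beta>. The bound
  of \<beta> by \<open>g\<close> makes the truncated subtraction exact.\<close>

lemma graphs_Suc_bij:
  "bij_betw (\<lambda>e. (\<lambda>i. if i < N then e (i, N) else 0, \<lambda>p. if p \<in> pairs N then e p else 0))
    (graphs (Suc N) g) (SIGMA \<beta>:below N (g N) g. graphs N (\<lambda>i. g i - \<beta> i))"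
proof (rule bij_betw_byWitness[where f' = "\<lambda>(\<beta>, e) p. if p \<in> pairs N then e p else if snd p = N then \<beta> (fst p) else 0"])
  let ?r = "\<lambda>e. (\<lambda>i. if i < N then e (i, N) else 0, \<lambda>p. if p \<in> pairs N then e p else 0 :: nat)"
  let ?m = "\<lambda>(\<beta>, e) p. if p \<in> pairs N then e p else if snd p = N then \<beta> (fst p) else 0 :: nat"
  let ?S = "SIGMA \<beta>:below N (g N) g. graphs N (\<lambda>i. g i - \<beta> i)"
  have nin: "(i, N) \<notin> pairs N" for i by (simp add: pairs_def)
  show "\<forall>e\<in>graphs (Suc N) g. ?m (?r e) = e"
  proof
    fix e assume "e \<in> graphs (Suc N) g"
    then have e0: "e p = 0" if "p \<notin> pairs (Suc N)" for p using that unfolding graphs_def by blast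
    show "?m (?r e) = e"
    proof
      fix p :: "nat \<times> nat"
      obtain i j where p: "p = (i, j)" by (cases p)
      show "?m (?r e) p = e p"
      proof (cases "p \<in> pairs (Suc N)")
        case True
        then show ?thesis using nin by (auto simp: p pairs_Suc)
      next
        case False
        then show ?thesis using e0[OF False] by (auto simp: p pairs_Suc)
      qed
    qed
  qed
  show "\<forall>q\<in>?S. ?r (?m q) = q"
  proof
    fix q assume "q \<in> ?S"
    then obtain \<beta> e where q: "q = (\<beta>, e)" and b: "\<And>i. N \<le> i \<Longrightarrow> \<beta> i = 0" and e: "\<And>p. p \<notin> pairs N \<Longrightarrow> e p = 0"
      by (auto simp: graphs_def below_def)
    have "(\<lambda>i. if i < N then ?m q (i, N) else 0) = \<beta>"
    proof
      show "(if i < N then ?m q (i, N) else 0) = \<beta> i" for i using b[of i] nin by (simp add: q)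
    qed
    moreover have "(\<lambda>p. if p \<in> pairs N then ?m q p else 0) = e"
    proof
      show "(if p \<in> pairs N then ?m q p else 0) = e p" for p using e[of p] by (simp add: q)
    qed
    ultimately show "?r (?m q) = q" unfolding q by simp
  qed
  show "?r ` graphs (Suc N) g \<subseteq> ?S"
  proof
    fix q assume "q \<in> ?r ` graphs (Suc N) g"
    then obtain e where e: "e \<in> graphs (Suc N) g" and q: "q = ?r e" by blast
    have d: "degree_at (Suc N) e l = g l" if "l < Suc N" for l using e that by (simp add: graphs_def)
    have d1: "degree_at N e l + e (l, N) = g l" if "l < N" for l
      using d[of l] degree_at_Suc(1)[OF that, of e] that by simp
    have dN: "(\<Sum>i<N. e (i, N)) = g N" using d[of N] degree_at_Suc(2)[of N e] by simp
    have "(\<lambda>i. if i < N then e (i, N) else 0) \<in> below N (g N) g"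
      unfolding below_def using dN d1 by (auto simp flip: d1)
    moreover have "degree_at N (\<lambda>p. if p \<in> pairs N then e p else 0) l = g l - (if l < N then e (l, N) else 0)"
      if "l < N" for l
      using d1[OF that] that degree_at_cong[of N "\<lambda>p. if p \<in> pairs N then e p else 0" e l] by simp
    ultimately show "q \<in> ?S" by (auto simp: q graphs_def)
  qed
  show "?m ` ?S \<subseteq> graphs (Suc N) g"
  proof
    fix f assume "f \<in> ?m ` ?S"
    then obtain \<beta> e where f: "f = ?m (\<beta>, e)" and \<beta>: "\<beta> \<in> below N (g N) g"
      and e: "e \<in> graphs N (\<lambda>i. g i - \<beta> i)" by blast
    have fN: "f (i, N) = \<beta> i" for i using nin by (simp add: f)
    have fe: "degree_at N f l = degree_at N e l" for l by (rule degree_at_cong) (simp add: f)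
    have le: "\<beta> i \<le> g i" for i using \<beta> by (simp add: below_def)
    have "degree_at (Suc N) f l = g l" if "l < Suc N" for l
    proof (cases "l = N")
      case True
      then show ?thesis using \<beta> by (simp add: degree_at_Suc(2) fN below_def)
    next
      case False
      then have "l < N" using that by simp
      then show ?thesis using e le[of l] by (simp add: degree_at_Suc(1) fN fe graphs_def)
    qed
    moreover have "f p = 0" if "p \<notin> pairs (Suc N)" for p
    proof -
      obtain i j where p: "p = (i, j)" by (cases p)
      have "p \<notin> pairs N" "j = N \<longrightarrow> N \<le> i" using that by (auto simp: pairs_def p)
      then show ?thesis using \<beta> by (simp add: f p below_def)
    qed
    ultimately show "f \<in> graphs (Suc N) g" by (simp add: graphs_def)
  qed
qed

lemma finite_graphs: "finite (graphs N g)"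
proof (induction N arbitrary: g)
  case 0
  have "graphs 0 g \<subseteq> {\<lambda>_. 0}" by (auto simp: graphs_def pairs_def)
  then show ?case by (rule finite_subset) simp
next
  case (Suc N)
  show ?case unfolding bij_betw_finite[OF graphs_Suc_bij] using Suc by (intro finite_SigmaI finite_below)
qed

lemma card_graphs_Suc: "card (graphs (Suc N) g) = (\<Sum>\<beta>\<in>below N (g N) g. card (graphs N (\<lambda>i. g i - \<beta> i)))"
  unfolding bij_betw_same_card[OF graphs_Suc_bij]
  by (intro card_SigmaI finite_below) (simp add: finite_graphs)

section \<open>Littlewood's identity\<close>

definition round_up :: "(nat \<Rightarrow> nat) \<Rightarrow> nat \<Rightarrow> nat" where
  "round_up v i = v (2 * (i div 2))"

definition round_down :: "(nat \<Rightarrow> nat) \<Rightarrow> nat \<Rightarrow> nat" where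
  "round_down v i = v (2 * (i div 2) + 1)"

lemma round_strips:
  assumes "v \<in> shapes"
  shows "hstrip (round_up v) v" "hstrip v (round_down v)"
proof -
  have "i \<le> 2 * (Suc i div 2)" "2 * (i div 2) \<le> i" "2 * (i div 2) + 1 \<le> Suc i" "i \<le> 2 * (i div 2) + 1" for i :: nat
    by presburger+
  then show "hstrip (round_up v) v" "hstrip v (round_down v)"
    unfolding hstrip_def round_up_def round_down_def using shapes_antimono[OF assms] by blast+
qed

lemma round_paired:
  assumes "v \<in> shapes"
  shows "round_up v \<in> paired" "round_down v \<in> paired"
  using hstrip_shapes'[OF assms round_strips(1)[OF assms]] hstrip_shapes[OF assms round_strips(2)[OF assms]]
  by (simp_all add: paired_def round_up_def round_down_def)

text \<open>Interlacing encloses every second row of \<open>v\<close> between two equal rows of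
  \<open>z\<close>. So \<open>round_down v\<close> and \<open>round_up v\<close> are the only paired
  shapes from which \<open>v\<close> differs by a horizontal strip, one inside \<open>v\<close> and
  one around it.\<close>

lemma paired_strip_unique:
  assumes "z \<in> paired"
  shows "hstrip v z \<Longrightarrow> round_down v = z" "hstrip z v \<Longrightarrow> round_up v = z"
proof -
  have p: "z i = z (2 * (i div 2))" "z i = z (2 * (i div 2) + 1)" for i
  proof -
    have "z (2 * (i div 2)) = z (2 * (i div 2) + 1)" using assms by (simp add: paired_def)
    moreover have "i = 2 * (i div 2) \<or> i = 2 * (i div 2) + 1" by presburger
    ultimately show "z i = z (2 * (i div 2))" "z i = z (2 * (i div 2) + 1)" by metis+
  qed
  show "round_down v = z" if "hstrip v z"
  proof
    fix i
    show "round_down v i = z i"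
      using hstripD(1)[OF that, of "2 * (i div 2)"] hstripD(2)[OF that, of "2 * (i div 2) + 1"] p[of i]
      unfolding round_down_def by simp
  qed
  show "round_up v = z" if "hstrip z v"
  proof
    fix i
    show "round_up v i = z i"
      using hstripD(1)[OF that, of "2 * (i div 2)"] hstripD(2)[OF that, of "2 * (i div 2)"] p[of i]
      unfolding round_up_def by simp
  qed
qed

text \<open>The strip between \<open>round_down v\<close> and \<open>v\<close> therefore has the
  same size as the one between \<open>v\<close> and \<open>round_up v\<close>.\<close>

lemma wt_round:
  assumes v: "v \<in> shapes"
  shows "wt (round_up v) + wt (round_down v) = 2 * wt v"
proof -
  obtain L where L: "\<And>i. L \<le> i \<Longrightarrow> v i = 0" using shapes_bound[OF v] by blast
  have z: "v i = 0" "round_up v i = 0" "round_down v i = 0" if "2 * L \<le> i" for i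
  proof -
    have "L \<le> i" "L \<le> 2 * (i div 2)" "L \<le> 2 * (i div 2) + 1" using that by presburger+
    then show "v i = 0" "round_up v i = 0" "round_down v i = 0"
      using L unfolding round_up_def round_down_def by blast+
  qed
  have "(\<Sum>i<2 * k. round_up v i + round_down v i) = 2 * (\<Sum>i<2 * k. v i)" for k
    by (induction k) (simp_all add: round_up_def round_down_def)
  then show ?thesis
    using wt_eq_sum_lessThan[of "2 * L" v, OF z(1)] wt_eq_sum_lessThan[of "2 * L" "round_up v", OF z(2)]
      wt_eq_sum_lessThan[of "2 * L" "round_down v", OF z(3)]
    by (simp add: sum.distrib)
qed

lemma finite_paired: "finite {z \<in> paired. wt z = d}"
  using finite_paired_wt[of 0 d] by simp

text \<open>Delete the last vertex, of degree \<open>k = g N\<close>. Its edges amount to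
  multiplication by \<open>h\<^sub>k\<close>, so Pieri's rule turns the paired shapes
  \<open>z\<close> of the smaller graph into shapes \<open>v\<close> larger by a horizontal strip of
  size \<open>k\<close>. On the other side the last letter removes such a strip from a paired shape,
  again leaving a shape \<open>v\<close>.\<close>

lemma card_graphs_eq_sum_kostka:
  "int (card (graphs N g)) = (\<Sum>z | z \<in> paired \<and> wt z = sum g {..<N}. kostka N z g)"
proof (induction N arbitrary: g)
  case 0
  have "graphs 0 g = {\<lambda>_. 0}" by (auto simp: graphs_def pairs_def)
  moreover have "{z \<in> paired. wt z = 0} = {\<lambda>_. 0}"
  proof -
    have "z = (\<lambda>_. 0)" if "z \<in> paired" "wt z = 0" for z
      using that by (intro wt_eq_0) (simp_all add: paired_def)
    moreover have "(\<lambda>_. 0) \<in> paired" by (simp add: paired_def)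
    ultimately show ?thesis using wt_zero by blast
  qed
  ultimately show ?case by simp
next
  case (Suc N)
  let ?S = "sum g {..<N}" and ?k = "g N"
  let ?P = "{z \<in> paired. wt z + ?k = ?S}" and ?Q = "{z \<in> paired. wt z = sum g {..<Suc N}}"
  have Ps: "z \<in> shapes" if "z \<in> ?P" for z using that by (simp add: paired_def)
  have Qs: "z \<in> shapes" if "z \<in> ?Q" for z using that by (simp add: paired_def)
  have "int (card (graphs (Suc N) g)) = (\<Sum>\<beta>\<in>below N ?k g. int (card (graphs N (\<lambda>i. g i - \<beta> i))))"
    by (simp add: card_graphs_Suc)
  also have "\<dots> = (\<Sum>\<beta>\<in>below N ?k g. \<Sum>z\<in>?P. kostka N z (\<lambda>i. g i - \<beta> i))"
  proof (rule sum.cong[OF refl])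
    fix \<beta> assume "\<beta> \<in> below N ?k g"
    then have b: "\<And>i. \<beta> i \<le> g i" "sum \<beta> {..<N} = ?k" by (auto simp: below_def)
    have "(\<Sum>i<N. g i - \<beta> i) + (\<Sum>i<N. \<beta> i) = ?S" using b(1) by (simp flip: sum.distrib)
    then have "{z \<in> paired. wt z = (\<Sum>i<N. g i - \<beta> i)} = ?P" using b(2) by auto
    then show "int (card (graphs N (\<lambda>i. g i - \<beta> i))) = (\<Sum>z\<in>?P. kostka N z (\<lambda>i. g i - \<beta> i))"
      using Suc.IH[of "\<lambda>i. g i - \<beta> i"] by simp
  qed
  also have "\<dots> = (\<Sum>z\<in>?P. \<Sum>\<beta>\<in>below N ?k g. kostka N z (\<lambda>i. g i - \<beta> i))" by (rule sum.swap)
  also have "\<dots> = (\<Sum>z\<in>?P. \<Sum>v\<in>hadd z ?k. kostka N v g)"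
    by (rule sum.cong[OF refl]) (rule kostka_Pieri, rule Ps)
  also have "\<dots> = (\<Sum>(z, v)\<in>(SIGMA z:?P. hadd z ?k). kostka N v g)"
    using finite_paired_wt finite_hadd[OF Ps] by (intro sum.Sigma) blast+
  \<comment> \<open>Each \<open>v\<close> has one paired shape inside and one around it, and as the
    two strips have equal size, the weight conditions on both sides match.\<close>
  also have "\<dots> = (\<Sum>(z, v)\<in>(SIGMA z:?Q. hremove z ?k). kostka N v g)"
  proof (rule sum.reindex_bij_witness[of _ "\<lambda>(z, v). (round_down v, v)" "\<lambda>(z, v). (round_up v, v)"])
    fix p assume "p \<in> (SIGMA z:?P. hadd z ?k)"
    then obtain z v where p: "p = (z, v)" and z: "z \<in> paired" "wt z + ?k = ?S"
      and v: "hstrip v z" "wt v = wt z + ?k" by (auto simp: hadd_def)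
    have zs: "z \<in> shapes" using z(1) by (simp add: paired_def)
    have vs: "v \<in> shapes" by (rule hstrip_shapes'[OF zs v(1)])
    have rz: "round_down v = z" by (rule paired_strip_unique(1)[OF z(1) v(1)])
    show "(\<lambda>(z, v). (round_down v, v)) ((\<lambda>(z, v). (round_up v, v)) p) = p" by (simp add: p rz)
    have "wt (round_up v) = wt v + ?k" "wt (round_up v) = ?S + ?k"
      using wt_round[OF vs] rz z(2) v(2) by auto
    then show "(\<lambda>(z, v). (round_up v, v)) p \<in> (SIGMA z:?Q. hremove z ?k)"
      using round_paired(1)[OF vs] round_strips(1)[OF vs] by (simp add: p hremove_def)
    show "(case (\<lambda>(z, v). (round_up v, v)) p of (z, v) \<Rightarrow> kostka N v g) = (case p of (z, v) \<Rightarrow> kostka N v g)"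
      by (simp add: p)
  next
    fix p assume "p \<in> (SIGMA z:?Q. hremove z ?k)"
    then obtain z v where p: "p = (z, v)" and z: "z \<in> paired" "wt z = ?S + ?k"
      and v: "hstrip z v" "wt z = wt v + ?k" by (auto simp: hremove_def)
    have zs: "z \<in> shapes" using z(1) by (simp add: paired_def)
    have vs: "v \<in> shapes" by (rule hstrip_shapes[OF zs v(1)])
    have rz: "round_up v = z" by (rule paired_strip_unique(2)[OF z(1) v(1)])
    show "(\<lambda>(z, v). (round_up v, v)) ((\<lambda>(z, v). (round_down v, v)) p) = p" by (simp add: p rz)
    have "wt v = wt (round_down v) + ?k" "wt (round_down v) + ?k = ?S"
      using wt_round[OF vs] rz z(2) v(2) by auto
    then show "(\<lambda>(z, v). (round_down v, v)) p \<in> (SIGMA z:?P. hadd z ?k)"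
      using round_paired(2)[OF vs] round_strips(2)[OF vs] by (simp add: p hadd_def)
  qed
  also have "\<dots> = (\<Sum>z\<in>?Q. \<Sum>v\<in>hremove z ?k. kostka N v g)"
    using finite_paired finite_hremove[OF Qs] by (intro sum.Sigma[symmetric]) blast+
  finally show ?case by simp
qed

section \<open>Complements in a box\<close>

definition box_complement :: "nat \<Rightarrow> nat \<Rightarrow> (nat \<Rightarrow> nat) \<Rightarrow> nat \<Rightarrow> nat" where
  "box_complement N n x = (\<lambda>i. if i < N then n - x (N - Suc i) else 0)"

definition in_box :: "nat \<Rightarrow> nat \<Rightarrow> (nat \<Rightarrow> nat) \<Rightarrow> bool" where
  "in_box N n x \<longleftrightarrow> x \<in> shapes \<and> (\<forall>i\<ge>N. x i = 0) \<and> (\<forall>i. x i \<le> n)"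

lemma box_complement_in_box:
  assumes "in_box N n x"
  shows "in_box N n (box_complement N n x)"
proof -
  have x: "x \<in> shapes" using assms by (simp add: in_box_def)
  have "box_complement N n x \<in> shapes"
  proof (rule shapesI[of _ N])
    fix i
    have "x (N - Suc i) \<le> x (N - Suc (Suc i))" by (rule shapes_antimono[OF x]) simp
    then show "box_complement N n x (Suc i) \<le> box_complement N n x i" by (auto simp: box_complement_def)
  qed (simp add: box_complement_def)
  then show ?thesis by (auto simp: in_box_def box_complement_def)
qed

lemma box_complement_involution: "in_box N n x \<Longrightarrow> box_complement N n (box_complement N n x) = x"
proof
  fix i assume "in_box N n x"
  then show "box_complement N n (box_complement N n x) i = x i"
    by (cases "i < N") (auto simp: box_complement_def in_box_def Suc_diff_Suc)
qed

lemma wt_box_complement: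
  assumes "in_box N n x"
  shows "wt (box_complement N n x) + wt x = N * n"
proof -
  have "wt (box_complement N n x) = (\<Sum>i<N. n - x (N - Suc i))"
    using wt_eq_sum_lessThan[of N "box_complement N n x"] by (simp add: box_complement_def)
  also have "\<dots> = (\<Sum>i<N. n - x i)" by (rule sum.nat_diff_reindex)
  finally have "wt (box_complement N n x) = (\<Sum>i<N. n - x i)" .
  moreover have "wt x = sum x {..<N}" by (rule wt_eq_sum_lessThan) (use assms in \<open>simp add: in_box_def\<close>)
  moreover have "(\<Sum>i<N. n - x i) + (\<Sum>i<N. x i) = (\<Sum>i<N. n)"
    using assms unfolding sum.distrib[symmetric] by (intro sum.cong) (auto simp: in_box_def)
  ultimately show ?thesis by simp
qed

lemma hstrip_box_complement:
  assumes "in_box (Suc N) n x" "in_box N n y" "hstrip x y"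
  shows "hstrip (box_complement (Suc N) n x) (box_complement N n y)"
  unfolding hstrip_def
proof
  fix i
  show "box_complement (Suc N) n x (Suc i) \<le> box_complement N n y i \<and>
    box_complement N n y i \<le> box_complement (Suc N) n x i"
  proof (cases "i < N")
    case True
    then have "N - i = Suc (N - Suc i)" by simp
    then have "x (N - i) \<le> y (N - Suc i)" "y (N - Suc i) \<le> x (N - Suc i)"
      using hstripD[OF assms(3), of "N - Suc i"] by simp_all
    then show ?thesis using True by (auto simp: box_complement_def)
  qed (simp add: box_complement_def)
qed

text \<open>On Schur functions this inverts the \<open>N\<close> variables and multiplies by the
  \<open>n\<close>-th power of their product. In the chain of strips, the shape filled by the first
  \<open>k\<close> letters is complemented in a box with \<open>k\<close> rows, so a strip of size
  \<open>a\<close> becomes one of size \<open>n - a\<close>.\<close>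

lemma kostka_box_complement:
  assumes "in_box N n x" "\<And>i. g i \<le> n"
  shows "kostka N (box_complement N n x) (\<lambda>i. n - g i) = kostka N x g"
  using assms(1)
proof (induction N arbitrary: x)
  case 0
  have "x = (\<lambda>_. 0)" using 0 by (auto simp: in_box_def)
  then show ?case by (simp add: box_complement_def)
next
  case (Suc N)
  \<comment> \<open>Shapes outside the box with \<open>N\<close> rows have Kostka number 0; on the
    others complementing is an involution.\<close>
  define H where "H = (\<lambda>x k. {y \<in> hremove x k. in_box N n y})"
  have K: "kostka (Suc N) x h = (\<Sum>y\<in>H x (h N). kostka N y h)" if x: "in_box (Suc N) n x" for x h
  proof -
    have xs: "x \<in> shapes" using x by (simp add: in_box_def)
    have "kostka N y h = 0" if y: "y \<in> hremove x (h N) - H x (h N)" for y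
    proof (rule ccontr)
      assume nz: "kostka N y h \<noteq> 0"
      have ys: "y \<in> shapes" using hremove_shapes[OF xs] y by blast
      have "y i \<le> n" for i
      proof -
        have "y i \<le> x i" using y by (simp add: hremove_def hstrip_def)
        also have "\<dots> \<le> n" using x by (simp add: in_box_def)
        finally show ?thesis .
      qed
      then have "in_box N n y" using ys kostka_support[OF ys nz] by (simp add: in_box_def)
      then show False using y by (simp add: H_def)
    qed
    moreover have "H x (h N) \<subseteq> hremove x (h N)" by (auto simp: H_def)
    ultimately have "(\<Sum>y\<in>hremove x (h N). kostka N y h) = (\<Sum>y\<in>H x (h N). kostka N y h)"
      using finite_hremove[OF xs] by (intro sum.mono_neutral_right) auto
    then show ?thesis by simp
  qed
  have step: "box_complement N n y \<in> H (box_complement (Suc N) n x) (n - k)"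
    if x: "in_box (Suc N) n x" and y: "y \<in> H x k" and k: "k \<le> n" for x y k
  proof -
    have yb: "in_box N n y" and h: "hstrip x y" "wt x = wt y + k" using y by (auto simp: H_def hremove_def)
    have "wt (box_complement (Suc N) n x) = wt (box_complement N n y) + (n - k)"
      using wt_box_complement[OF x] wt_box_complement[OF yb] h(2) k by simp
    then show ?thesis
      using hstrip_box_complement[OF x yb h(1)] box_complement_in_box[OF yb] by (simp add: H_def hremove_def)
  qed
  let ?x = "box_complement (Suc N) n x"
  have x': "in_box (Suc N) n ?x" by (rule box_complement_in_box[OF Suc.prems])
  have "(\<Sum>y\<in>H x (g N). kostka N y g) = (\<Sum>y\<in>H ?x (n - g N). kostka N y (\<lambda>i. n - g i))"
  proof (rule sum.reindex_bij_witness[of _ "box_complement N n" "box_complement N n"])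
    fix y assume y: "y \<in> H x (g N)"
    then have yb: "in_box N n y" by (simp add: H_def)
    show "box_complement N n (box_complement N n y) = y" by (rule box_complement_involution[OF yb])
    show "box_complement N n y \<in> H ?x (n - g N)" by (rule step[OF Suc.prems y assms(2)])
    show "kostka N (box_complement N n y) (\<lambda>i. n - g i) = kostka N y g" by (rule Suc.IH[OF yb])
  next
    fix y assume y: "y \<in> H ?x (n - g N)"
    then have yb: "in_box N n y" by (simp add: H_def)
    show "box_complement N n (box_complement N n y) = y" by (rule box_complement_involution[OF yb])
    show "box_complement N n y \<in> H x (g N)"
      using step[OF x' y] assms(2)[of N] box_complement_involution[OF Suc.prems] by simp
  qed
  then show ?case using K[OF Suc.prems, of g] K[OF x', of "\<lambda>i. n - g i"] by simp
qed

section \<open>The plethysms of one-row and one-column Schur functions\<close>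

lemma count_image_mset_inj_on:
  "inj_on f (insert x (set_mset M)) \<Longrightarrow> count (image_mset f M) (f x) = count M x"
proof (induction M)
  case (add a M)
  then have "inj_on f (insert x (set_mset M))" by (auto intro: inj_on_subset)
  moreover have "f a = f x \<longleftrightarrow> a = x" by (rule inj_on_eq_iff[OF add.prems]) auto
  ultimately show ?case using add.IH by simp
qed simp

lemma schur_row: "schur [m] \<alpha> = (if size \<alpha> = m then 1 else 0)"
proof -
  have iff: "T \<in> ssyt [m] \<and> mset (concat T) = \<alpha> \<longleftrightarrow> size \<alpha> = m \<and> T = [sorted_list_of_multiset \<alpha>]" for T
  proof
    assume a: "T \<in> ssyt [m] \<and> mset (concat T) = \<alpha>"
    then have l: "map length T = [m]" by (simp add: ssyt_def)
    then obtain r where T: "T = [r]" by (cases T) auto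
    then have "sorted r" "length r = m" "mset r = \<alpha>" using a l by (auto simp: ssyt_def)
    then show "size \<alpha> = m \<and> T = [sorted_list_of_multiset \<alpha>]"
      using T by (auto simp: sorted_sort_id)
  next
    assume "size \<alpha> = m \<and> T = [sorted_list_of_multiset \<alpha>]"
    then show "T \<in> ssyt [m] \<and> mset (concat T) = \<alpha>" by (simp add: ssyt_def flip: size_mset)
  qed
  have "{T \<in> ssyt [m]. mset (concat T) = \<alpha>} = (if size \<alpha> = m then {[sorted_list_of_multiset \<alpha>]} else {})"
    unfolding iff by auto
  then show ?thesis by (simp add: schur_def)
qed

lemma schur_column:
  "schur (replicate n 1) \<alpha> = (if size \<alpha> = n \<and> (\<forall>a. count \<alpha> a \<le> 1) then 1 else 0)"
proof -
  let ?l = "sorted_list_of_multiset \<alpha>"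
  let ?P = "size \<alpha> = n \<and> (\<forall>a. count \<alpha> a \<le> 1)"
  have distinct: "distinct l \<longleftrightarrow> (\<forall>a. count (mset l) a \<le> 1)" for l :: "nat list"
  proof -
    have "count (mset l) a = (if a \<in> set l then 1 else 0) \<longleftrightarrow> count (mset l) a \<le> 1" for a
    proof (cases "a \<in> set l")
      case True
      then have "1 \<le> count (mset l) a" by (simp add: Suc_le_eq)
      then show ?thesis using True by (auto intro: le_antisym)
    next
      case False
      then have "count (mset l) a = 0" by simp
      then show ?thesis unfolding \<open>count (mset l) a = 0\<close> using False by simp
    qed
    then show ?thesis by (simp only: distinct_count_atmost_1)
  qed
  have ssyt: "map (\<lambda>a. [a]) l \<in> ssyt (replicate n 1) \<longleftrightarrow> length l = n \<and> sorted_wrt (<) l" for l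
  proof -
    let ?T = "map (\<lambda>a. [a]) l"
    have "(Suc i < length ?T \<and> j < length (?T ! Suc i) \<longrightarrow> ?T ! i ! j < ?T ! Suc i ! j)
        \<longleftrightarrow> (Suc i < length l \<longrightarrow> j = 0 \<longrightarrow> l ! i < l ! Suc i)" for i j
      by auto
    moreover have "map length ?T = replicate n 1 \<longleftrightarrow> length l = n"
      by (auto simp: list_eq_iff_nth_eq)
    ultimately show ?thesis by (auto simp: ssyt_def sorted_wrt_iff_nth_Suc_transp)
  qed
  have iff: "T \<in> ssyt (replicate n 1) \<and> mset (concat T) = \<alpha> \<longleftrightarrow> ?P \<and> T = map (\<lambda>a. [a]) ?l" for T
  proof
    assume a: "T \<in> ssyt (replicate n 1) \<and> mset (concat T) = \<alpha>"
    define l where "l = map hd T"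
    have "map length T = replicate n 1" using a by (simp add: ssyt_def)
    then have "\<forall>r\<in>set T. length r = 1" by (metis in_set_replicate in_set_conv_nth length_map nth_map)
    then have "[hd r] = r" if "r \<in> set T" for r using that by (cases r) auto
    then have T: "T = map (\<lambda>a. [a]) l" unfolding l_def by (simp add: map_idI)
    then have l: "length l = n" "sorted_wrt (<) l" "mset l = \<alpha>" using a ssyt[of l] by auto
    then have "distinct l" "sorted l" by (simp_all add: strict_sorted_iff)
    have "?l = l"
      unfolding l(3)[symmetric] sorted_list_of_multiset_mset by (rule sorted_sort_id[OF \<open>sorted l\<close>])
    moreover have "size (mset l) = n" "\<forall>a. count (mset l) a \<le> 1"
      using l(1) distinct[of l] \<open>distinct l\<close> by simp_all
    then have "?P" unfolding l(3) by blast
    ultimately show "?P \<and> T = map (\<lambda>a. [a]) ?l" using T by simp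
  next
    assume a: "?P \<and> T = map (\<lambda>a. [a]) ?l"
    then have "distinct ?l" using distinct[of ?l] by simp
    then have "sorted_wrt (<) ?l" by (simp add: strict_sorted_iff)
    moreover have "length ?l = n" using a by (simp flip: size_mset)
    ultimately show "T \<in> ssyt (replicate n 1) \<and> mset (concat T) = \<alpha>" using a ssyt[of ?l] by simp
  qed
  have "{T \<in> ssyt (replicate n 1). mset (concat T) = \<alpha>} = (if ?P then {map (\<lambda>a. [a]) ?l} else {})"
    unfolding iff by auto
  then show ?thesis by (simp add: schur_def)
qed

lemma inj_copy_index: "inj copy_index"
proof (rule injI)
  fix p q :: "monom \<times> nat" assume e: "copy_index p = copy_index q"
  obtain \<alpha> k \<beta> l where p: "p = (\<alpha>, k)" and q: "q = (\<beta>, l)" by fastforce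
  have "sorted_list_of_multiset \<alpha> = sorted_list_of_multiset \<beta>" "k = l"
    using e by (auto simp: copy_index_def p q)
  then show "p = q" unfolding p q by (metis mset_sorted_list_of_multiset)
qed

lemma letters_subset:
  assumes "A \<in># B"
  shows "set_mset A \<subseteq> set_mset (\<Sum>\<^sub># B)"
  using assms by auto

lemma set_super_monom_of: "set_mset (super_monom_of \<gamma> \<delta>) = Inl ` set_mset \<gamma> \<union> Inr ` set_mset \<delta>"
  by (simp add: super_monom_of_def)

lemma super_plethysm_letters:
  assumes "B \<in> super_plethysm n m \<gamma> \<delta>" "A \<in># B"
  shows "set_mset A \<subseteq> Inl ` set_mset \<gamma> \<union> Inr ` set_mset \<delta>"
proof -
  have "\<Sum>\<^sub># B = super_monom_of \<gamma> \<delta>" using assms(1) by (simp add: super_plethysm_def)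
  then show ?thesis using letters_subset[OF assms(2)] by (simp only: set_super_monom_of)
qed

text \<open>The coefficients of \<open>h\<^sub>m\<close> are 0 or 1, so the only copy number is 0
  and a monomial in the \<open>y\<close>'s is a multiset of monomials of degree \<open>m\<close>.
  Written in even letters, each of them has exactly \<open>m\<close> even letters, so the rule
  against repetition depends on the parity of \<open>m\<close> alone, as in
  \<open>f\<close>.\<close>

lemma plethysm_eq_card:
  assumes f: "\<And>\<beta>. f \<beta> = (if size \<beta> = n \<and> (odd m \<longrightarrow> (\<forall>a. count \<beta> a \<le> 1)) then 1 else 0)"
  shows "plethysm f (schur [m]) \<gamma> = int (card (super_plethysm n m \<gamma> {#}))"
proof -
  define S where "S = {B. f (image_mset copy_index B) \<noteq> 0 \<and> (\<forall>(\<alpha>, k) \<in># B. int k < schur [m] \<alpha>) \<and>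
      (\<Sum>y\<in>#B. fst y) = \<gamma>}"
  have "plethysm f (schur [m]) \<gamma> = (\<Sum>B\<in>S. 1)"
    unfolding plethysm_def S_def[symmetric]
  proof (rule sum.cong[OF refl])
    fix B assume "B \<in> S"
    then have "f (image_mset copy_index B) \<noteq> 0" by (simp add: S_def)
    then show "f (image_mset copy_index B) = 1" unfolding f by (auto split: if_splits)
  qed
  then have pl: "plethysm f (schur [m]) \<gamma> = int (card S)" by simp
  let ?F = "image_mset (\<lambda>(\<alpha>, k :: nat). image_mset Inl \<alpha> :: super_monom)"
  let ?G = "image_mset (\<lambda>A :: super_monom. (image_mset projl A, 0 :: nat))"
  have S: "size B = n" "odd m \<Longrightarrow> count B p \<le> 1" "(\<alpha>, k) \<in># B \<Longrightarrow> k = 0 \<and> size \<alpha> = m" "(\<Sum>y\<in>#B. fst y) = \<gamma>"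
    if "B \<in> S" for B \<alpha> k p
  proof -
    have "f (image_mset copy_index B) \<noteq> 0" using that by (simp add: S_def)
    then have "size B = n \<and> (odd m \<longrightarrow> (\<forall>a. count (image_mset copy_index B) a \<le> 1))"
      unfolding f by (auto split: if_splits)
    moreover have "count (image_mset copy_index B) (copy_index p) = count B p"
      by (rule count_image_mset_inj_on) (rule inj_on_subset[OF inj_copy_index subset_UNIV])
    ultimately show "size B = n" "odd m \<Longrightarrow> count B p \<le> 1" by metis+
    show "(\<alpha>, k) \<in># B \<Longrightarrow> k = 0 \<and> size \<alpha> = m" using that by (force simp: S_def schur_row split: if_splits)
    show "(\<Sum>y\<in>#B. fst y) = \<gamma>" using that by (simp add: S_def)
  qed
  have projl: "image_mset projl (image_mset Inl \<alpha>) = \<alpha>" for \<alpha> :: monom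
    by (simp add: multiset.map_comp o_def)
  have inl: "image_mset Inl (image_mset projl A) = A" if "B \<in> super_plethysm n m \<gamma> {#}" "A \<in># B" for A B
  proof -
    have "set_mset A \<subseteq> Inl ` set_mset \<gamma>"
      using super_plethysm_letters[OF that] by simp
    then have "Inl (projl a) = a" if "a \<in># A" for a using that by auto
    then show ?thesis by (simp add: multiset.map_comp o_def cong: image_mset_cong)
  qed
  have ev: "even_letters (image_mset Inl \<alpha>) = size \<alpha>" for \<alpha>
    by (simp add: even_letters_def filter_mset_image_mset)
  have bij: "bij_betw ?F S (super_plethysm n m \<gamma> {#})"
  proof (rule bij_betw_byWitness[where f' = ?G])
    show "\<forall>B\<in>S. ?G (?F B) = B"
    proof
      fix B assume B: "B \<in> S"
      have "?G (?F B) = image_mset (\<lambda>p. p) B"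
        unfolding multiset.map_comp using S(3)[OF B] projl by (intro image_mset_cong) auto
      then show "?G (?F B) = B" by simp
    qed
    show "\<forall>B\<in>super_plethysm n m \<gamma> {#}. ?F (?G B) = B"
    proof
      fix B assume B: "B \<in> super_plethysm n m \<gamma> {#}"
      have "?F (?G B) = image_mset (\<lambda>p. p) B"
        unfolding multiset.map_comp using inl[OF B] by (intro image_mset_cong) auto
      then show "?F (?G B) = B" by simp
    qed
    show "?F ` S \<subseteq> super_plethysm n m \<gamma> {#}"
    proof
      fix C assume "C \<in> ?F ` S"
      then obtain B where B: "B \<in> S" and C: "C = ?F B" by blast
      have "super_factor m A \<and> (odd (even_letters A) \<longrightarrow> count C A \<le> 1)" if AC: "A \<in># C" for A
      proof -
        obtain \<alpha> k where ak: "(\<alpha>, k) \<in># B" "A = image_mset Inl \<alpha>" using AC unfolding C by auto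
        then have k: "k = 0" "size \<alpha> = m" using S(3)[OF B] by blast+
        have inj: "inj_on (\<lambda>(\<alpha>, k). image_mset Inl \<alpha> :: super_monom) (insert (\<alpha>, k) (set_mset B))"
        proof (rule inj_onI)
          fix p q assume pq: "p \<in> insert (\<alpha>, k) (set_mset B)" "q \<in> insert (\<alpha>, k) (set_mset B)"
            "(case p of (\<alpha>, k) \<Rightarrow> (image_mset Inl \<alpha> :: super_monom)) = (case q of (\<alpha>, k) \<Rightarrow> image_mset Inl \<alpha>)"
          then have "image_mset Inl (fst p) = (image_mset Inl (fst q) :: super_monom)" by (simp add: case_prod_beta)
          then have "fst p = fst q" using projl by metis
          moreover have "p \<in># B" "q \<in># B" using pq(1,2) ak(1) by auto
          then have "snd p = snd q" using S(3)[OF B, of "fst p" "snd p"] S(3)[OF B, of "fst q" "snd q"] by simp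
          ultimately show "p = q" by (simp add: prod_eq_iff)
        qed
        have "count C A = count B (\<alpha>, k)" using count_image_mset_inj_on[OF inj] unfolding C ak(2) by simp
        moreover have "odd m \<Longrightarrow> count B (\<alpha>, k) \<le> 1" by (rule S(2)[OF B])
        ultimately show ?thesis
          using k(2) by (auto simp: ak(2) ev super_factor_def count_image_Inl)
      qed
      moreover have "\<Sum>\<^sub># (?F B) = image_mset Inl (\<Sum>y\<in>#B. fst y)"
        by (induction B) (auto simp: case_prod_beta)
      ultimately show "C \<in> super_plethysm n m \<gamma> {#}"
        using S(1,4)[OF B] by (simp add: super_plethysm_def super_products_def super_monom_of_def C)
    qed
    show "?G ` super_plethysm n m \<gamma> {#} \<subseteq> S"
    proof
      fix C assume "C \<in> ?G ` super_plethysm n m \<gamma> {#}"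
      then obtain B where B: "B \<in> super_plethysm n m \<gamma> {#}" and C: "C = ?G B" by blast
      have Bp: "size B = n" "\<And>A. A \<in># B \<Longrightarrow> size A = m" "\<And>A. A \<in># B \<Longrightarrow> odd (even_letters A) \<Longrightarrow> count B A \<le> 1"
        "\<Sum>\<^sub># B = image_mset Inl \<gamma>"
        using B by (auto simp: super_plethysm_def super_products_def super_factor_def super_monom_of_def)
      have evB: "even_letters A = m" if "A \<in># B" for A
        using ev[of "image_mset projl A"] inl[OF B that] Bp(2)[OF that] by simp
      have "count (image_mset copy_index C) a \<le> 1" if "odd m" for a
      proof (cases "a \<in># image_mset copy_index C")
        case True
        let ?h = "copy_index \<circ> (\<lambda>A :: super_monom. (image_mset projl A, 0))"
        have hC: "image_mset copy_index C = image_mset ?h B" by (simp only: C multiset.map_comp)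
        then obtain A where A: "A \<in># B" "a = ?h A" using True by auto
        have "inj_on ?h (insert A (set_mset B))"
        proof (rule inj_onI)
          fix p q assume pq: "p \<in> insert A (set_mset B)" "q \<in> insert A (set_mset B)" "?h p = ?h q"
          then have "p \<in># B" "q \<in># B" using A(1) by auto
          moreover have "image_mset projl p = image_mset projl q"
            using injD[OF inj_copy_index] pq(3) by fastforce
          ultimately show "p = q" using inl[OF B] by metis
        qed
        then have "count (image_mset copy_index C) a = count B A"
          unfolding hC A(2) by (rule count_image_mset_inj_on)
        then show ?thesis using Bp(3)[OF A(1)] evB[OF A(1)] that by simp
      next
        case False
        then have "count (image_mset copy_index C) a = 0" by (simp only: not_in_iff)
        then show ?thesis by (simp only: zero_le_one)
      qed
      then have "f (image_mset copy_index C) \<noteq> 0" using Bp(1) by (simp add: f C)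
      moreover have "int k < schur [m] \<alpha>" if "(\<alpha>, k) \<in># C" for \<alpha> k
        using that Bp(2) by (auto simp: C schur_row)
      moreover have "(\<Sum>y\<in>#?G B. fst y) = image_mset projl (\<Sum>\<^sub># B)" by (induction B) auto
      then have "(\<Sum>y\<in>#C. fst y) = \<gamma>" using Bp(4) projl by (simp add: C)
      ultimately show "C \<in> S" unfolding S_def by auto
    qed
  qed
  show ?thesis unfolding pl bij_betw_same_card[OF bij] ..
qed

lemma size_sum_mset_const:
  fixes B :: "'a multiset multiset"
  shows "(\<And>A. A \<in># B \<Longrightarrow> size A = m) \<Longrightarrow> size (\<Sum>\<^sub># B) = size B * m"
  by (induction B) auto

lemma super_plethysm_size:
  assumes "B \<in> super_plethysm n m \<gamma> \<delta>"
  shows "size \<gamma> + size \<delta> = m * n"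
proof -
  have "size (\<Sum>\<^sub># B) = size B * m"
    using assms by (intro size_sum_mset_const) (auto simp: super_plethysm_def super_products_def super_factor_def)
  moreover have "size B = n" "\<Sum>\<^sub># B = super_monom_of \<gamma> \<delta>"
    using assms by (auto simp: super_plethysm_def super_products_def)
  ultimately show ?thesis by (simp add: super_monom_of_def mult.commute)
qed

text \<open>Renaming even letters keeps the parity of every factor; this is the symmetry that
  \<open>kostka_span\<close> asks for.\<close>

lemma card_super_plethysm_rename:
  assumes invol: "\<And>i. \<sigma> (\<sigma> i) = i"
  shows "card (super_plethysm n m (image_mset \<sigma> \<gamma>) {#}) = card (super_plethysm n m \<gamma> {#})"
proof -
  let ?r = "map_sum \<sigma> id :: nat + nat \<Rightarrow> nat + nat"
  let ?R = "image_mset (image_mset ?r)"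
  have rr: "?r (?r a) = a" for a using invol by (cases a) auto
  have "?r \<circ> ?r = id" using rr by auto
  then have RR0: "image_mset ?r (image_mset ?r A) = A" for A by (simp add: multiset.map_comp)
  then have "image_mset ?r \<circ> image_mset ?r = id" by auto
  then have RR: "?R (?R B) = B" for B by (simp add: multiset.map_comp)
  have inj: "inj (image_mset ?r)" using RR0 by (metis injI)
  have cr: "count (image_mset ?r A) (Inr j) = count A (Inr j)" for A j
  proof (induction A)
    case (add a A)
    then show ?case by (cases a) auto
  qed simp
  have er: "even_letters (image_mset ?r A) = even_letters A" for A
  proof (induction A)
    case (add a A)
    then show ?case by (cases a) (auto simp: even_letters_def)
  qed (simp add: even_letters_def)
  have step: "?R B \<in> super_plethysm n m (image_mset \<sigma> \<gamma>) {#}" if B: "B \<in> super_plethysm n m \<gamma> {#}" for B \<gamma>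
  proof -
    have "super_factor m C \<and> (odd (even_letters C) \<longrightarrow> count (?R B) C \<le> 1)" if CB: "C \<in># ?R B" for C
    proof -
      obtain A where A: "A \<in># B" "C = image_mset ?r A" using CB unfolding set_image_mset by blast
      have "count (?R B) C = count B A" unfolding A(2)
        by (rule count_image_mset_inj_on) (rule inj_on_subset[OF inj subset_UNIV])
      then show ?thesis using A B by (auto simp: super_plethysm_def super_products_def super_factor_def cr er)
    qed
    moreover have "\<Sum>\<^sub># (?R B) = super_monom_of (image_mset \<sigma> \<gamma>) {#}"
      using B by (simp add: sum_mset_image_image super_plethysm_def super_monom_of_def multiset.map_comp o_def)
    moreover have "size (?R B) = n" using B by (simp add: super_plethysm_def super_products_def)
    ultimately show ?thesis by (simp add: super_plethysm_def super_products_def)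
  qed
  have "image_mset \<sigma> (image_mset \<sigma> \<gamma>) = \<gamma>" using invol by (simp add: multiset.map_comp o_def)
  then have "bij_betw ?R (super_plethysm n m (image_mset \<sigma> \<gamma>) {#}) (super_plethysm n m \<gamma> {#})"
    using step[of _ \<gamma>] step[of _ "image_mset \<sigma> \<gamma>"] RR by (intro bij_betw_byWitness[where f' = ?R]) auto
  then show ?thesis by (rule bij_betw_same_card)
qed

section \<open>Multigraphs and the plethysm in odd letters\<close>

text \<open>A set of \<open>m\<close> out of \<open>m + 2\<close> odd letters, recorded by the pair
  of letters that it omits.\<close>

definition edge_factor :: "nat \<Rightarrow> nat \<times> nat \<Rightarrow> super_monom" where
  "edge_factor N p = image_mset Inr (mset_set ({..<N} - {fst p, snd p}))"

definition edge_product :: "nat \<Rightarrow> (nat \<times> nat \<Rightarrow> nat) \<Rightarrow> super_monom multiset" where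
  "edge_product N e = (\<Sum>p\<in>pairs N. replicate_mset (e p) (edge_factor N p))"

lemma count_edge_factor:
  "count (edge_factor N p) (Inl i) = 0"
  "count (edge_factor N p) (Inr l) = (if l < N \<and> l \<noteq> fst p \<and> l \<noteq> snd p then 1 else 0)"
  by (simp_all add: edge_factor_def count_image_Inr count_mset_set')

lemma size_edge_factor: "p \<in> pairs (m + 2) \<Longrightarrow> size (edge_factor (m + 2) p) = m"
  by (auto simp: edge_factor_def pairs_def card_Diff_subset)

lemma inj_on_edge_factor: "inj_on (edge_factor N) (pairs N)"
proof (rule inj_onI)
  fix p q assume p: "p \<in> pairs N" and q: "q \<in> pairs N" and e: "edge_factor N p = edge_factor N q"
  have "l = fst p \<or> l = snd p \<longleftrightarrow> l = fst q \<or> l = snd q" if "l < N" for l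
    using arg_cong[OF e, of "\<lambda>A. count A (Inr l)"] that by (simp add: count_edge_factor split: if_splits)
  then show "p = q" using p q unfolding pairs_def by (auto simp: prod_eq_iff) (metis nat_neq_iff less_trans)+
qed

lemma count_edge_product: "q \<in> pairs N \<Longrightarrow> count (edge_product N e) (edge_factor N q) = e q"
proof -
  assume q: "q \<in> pairs N"
  have "count (edge_product N e) (edge_factor N q) = (\<Sum>p\<in>pairs N. if p = q then e q else 0)"
    unfolding edge_product_def count_sum
    by (intro sum.cong) (use inj_onD[OF inj_on_edge_factor, of N] q in auto)
  then show ?thesis using q finite_pairs by simp
qed

lemma set_edge_product: "A \<in># edge_product N e \<Longrightarrow> A \<in> edge_factor N ` pairs N"
  unfolding edge_product_def by (auto simp: set_mset_sum finite_pairs split: if_splits)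

lemma size_edge_product: "size (edge_product N e) = (\<Sum>p\<in>pairs N. e p)"
  unfolding edge_product_def by simp

lemma count_sum_edge_product: "count (\<Sum>\<^sub># (edge_product N e)) a = (\<Sum>p\<in>pairs N. e p * count (edge_factor N p) a)"
proof -
  have r: "count (\<Sum>\<^sub># (replicate_mset k A)) a = k * count A a" for k and A :: super_monom
    by (induction k) auto
  have "finite P \<Longrightarrow> count (\<Sum>\<^sub># (\<Sum>p\<in>P. replicate_mset (e p) (edge_factor N p))) a
      = (\<Sum>p\<in>P. e p * count (edge_factor N p) a)" for P
    by (induction P rule: finite_induct) (auto simp: r)
  then show ?thesis unfolding edge_product_def using finite_pairs by blast
qed

text \<open>Each factor either contains the letter \<open>l\<close> or belongs to an edge at
  \<open>l\<close>.\<close>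

lemma degree_edge_product:
  assumes "l < N"
  shows "count (\<Sum>\<^sub># (edge_product N e)) (Inr l) + degree_at N e l = size (edge_product N e)"
  unfolding count_sum_edge_product degree_at_def size_edge_product sum.distrib[symmetric]
  using assms by (intro sum.cong) (auto simp: count_edge_factor)

lemma handshake: "(\<Sum>l<N. degree_at N e l) = 2 * (\<Sum>p\<in>pairs N. e p)"
proof -
  have "(\<Sum>l<N. degree_at N e l) = (\<Sum>p\<in>pairs N. \<Sum>l<N. if l = fst p \<or> l = snd p then e p else 0)"
    unfolding degree_at_def by (rule sum.swap)
  also have "\<dots> = (\<Sum>p\<in>pairs N. 2 * e p)"
  proof (rule sum.cong[OF refl])
    fix p assume p: "p \<in> pairs N"
    have "(\<Sum>l<N. if l = fst p \<or> l = snd p then e p else 0) = (\<Sum>l\<in>{fst p, snd p}. e p)"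
      by (rule sum.mono_neutral_cong_right) (use p in \<open>auto simp: pairs_def\<close>)
    then show "(\<Sum>l<N. if l = fst p \<or> l = snd p then e p else 0) = 2 * e p"
      using p by (auto simp: pairs_def)
  qed
  finally show ?thesis by (simp add: sum_distrib_left)
qed

lemma odd_factor_is_edge_factor:
  assumes B: "B \<in> super_plethysm n m {#} \<delta>" and \<delta>: "set_mset \<delta> \<subseteq> {..<m + 2}" and A: "A \<in># B"
  shows "A \<in> edge_factor (m + 2) ` pairs (m + 2)"
proof -
  let ?N = "m + 2"
  have sub: "set_mset A \<subseteq> Inr ` {..<?N}"
    using super_plethysm_letters[OF B A] \<delta> by fastforce
  have f: "size A = m" "\<And>j. count A (Inr j) \<le> 1"
    using B A by (auto simp: super_plethysm_def super_products_def super_factor_def)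
  define S where "S = {l. Inr l \<in># A}"
  have S: "S \<subseteq> {..<?N}" using sub by (auto simp: S_def)
  then have fin: "finite S" using finite_subset by blast
  have AS: "A = image_mset Inr (mset_set S)"
  proof (rule super_eqI)
    fix i
    have "Inl i \<notin># A" using sub by auto
    then show "count A (Inl i) = count (image_mset Inr (mset_set S)) (Inl i)"
      by (simp add: count_image_Inr not_in_iff)
    show "count A (Inr i) = count (image_mset Inr (mset_set S)) (Inr i)"
    proof (cases "Inr i \<in># A")
      case True
      then have "1 \<le> count A (Inr i)" by (simp add: Suc_le_eq)
      then have "count A (Inr i) = 1" using f(2)[of i] by (rule le_antisym[rotated])
      then show ?thesis using True fin by (simp add: count_image_Inr S_def)
    next
      case False
      then show ?thesis using fin by (simp add: count_image_Inr S_def not_in_iff)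
    qed
  qed
  then have "card S = m" using f(1) by simp
  then have "card ({..<?N} - S) = 2" using S fin by (simp add: card_Diff_subset)
  then obtain a b where ab: "{..<?N} - S = {a, b}" "a \<noteq> b" by (auto simp: card_2_iff)
  define p where "p = (min a b, max a b)"
  have "a < ?N" "b < ?N" using ab(1) by auto
  then have "p \<in> pairs ?N" using ab(2) by (auto simp: p_def pairs_def min_def max_def)
  moreover have "S = {..<?N} - {fst p, snd p}" using ab(1) S by (auto simp: p_def min_def max_def)
  then have "A = edge_factor ?N p" unfolding AS edge_factor_def by simp
  ultimately show ?thesis by blast
qed

text \<open>Factors without even letters may be repeated, so a product is given by arbitrary edge
  multiplicities. The letter \<open>l\<close> is missing in \<open>n - count \<delta> l\<close> of
  the \<open>n\<close> factors, which is the degree of the vertex \<open>l\<close>.\<close>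

lemma card_super_plethysm_odd:
  assumes \<delta>: "set_mset \<delta> \<subseteq> {..<m + 2}" "size \<delta> = m * n" "\<And>i. count \<delta> i \<le> n"
  shows "card (super_plethysm n m {#} \<delta>) = card (graphs (m + 2) (\<lambda>i. n - count \<delta> i))"
proof -
  let ?N = "m + 2"
  let ?E = "edge_factor ?N" and ?P = "edge_product ?N"
  let ?S = "super_plethysm n m {#} \<delta>" and ?G = "graphs ?N (\<lambda>i. n - count \<delta> i)"
  define \<Phi> where "\<Phi> = (\<lambda>B p. if p \<in> pairs ?N then count B (?E p) else 0)"
  have d0: "count \<delta> l = 0" if "\<not> l < ?N" for l
  proof -
    have "l \<notin># \<delta>" using \<delta>(1) that by auto
    then show ?thesis by (simp add: not_in_iff)
  qed
  have P\<Phi>: "?P (\<Phi> B) = B" if B: "B \<in> ?S" for B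
  proof (rule multiset_eqI)
    fix A
    show "count (?P (\<Phi> B)) A = count B A"
    proof (cases "A \<in> ?E ` pairs ?N")
      case True
      then obtain p where p: "p \<in> pairs ?N" "A = ?E p" by blast
      then show ?thesis using count_edge_product[OF p(1), of "\<Phi> B"] by (simp only: \<Phi>_def if_True)
    next
      case False
      then have "A \<notin># ?P (\<Phi> B)" "A \<notin># B"
        using set_edge_product odd_factor_is_edge_factor[OF B \<delta>(1)] by blast+
      then show ?thesis by (simp add: not_in_iff)
    qed
  qed
  have \<Phi>G: "\<Phi> B \<in> ?G" if B: "B \<in> ?S" for B
  proof -
    have "degree_at ?N (\<Phi> B) l = n - count \<delta> l" if "l < ?N" for l
    proof -
      have "count (\<Sum>\<^sub># B) (Inr l) + degree_at ?N (\<Phi> B) l = size B"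
        using degree_edge_product[OF that, of "\<Phi> B"] unfolding P\<Phi>[OF B] .
      moreover have "count (\<Sum>\<^sub># B) (Inr l) = count \<delta> l" "size B = n"
        using B by (auto simp: super_plethysm_def super_products_def)
      ultimately show ?thesis by simp
    qed
    then show ?thesis by (simp add: graphs_def \<Phi>_def)
  qed
  have \<Phi>P: "\<Phi> (?P e) = e" if e: "e \<in> ?G" for e
  proof
    fix p
    show "\<Phi> (?P e) p = e p"
    proof (cases "p \<in> pairs ?N")
      case True
      then show ?thesis using count_edge_product[OF True, of e] by (simp add: \<Phi>_def)
    next
      case False
      then have "e p = 0" using e unfolding graphs_def by blast
      then show ?thesis using False by (simp add: \<Phi>_def)
    qed
  qed
  have PS: "?P e \<in> ?S" if e: "e \<in> ?G" for e
  proof -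
    have d: "degree_at ?N e l = n - count \<delta> l" if "l < ?N" for l using e that by (simp add: graphs_def)
    have "size \<delta> = sum (count \<delta>) {..<?N}"
      unfolding size_multiset_overloaded_eq using \<delta>(1)
      by (intro sum.mono_neutral_left) (auto simp: not_in_iff)
    moreover have "(\<Sum>l<?N. n - count \<delta> l) + (\<Sum>l<?N. count \<delta> l) = (\<Sum>l<?N. n)"
      unfolding sum.distrib[symmetric] using \<delta>(3) by (intro sum.cong) auto
    moreover have "(\<Sum>l<?N. n - count \<delta> l) = 2 * (\<Sum>p\<in>pairs ?N. e p)"
      using d by (simp flip: handshake)
    \<comment> \<open>The degree sum is \<open>(m + 2) * n - m * n\<close>, so there are exactly
      \<open>n\<close> edges and hence \<open>n\<close> factors.\<close>
    ultimately have "2 * (\<Sum>p\<in>pairs ?N. e p) + m * n = (m + 2) * n"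
      using \<delta>(2) by simp
    then have sz: "size (?P e) = n" unfolding size_edge_product by (simp add: algebra_simps)
    have "super_factor m A \<and> (odd (even_letters A) \<longrightarrow> count (?P e) A \<le> 1)" if A: "A \<in># ?P e" for A
    proof -
      obtain p where p: "p \<in> pairs ?N" "A = ?E p" using set_edge_product[OF A] by blast
      have "even_letters A = 0" unfolding p(2) even_letters_def edge_factor_def
        by (simp add: filter_mset_image_mset)
      then show ?thesis using size_edge_factor[OF p(1)] by (simp add: super_factor_def p(2) count_edge_factor)
    qed
    moreover have "\<Sum>\<^sub># (?P e) = super_monom_of {#} \<delta>"
    proof (rule super_eqI)
      show "count (\<Sum>\<^sub># (?P e)) (Inl i) = count (super_monom_of {#} \<delta>) (Inl i)" for i
        by (simp add: count_sum_edge_product count_edge_factor)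
      show "count (\<Sum>\<^sub># (?P e)) (Inr l) = count (super_monom_of {#} \<delta>) (Inr l)" for l
      proof (cases "l < ?N")
        case True
        then show ?thesis using degree_edge_product[OF True, of e] d[OF True] sz \<delta>(3)[of l] by simp
      next
        case False
        then show ?thesis using d0[OF False] by (simp add: count_sum_edge_product count_edge_factor)
      qed
    qed
    ultimately show ?thesis using sz by (simp add: super_plethysm_def super_products_def)
  qed
  have "bij_betw \<Phi> ?S ?G"
    by (rule bij_betw_byWitness[where f' = ?P]) (use P\<Phi> \<Phi>G \<Phi>P PS in auto)
  then show ?thesis by (rule bij_betw_same_card)
qed

lemma super_plethysm_count_le:
  assumes "B \<in> super_plethysm n m \<gamma> \<delta>"
  shows "count \<delta> l \<le> n"
proof -
  have le: "(\<And>A. A \<in># B \<Longrightarrow> count A (Inr l) \<le> 1) \<Longrightarrow> count (\<Sum>\<^sub># B) (Inr l) \<le> size B" for B :: "super_monom multiset"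
  proof (induction B)
    case (add A B)
    then have "count A (Inr l) \<le> 1" "count (\<Sum>\<^sub># B) (Inr l) \<le> size B" by auto
    then show ?case by simp
  qed simp
  have "count A (Inr l) \<le> 1" if "A \<in># B" for A
    using assms that by (simp add: super_plethysm_def super_products_def super_factor_def)
  then have "count (\<Sum>\<^sub># B) (Inr l) \<le> size B" by (rule le)
  then show ?thesis using assms by (simp add: super_plethysm_def super_products_def)
qed

text \<open>The copies of one letter lie in different columns, of which there are
  \<open>x 0\<close>.\<close>

lemma kostka_content_le:
  assumes "x \<in> shapes" "kostka N x g \<noteq> 0" "i < N"
  shows "g i \<le> x 0"
  using assms
proof (induction N arbitrary: x)
  case (Suc N)
  then obtain y where y: "y \<in> hremove x (g N)" "y \<in> shapes" "kostka N y g \<noteq> 0"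
    using ex_kostka_chain by blast
  have h: "hstrip x y" "wt x = wt y + g N" using y(1) by (auto simp: hremove_def)
  show ?case
  proof (cases "i = N")
    case True
    obtain L where L: "\<And>i. L \<le> i \<Longrightarrow> x i = 0" using shapes_bound[OF Suc.prems(1)] by blast
    have xL: "x i = 0" if "Suc L \<le> i" for i using L that by simp
    have yL: "y i = 0" if "L \<le> i" for i using L[OF that] hstripD(2)[OF h(1), of i] by simp
    have "wt x = x 0 + (\<Sum>i<L. x (Suc i))"
      using wt_eq_sum_lessThan[of "Suc L" x, OF xL] by (simp only: sum.lessThan_Suc_shift)
    also have "(\<Sum>i<L. x (Suc i)) \<le> (\<Sum>i<L. y i)" using h(1) by (intro sum_mono) (simp add: hstrip_def)
    also have "(\<Sum>i<L. y i) = wt y" using wt_eq_sum_lessThan[of L y, OF yL] by simp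
    finally show ?thesis using h(2) True by simp
  next
    case False
    then have "g i \<le> y 0" using Suc.IH[OF y(2,3)] Suc.prems(3) by simp
    also have "\<dots> \<le> x 0" using h(1) by (simp add: hstrip_def)
    finally show ?thesis .
  qed
qed simp

section \<open>The coefficient\<close>

declare kostka.simps(2) [simp del] \<comment> \<open>it would unfold \<open>kostka (m + 2)\<close>\<close>

text \<open>Here \<open>y\<close> stands for the conjugate of \<lambda>, so its rows correspond to
  the \<open>m + 2\<close> odd letters.\<close>

definition admissible :: "nat \<Rightarrow> nat \<Rightarrow> (nat \<Rightarrow> nat) \<Rightarrow> bool" where
  "admissible n m y \<longleftrightarrow> in_box (m + 2) n y \<and> box_complement (m + 2) n y \<in> paired"

text \<open>The products become multigraphs with degrees \<open>n - y' i\<close>. Littlewood's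
  identity expands their number, and complementing the shapes leads back to the content
  \<open>y'\<close>. If an exponent exceeds \<open>n\<close>, both sides vanish: an odd letter
  occurs at most once per factor, and a shape in the box has at most \<open>n\<close>
  columns.\<close>

lemma card_super_plethysm_odd_eq_sum_kostka:
  assumes y': "y' \<in> shapes" "wt y' = m * n" "\<And>i. m + 2 \<le> i \<Longrightarrow> y' i = 0"
    and \<delta>: "count \<delta> = y'"
  defines "Y \<equiv> {y \<in> shapes. wt y = m * n \<and> (\<forall>i\<ge>m + 2. y i = 0)}"
  shows "int (card (super_plethysm n m {#} \<delta>)) =
    (\<Sum>y\<in>Y. (if admissible n m y then 1 else 0) * kostka (m + 2) y y')"
proof -
  let ?N = "m + 2"
  have finY: "finite Y"
    by (rule finite_subset[OF _ finite_shapes_wt[of "m * n"]]) (auto simp: Y_def)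
  have set\<delta>: "set_mset \<delta> \<subseteq> {..<?N}"
  proof
    fix i assume "i \<in># \<delta>"
    then have "y' i \<noteq> 0" by (simp flip: \<delta>)
    then show "i \<in> {..<?N}" using y'(3)[of i] by (cases "?N \<le> i") auto
  qed
  have size\<delta>: "size \<delta> = m * n"
  proof -
    have "size \<delta> = sum (count \<delta>) {..<?N}"
      unfolding size_multiset_overloaded_eq using set\<delta>
      by (intro sum.mono_neutral_left) (auto simp: not_in_iff)
    then show ?thesis using y'(2) wt_eq_sum_lessThan[of ?N y', OF y'(3)] by (simp add: \<delta>)
  qed
  let ?A = "{y \<in> Y. admissible n m y}"
  have sumA: "(\<Sum>y\<in>Y. (if admissible n m y then 1 else 0) * kostka ?N y y') = (\<Sum>y\<in>?A. kostka ?N y y')"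
    using finY by (simp add: sum.inter_filter if_distrib[of "\<lambda>a. a * kostka _ _ _"] cong: if_cong)
  show ?thesis
  proof (cases "\<forall>i. y' i \<le> n")
    case True
    let ?g = "\<lambda>i. n - y' i"
    let ?Z = "{z \<in> paired. in_box ?N n z \<and> wt z = 2 * n}"
    have g: "sum ?g {..<?N} = 2 * n"
    proof -
      have "(\<Sum>i<?N. ?g i) + (\<Sum>i<?N. y' i) = (\<Sum>i<?N. n)"
        unfolding sum.distrib[symmetric] using True by (intro sum.cong) auto
      then show ?thesis using y'(2) wt_eq_sum_lessThan[of ?N y', OF y'(3)] by simp
    qed
    have "int (card (super_plethysm n m {#} \<delta>)) = int (card (graphs ?N ?g))"
      using card_super_plethysm_odd[OF set\<delta> size\<delta>] True by (simp add: \<delta>)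
    also have "\<dots> = (\<Sum>z | z \<in> paired \<and> wt z = 2 * n. kostka ?N z ?g)"
      using card_graphs_eq_sum_kostka[of ?N ?g] unfolding g .
    also have "\<dots> = (\<Sum>z\<in>?Z. kostka ?N z ?g)"
    proof (rule sum.mono_neutral_right)
      show "finite {z \<in> paired. wt z = 2 * n}" by (rule finite_paired)
      show "?Z \<subseteq> {z \<in> paired. wt z = 2 * n}" by blast
      show "\<forall>z\<in>{z \<in> paired. wt z = 2 * n} - ?Z. kostka ?N z ?g = 0"
      proof (rule ballI, rule ccontr)
        fix z assume z: "z \<in> {z \<in> paired. wt z = 2 * n} - ?Z" and nz: "kostka ?N z ?g \<noteq> 0"
        then have zp: "z \<in> paired" "wt z = 2 * n" by auto
        then have zs: "z \<in> shapes" by (simp add: paired_def)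
        \<comment> \<open>The two equal first rows of a paired shape of weight \<open>2 * n\<close>
          have length at most \<open>n\<close>, so it fits into the width of the box
          automatically.\<close>
        have "z 0 = z 1" using zp(1) unfolding paired_def by (metis (mono_tags, lifting) mem_Collect_eq mult_zero_right add_0)
        moreover have "z 0 + z 1 \<le> wt z"
        proof -
          obtain L where L: "\<And>i. L \<le> i \<Longrightarrow> z i = 0" using shapes_bound[OF zs] by blast
          have L': "z i = 0" if "L + 2 \<le> i" for i using L that by simp
          have "sum z {0, 1} \<le> sum z {..<L + 2}" by (rule sum_mono2) auto
          then show ?thesis using wt_eq_sum_lessThan[of "L + 2" z, OF L'] by simp
        qed
        ultimately have "z 0 \<le> n" using zp(2) by simp
        then have "z i \<le> n" for i using shapes_antimono[OF zs, of 0 i] by simp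
        then have "in_box ?N n z" using zs kostka_support[OF zs nz] by (simp add: in_box_def)
        then show False using z zp by blast
      qed
    qed
    also have "\<dots> = (\<Sum>y\<in>?A. kostka ?N y y')"
    proof (rule sum.reindex_bij_witness[of _ "box_complement ?N n" "box_complement ?N n"])
      fix z assume z: "z \<in> ?Z"
      then have b: "in_box ?N n z" by blast
      show c: "box_complement ?N n (box_complement ?N n z) = z" by (rule box_complement_involution[OF b])
      have b': "in_box ?N n (box_complement ?N n z)" by (rule box_complement_in_box[OF b])
      moreover have "wt (box_complement ?N n z) = m * n" using wt_box_complement[OF b] z by simp
      ultimately have "box_complement ?N n z \<in> Y" by (simp add: Y_def in_box_def)
      then show "box_complement ?N n z \<in> ?A" using b' c z by (simp add: admissible_def)
      show "kostka ?N (box_complement ?N n z) y' = kostka ?N z ?g"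
        using kostka_box_complement[OF b', of y'] True unfolding c by simp
    next
      fix y assume y: "y \<in> ?A"
      then have b: "in_box ?N n y" by (simp add: admissible_def)
      show "box_complement ?N n (box_complement ?N n y) = y" by (rule box_complement_involution[OF b])
      have "wt (box_complement ?N n y) = 2 * n" using wt_box_complement[OF b] y by (simp add: Y_def)
      then show "box_complement ?N n y \<in> ?Z"
        using box_complement_in_box[OF b] y by (simp add: admissible_def)
    qed
    finally show ?thesis unfolding sumA .
  next
    case False
    then obtain i where i: "n < y' i" by (auto simp: not_le)
    have "super_plethysm n m {#} \<delta> = {}"
      using super_plethysm_count_le[of _ n m "{#}" \<delta> i] i by (auto simp: \<delta>)
    moreover have "(\<Sum>y\<in>?A. kostka ?N y y') = 0"
    proof (rule sum.neutral, rule ballI, rule ccontr)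
      fix y assume y: "y \<in> ?A" and nz: "kostka ?N y y' \<noteq> 0"
      have ys: "y \<in> shapes" using y by (simp add: Y_def)
      have "i < ?N" using y'(3)[of i] i by (cases "?N \<le> i") auto
      then have "y' i \<le> y 0" by (rule kostka_content_le[OF ys nz])
      also have "\<dots> \<le> n" using y by (simp add: admissible_def in_box_def)
      finally show False using i by simp
    qed
    ultimately show ?thesis unfolding sumA by simp
  qed
qed

text \<open>Symmetry alone provides the coefficients \<open>c\<close>. To compute them, all letters
  are made odd, which conjugates the shapes, and the result in \<open>m + 2\<close> letters is
  compared with the explicit expansion there. These letters see the shapes with at most
  \<open>m + 2\<close> rows, which for the conjugate of \<open>x\<close> means
  \<open>x 0 \<le> m + 2\<close>.\<close>

lemma super_plethysm_expansion:
  obtains c where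
    "\<And>N \<gamma>. set_mset \<gamma> \<subseteq> {..<N} \<Longrightarrow> int (card (super_plethysm n m \<gamma> {#}))
      = (\<Sum>x | x \<in> shapes \<and> wt x = m * n. c x * kostka N x (count \<gamma>))"
    "\<And>x. x \<in> shapes \<Longrightarrow> wt x = m * n \<Longrightarrow> x 0 \<le> m + 2 \<Longrightarrow>
      c x = (if admissible n m (conjugate x) then 1 else 0)"
proof -
  let ?N = "m + 2"
  let ?X = "{x \<in> shapes. wt x = m * n}"
  define F where "F = (\<lambda>\<gamma> \<delta>. int (card (super_plethysm n m \<gamma> \<delta>)))"
  have "F (image_mset (transpose i (Suc i)) \<gamma>) {#} = F \<gamma> {#}" for \<gamma> i
    unfolding F_def by (simp add: card_super_plethysm_rename)
  moreover have "size \<gamma> = m * n" if "F \<gamma> {#} \<noteq> 0" for \<gamma>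
  proof -
    have "super_plethysm n m \<gamma> {#} \<noteq> {}" using that by (auto simp: F_def)
    then show ?thesis using super_plethysm_size by fastforce
  qed
  ultimately obtain c where c: "\<And>N \<gamma>. set_mset \<gamma> \<subseteq> {..<N} \<Longrightarrow> F \<gamma> {#} = (\<Sum>x\<in>?X. c x * kostka N x (count \<gamma>))"
    using kostka_span[of "\<lambda>\<gamma>. F \<gamma> {#}" "m * n"] by blast
  have rel: "(\<Sum>k\<le>a. (-1) ^ k * F (\<gamma> + replicate_mset (a - k) N) (\<delta> + replicate_mset k u)) = 0"
    if "set_mset \<gamma> \<subseteq> {..<N}" "u \<notin># \<delta>" "0 < a" for \<gamma> \<delta> N u a
  proof -
    have "N \<notin># \<gamma>" using that(1) by auto
    then show ?thesis unfolding F_def using that by (intro super_plethysm_cancel)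
  qed
  have transposed: "F {#} \<delta> = (\<Sum>y\<in>?X. c (conjugate y) * kostka ?N y (count \<delta>))" if "set_mset \<delta> \<subseteq> {..<?N}" for \<delta>
  proof -
    have "F {#} \<delta> = (\<Sum>x\<in>?X. c x * kostka ?N (conjugate x) (count \<delta>))"
      by (rule odd_letters_kostka[OF rel]) (use finite_shapes_wt c that in auto)
    also have "\<dots> = (\<Sum>y\<in>?X. c (conjugate y) * kostka ?N y (count \<delta>))"
      by (rule sum.reindex_bij_witness[of _ conjugate conjugate])
         (auto simp: conjugate_conjugate conjugate_shapes wt_conjugate)
    finally show ?thesis .
  qed
  let ?Y = "{y \<in> shapes. wt y = m * n \<and> (\<forall>i\<ge>?N. y i = 0)}"
  have finY: "finite ?Y" by (rule finite_subset[OF _ finite_shapes_wt[of "m * n"]]) auto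
  have eq: "c (conjugate y) - (if admissible n m y then 1 else 0) = 0" if "y \<in> ?Y" for y
  proof (rule kostka_independent[OF finY _ _ _ that, of ?N "\<lambda>y. c (conjugate y) - (if admissible n m y then 1 else 0)"])
    fix y' assume y': "y' \<in> ?Y"
    then have fin: "finite {i. 0 < y' i}" by (simp add: shapes_def)
    define \<delta> where "\<delta> = Abs_multiset y'"
    have \<delta>: "count \<delta> = y'" unfolding \<delta>_def using fin by (simp add: Abs_multiset_inverse)
    have "set_mset \<delta> \<subseteq> {..<?N}"
    proof
      fix i assume "i \<in># \<delta>"
      then have "y' i \<noteq> 0" by (simp flip: \<delta>)
      then show "i \<in> {..<?N}" using y' by (cases "?N \<le> i") auto
    qed
    then have "F {#} \<delta> = (\<Sum>y\<in>?X. c (conjugate y) * kostka ?N y y')" using transposed \<delta> by simp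
    also have "\<dots> = (\<Sum>y\<in>?Y. c (conjugate y) * kostka ?N y y')"
    proof (rule sum.mono_neutral_right[OF finite_shapes_wt])
      show "\<forall>y\<in>?X - ?Y. c (conjugate y) * kostka ?N y y' = 0"
      proof
        fix y assume y: "y \<in> ?X - ?Y"
        then obtain i where "?N \<le> i" "y i \<noteq> 0" "y \<in> shapes" by auto
        then have "kostka ?N y y' = 0" using kostka_support[of y ?N y' i] by metis
        then show "c (conjugate y) * kostka ?N y y' = 0" by simp
      qed
    qed auto
    finally have "(\<Sum>y\<in>?Y. c (conjugate y) * kostka ?N y y') = (\<Sum>y\<in>?Y. (if admissible n m y then 1 else 0) * kostka ?N y y')"
      using card_super_plethysm_odd_eq_sum_kostka[of y' m n \<delta>] y' \<delta> unfolding F_def by auto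
    then show "(\<Sum>y\<in>?Y. (c (conjugate y) - (if admissible n m y then 1 else 0)) * kostka ?N y y') = 0"
      by (simp only: left_diff_distrib sum_subtractf diff_self)
  qed auto
  have "c x = (if admissible n m (conjugate x) then 1 else 0)"
    if x: "x \<in> shapes" "wt x = m * n" "x 0 \<le> ?N" for x
  proof -
    have "conjugate x i = 0" if "?N \<le> i" for i
      using less_conjugate_iff[OF x(1), of 0 i] x(3) that by simp
    then have "conjugate x \<in> ?Y" using x by (simp add: conjugate_shapes wt_conjugate)
    then show ?thesis using eq[of "conjugate x"] conjugate_conjugate[OF x(1)] by simp
  qed
  then show ?thesis using that[of c] c unfolding F_def by blast
qed

text \<open>Row \<open>i\<close> of the complement counts the entries of the \<open>n\<close>-tuple
  that are smaller than \<open>m + 2 - i\<close>. So rows \<open>2 * i\<close> and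
  \<open>2 * i + 1\<close> agree exactly if no entry equals \<open>m + 1 - 2 * i\<close>, and these
  values are the numbers up to \<open>m + 1\<close> whose parity is not that of
  \<open>m\<close>.\<close>

lemma admissible_conjugate_iff:
  assumes x: "x \<in> shapes" and n: "\<And>i. n \<le> i \<Longrightarrow> x i = 0" and x0: "x 0 \<le> m + 2"
  shows "admissible n m (conjugate x) \<longleftrightarrow> (\<forall>i<n. even (x i) \<longleftrightarrow> even m)"
proof -
  let ?N = "m + 2"
  let ?y = "conjugate x"
  have c0: "?y i = 0" if "?N \<le> i" for i using less_conjugate_iff[OF x, of 0 i] x0 that by simp
  have cn: "?y i \<le> n" for i using less_conjugate_iff[OF x, of n i] n[of n] by (cases "n < ?y i") auto
  have box: "in_box ?N n ?y" using conjugate_shapes[OF x] c0 cn by (simp add: in_box_def)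
  \<comment> \<open>All indices below \<open>n\<close> are counted, including those of zero
    parts.\<close>
  define u where "u = (\<lambda>k. card {l. l < n \<and> x l < k})"
  have yu: "?y j + u (Suc j) = n" for j
  proof -
    have "x l < Suc j \<longleftrightarrow> \<not> l < ?y j" for l using less_conjugate_iff[OF x, of l j] by auto
    then have "{l. l < n \<and> x l < Suc j} = {..<n} - {..<?y j}" by blast
    then show ?thesis using cn[of j] by (simp add: u_def card_Diff_subset)
  qed
  have z: "box_complement ?N n ?y i = u (?N - i)" for i
  proof (cases "i < ?N")
    case True
    then have "?N - i = Suc (?N - Suc i)" by simp
    then have "?y (?N - Suc i) + u (?N - i) = n" using yu[of "?N - Suc i"] by simp
    then show ?thesis using True by (simp add: box_complement_def)
  next
    case False
    then show ?thesis by (simp add: box_complement_def u_def)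
  qed
  have uS: "u (Suc k) = u k \<longleftrightarrow> (\<forall>l<n. x l \<noteq> k)" for k
  proof -
    have "{l. l < n \<and> x l < Suc k} = {l. l < n \<and> x l < k} \<union> {l. l < n \<and> x l = k}" by auto
    then have "u (Suc k) = u k + card {l. l < n \<and> x l = k}"
      unfolding u_def by (simp add: card_Un_disjoint disjoint_iff)
    then show ?thesis by auto
  qed
  have "box_complement ?N n ?y \<in> shapes" using box_complement_in_box[OF box] by (simp add: in_box_def)
  then have "admissible n m ?y \<longleftrightarrow> (\<forall>i. u (?N - 2 * i) = u (?N - (2 * i + 1)))"
    using box unfolding admissible_def paired_def z[abs_def] by simp
  also have "\<dots> \<longleftrightarrow> (\<forall>l<n. even (x l) \<longleftrightarrow> even m)"
  proof
    assume a: "\<forall>i. u (?N - 2 * i) = u (?N - (2 * i + 1))"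
    show "\<forall>l<n. even (x l) \<longleftrightarrow> even m"
    proof (intro allI impI, rule ccontr)
      fix l assume l: "l < n" and p: "(even (x l)) \<noteq> even m"
      have "x l \<le> ?N" using shapes_antimono[OF x, of 0 l] x0 by simp
      \<comment> \<open>The largest possible entry \<open>m + 2\<close> has the parity of
        \<open>m\<close>, so an entry of the wrong parity lies in the range that the pairs of rows
        control.\<close>
      moreover have "x l \<noteq> ?N" using p by auto
      ultimately have lt: "x l < ?N" by simp
      then have "even (?N - Suc (x l))" using p by (simp add: even_diff_nat)
      then obtain i where i: "?N - Suc (x l) = 2 * i" by blast
      then have "?N - 2 * i = Suc (x l)" "?N - (2 * i + 1) = x l" using lt by linarith+
      then have "u (Suc (x l)) = u (x l)" using a by metis
      then show False using uS l by blast
    qed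
  next
    assume a: "\<forall>l<n. even (x l) \<longleftrightarrow> even m"
    show "\<forall>i. u (?N - 2 * i) = u (?N - (2 * i + 1))"
    proof
      fix i
      show "u (?N - 2 * i) = u (?N - (2 * i + 1))"
      proof (cases "2 * i < ?N")
        case True
        \<comment> \<open>For odd \<open>m\<close> the last of these values is 0, which is where
          zero parts are excluded.\<close>
        let ?k = "?N - (2 * i + 1)"
        have k: "?N - 2 * i = Suc ?k" using True by simp
        have "x l \<noteq> ?k" if "l < n" for l
        proof
          assume "x l = ?k"
          then have "x l + (2 * i + 1) = m + 2" using True by simp
          then show False using a that by (metis even_add even_mult_iff even_numeral odd_one)
        qed
        then show ?thesis unfolding k using uS[of ?k] by blast
      qed simp
    qed
  qed
  finally show ?thesis .
qed

text \<open>The hypothesis on \<open>schur nu\<close> treats both cases at once: it describes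
  \<open>h\<^sub>n\<close> for even \<open>m\<close> and \<open>e\<^sub>n\<close> for odd
  \<open>m\<close>.\<close>

lemma plethysm_coeff_eq:
  assumes f: "\<And>\<beta>. schur nu \<beta> = (if size \<beta> = n \<and> (odd m \<longrightarrow> (\<forall>a. count \<beta> a \<le> 1)) then 1 else 0)"
    and lam: "is_partition lam" "sum_list lam = m * n" "length lam \<le> n" "part lam 0 = m + 2"
  shows "plethysm_coeff nu [m] lam = (if \<forall>i<n. even (part lam i) \<longleftrightarrow> even m then 1 else 0)"
proof -
  let ?X = "{x \<in> shapes. wt x = m * n}"
  obtain c where c: "\<And>N \<gamma>. set_mset \<gamma> \<subseteq> {..<N} \<Longrightarrow> int (card (super_plethysm n m \<gamma> {#}))
      = (\<Sum>x\<in>?X. c x * kostka N x (count \<gamma>))"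
    and cx: "\<And>x. x \<in> shapes \<Longrightarrow> wt x = m * n \<Longrightarrow> x 0 \<le> m + 2 \<Longrightarrow>
      c x = (if admissible n m (conjugate x) then 1 else 0)"
    using super_plethysm_expansion[of n m] by blast
  have "schur_expansion (plethysm (schur nu) (schur [m]))
      (\<lambda>\<mu>. if is_partition \<mu> \<and> part \<mu> \<in> ?X then c (part \<mu>) else 0)"
    by (rule schur_expansionI[OF finite_shapes_wt]) (use c plethysm_eq_card[of "schur nu", OF f] in auto)
  then have "plethysm_coeff nu [m] lam = c (part lam)"
    using hall_inner_schur[OF lam(1)] part_shapes[OF lam(1)] wt_part[of lam] lam(1,2)
    by (simp add: plethysm_coeff_def)
  also have "\<dots> = (if admissible n m (conjugate (part lam)) then 1 else 0)"
    using part_shapes[OF lam(1)] wt_part[of lam] lam(2,4) by (intro cx) auto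
  also have "admissible n m (conjugate (part lam)) \<longleftrightarrow> (\<forall>i<n. even (part lam i) \<longleftrightarrow> even m)"
    using part_shapes[OF lam(1)] part_beyond lam(3,4) by (intro admissible_conjugate_iff) auto
  finally show ?thesis .
qed

theorem theorem4p5:
  fixes m n :: nat and lam :: "nat list"
  assumes "m > 0" and "n > 0"
    and "is_partition lam" and "sum_list lam = m * n"
    and "length lam \<le> n" and "part lam 0 = m + 2"
  shows "(even m \<longrightarrow>
            ((\<forall>i<n. even (part lam i)) \<longrightarrow> plethysm_coeff [n] [m] lam = 1) \<and>
            (\<not> (\<forall>i<n. even (part lam i)) \<longrightarrow> plethysm_coeff [n] [m] lam = 0)) \<and>
         (odd m \<longrightarrow>
            ((\<forall>i<n. odd (part lam i)) \<longrightarrow> plethysm_coeff (replicate n 1) [m] lam = 1) \<and>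
            (\<not> (\<forall>i<n. odd (part lam i)) \<longrightarrow> plethysm_coeff (replicate n 1) [m] lam = 0))"
proof (cases "even m")
  case True
  then have "schur [n] \<beta> = (if size \<beta> = n \<and> (odd m \<longrightarrow> (\<forall>a. count \<beta> a \<le> 1)) then 1 else 0)" for \<beta>
    by (simp add: schur_row)
  from plethysm_coeff_eq[OF this assms(3-6)] show ?thesis using True by simp
next
  case False
  then have "schur (replicate n 1) \<beta> = (if size \<beta> = n \<and> (odd m \<longrightarrow> (\<forall>a. count \<beta> a \<le> 1)) then 1 else 0)" for \<beta>
    unfolding schur_column by simp
  from plethysm_coeff_eq[OF this assms(3-6)] show ?thesis using False by simp
qed

end
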